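(* Let $\mathcal X$ be a compact metrizable space, $\mathcal Y\subset\mathbb R^d$ compact with conical hull $\mathcal Z$, and let $F:\mathcal X\times\mathcal Z\to\mathbb R$ be such that there exist continuous functions $a_k:\mathcal X\to\mathbb R$ and $u_k:\mathcal X\to\mathbb R^d$, $k\ge0$, with $F(x,z)=\sup_{k\ge0}\{u_k(x)\cdot z+a_k(x)\}$ for all $x\in\mathcal X$, $z\in\mathcal Z$. Let $c(x,m)=F\left(x,\int y\,dm\right)$ for $x\in\mathcal X$, $m\in\mathcal M(\mathcal Y)$. Let $\mu\in\mathcal P(\mathcal X)$ and $\nu\in\mathcal P(\mathcal Y)$ be such that $\mathcal I_c(\mu,\nu)<+\infty$, and assume that the convex hull of the support of $\nu$ does not contain $0$. Then $$\mathcal I_c(\mu,\nu)=\inf_{\gamma\le_{phc}\nu}\mathcal T_F(\mu,\gamma),$$ where $\mathcal T_F$ is the classical transport cost $$\mathcal T_F(\mu,\gamma)=\inf_{\pi\in\Pi(\mu,\gamma)}\iint F(x,z)\,\pi(dxdz),\qquad\mu\in\mathcal P(\mathcal X),\ \gamma\in\mathcal P(\mathcal Z).$$ Moreover, suppose that $\bar q$ is a kernel solution of the transport problem $\mathcal I_c(\mu,\nu)$, define $\bar S(x)=\int y\,\bar q^x(dy)$, $x\in\mathcal X$, and let $\bar\nu$ be the image of $\mu$ under $\bar S$. Then: - $\bar\nu$ is dominated by $\nu$ in the positively $1$-homogenous convex order, i.e. $\bar\nu\le_{phc}\nu$; - $\mathcal I_c(\mu,\nu)=\int F(x,\bar S(x))\,\mu(dx)=\inf_{\gamma\le_{phc}\nu}\mathcal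 T_F(\mu,\gamma)$.
   Context: $\mathcal P(E)$: Borel probability measures on $E$; $\mathcal M(\mathcal Y)$: finite nonnegative Borel measures on $\mathcal Y$; $\Pi(\mu,\gamma)$: couplings of $\mu$ and $\gamma$. The conical hull of $\mathcal Y$ is $\mathcal Z=\{\sum_{i=1}^n\lambda_iy_i:\ n\ge1,\ \lambda_i\ge0,\ y_i\in\mathcal Y\}$. For probability measures $\gamma,\nu$ on $\mathbb R^d$ with finite first moments, $\gamma\le_{phc}\nu$ means $\int\varphi\,d\gamma\le\int\varphi\,d\nu$ for all convex $\varphi:\mathbb R^d\to\mathbb R$ with $\varphi(tx)=t\varphi(x)$ for all $t\ge0$, $x\in\mathbb R^d$. In the infimum, $\gamma$ runs over probability measures on $\mathcal Z$ with finite first moment and $\gamma\le_{phc}\nu$. A nonnegative kernel is a family $q=(q^x)_{x\in\mathcal X}$ in $\mathcal M(\mathcal Y)$ with $x\mapsto q^x(A)$ measurable for all Borel $A\subset\mathcal Y$. $\mathcal Q(\mu,\nu)$ is the set of nonnegative kernels with $\int q^x(dy)\,\mu(dx)=\nu(dy)$, and $\mathcal I_c(\mu,\nu)=\inf_{q\in\mathcal Q(\mu,\nu)}\int c(x,q^x)\,\mu(dx)$. A kernel solution is a $\bar q\in\mathcal Q(\mu,\nu)$ attaining this infimum. *)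

theory Defs
  imports "HOL-Probability.Probability"
begin

text \<open>
  A measure on a subset \<open>E\<close> of a topological space lives on \<open>restrict_space borel E\<close>, whose sets
  are the Borel sets of the subspace \<open>E\<close>.
\<close>

definition borel_prob_measures :: "'a::topological_space set \<Rightarrow> 'a measure set" where
  "borel_prob_measures E = {M. prob_space M \<and> sets M = sets (restrict_space borel E)}"

definition borel_finite_measures :: "'a::topological_space set \<Rightarrow> 'a measure set" where
  "borel_finite_measures E = {M. finite_measure M \<and> sets M = sets (restrict_space borel E)}"

definition conical_hull :: "'e::real_vector set \<Rightarrow> 'e set" where
  "conical_hull Y =
     {\<Sum>i<n. l i *\<^sub>R y i | (n::nat) (l :: nat \<Rightarrow> real) (y :: nat \<Rightarrow> 'e).
        n \<ge> 1 \<and> (\<forall>i<n. 0 \<le> l i \<and> y i \<in> Y)}"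

definition measure_support :: "'a::topological_space measure \<Rightarrow> 'a set" where
  "measure_support M =
     {x \<in> space M. \<forall>U. open U \<and> x \<in> U \<longrightarrow> 0 < emeasure M (U \<inter> space M)}"

text \<open>
  Integral of a real function with values in the extended reals. It is the usual integral as soon
  as the positive or the negative part has a finite integral; otherwise its value is \<open>\<infinity>\<close>. The costs
  below are bounded from below by \<open>- C * (1 + norm z)\<close>, so under finite first moments the negative
  part is integrable and only the value \<open>+\<infinity>\<close> can occur besides the real ones.
\<close>

definition ext_integral :: "'a measure \<Rightarrow> ('a \<Rightarrow> real) \<Rightarrow> ereal" where
  "ext_integral M f =
     enn2ereal (\<integral>\<^sup>+x. ennreal (f x) \<partial>M) - enn2ereal (\<integral>\<^sup>+x. ennreal (- f x) \<partial>M)"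

text \<open>
  The positively 1-homogeneous convex order. It is a relation between probability measures with
  finite first moments, and these requirements are part of the definition. The measures may live on
  (different) subsets of the Euclidean space: integrating the restriction of a function against such
  a measure is the same as integrating the function against its image under the inclusion.
  The test functions are continuous and have at most linear growth, so they are integrable.
\<close>

definition phc_le :: "'e::euclidean_space measure \<Rightarrow> 'e measure \<Rightarrow> bool" where
  "phc_le \<gamma> \<nu> \<longleftrightarrow>
     prob_space \<gamma> \<and> prob_space \<nu> \<and> integrable \<gamma> norm \<and> integrable \<nu> norm \<and>
     (\<forall>\<phi> :: 'e \<Rightarrow> real.
        convex_on UNIV \<phi> \<and> (\<forall>t\<ge>0. \<forall>x. \<phi> (t *\<^sub>R x) = t * \<phi> x)
        \<longrightarrow> (\<integral>z. \<phi> z \<partial>\<gamma>) \<le> (\<integral>y. \<phi> y \<partial>\<nu>))"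

definition nonneg_kernels ::
  "'x::topological_space set \<Rightarrow> 'y::topological_space set \<Rightarrow> ('x \<Rightarrow> 'y measure) set" where
  "nonneg_kernels X Y =
     {q. (\<forall>x\<in>X. q x \<in> borel_finite_measures Y) \<and>
         (\<forall>A\<in>sets (restrict_space borel Y).
            (\<lambda>x. emeasure (q x) A) \<in> borel_measurable (restrict_space borel X))}"

definition transport_kernels ::
  "'x::topological_space measure \<Rightarrow> 'y::topological_space measure \<Rightarrow> ('x \<Rightarrow> 'y measure) set" where
  "transport_kernels \<mu> \<nu> =
     {q \<in> nonneg_kernels (space \<mu>) (space \<nu>).
        \<forall>A\<in>sets \<nu>. (\<integral>\<^sup>+x. emeasure (q x) A \<partial>\<mu>) = emeasure \<nu> A}"

definition kernel_transport_cost ::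
  "('x::topological_space \<Rightarrow> 'y::topological_space measure \<Rightarrow> real)
     \<Rightarrow> 'x measure \<Rightarrow> 'y measure \<Rightarrow> ereal" where
  "kernel_transport_cost c \<mu> \<nu> =
     (INF q\<in>transport_kernels \<mu> \<nu>. ext_integral \<mu> (\<lambda>x. c x (q x)))"

definition kernel_solution ::
  "('x::topological_space \<Rightarrow> 'y::topological_space measure \<Rightarrow> real)
     \<Rightarrow> 'x measure \<Rightarrow> 'y measure \<Rightarrow> ('x \<Rightarrow> 'y measure) \<Rightarrow> bool" where
  "kernel_solution c \<mu> \<nu> q \<longleftrightarrow>
     q \<in> transport_kernels \<mu> \<nu> \<and>
     ext_integral \<mu> (\<lambda>x. c x (q x)) = kernel_transport_cost c \<mu> \<nu>"

text \<open>
  For Borel measures on separable metric spaces the product \<open>\<sigma>\<close>-algebra is the Borel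
  \<open>\<sigma>\<close>-algebra of the product space.
\<close>

definition couplings :: "'a measure \<Rightarrow> 'b measure \<Rightarrow> ('a \<times> 'b) measure set" where
  "couplings \<mu> \<gamma> =
     {\<pi>. prob_space \<pi> \<and> sets \<pi> = sets (\<mu> \<Otimes>\<^sub>M \<gamma>) \<and>
         distr \<pi> \<mu> fst = \<mu> \<and> distr \<pi> \<gamma> snd = \<gamma>}"

definition classical_transport_cost ::
  "('a \<Rightarrow> 'b \<Rightarrow> real) \<Rightarrow> 'a measure \<Rightarrow> 'b measure \<Rightarrow> ereal" where
  "classical_transport_cost F \<mu> \<gamma> =
     (INF \<pi>\<in>couplings \<mu> \<gamma>. ext_integral \<pi> (\<lambda>(x, z). F x z))"

end

theory Submission
  imports Defs
begin

text \<open>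
  If \<open>q\<close> transports \<open>\<mu>\<close> to \<open>\<nu>\<close> and \<open>S x\<close> is the barycenter of \<open>q x\<close>, then Jensen's inequality for sublinear
  functions gives \<open>S\<^sub>#\<mu> \<le>\<^sub>p\<^sub>h\<^sub>c \<nu>\<close>, and the coupling \<open>(id, S)\<^sub>#\<mu>\<close> has the cost of \<open>q\<close>.

  Conversely, let \<open>\<pi>\<close> be a coupling of \<open>\<mu>\<close> and \<open>\<gamma> \<le>\<^sub>p\<^sub>h\<^sub>c \<nu>\<close>. It suffices to find a kernel \<open>q\<close> from \<open>\<mu>\<close> to
  \<open>\<nu>\<close> whose barycenters satisfy \<open>\<integral>x\<in>A. S x \<partial>\<mu> = \<integral>(x, z)\<in>A \<times> Z. z \<partial>\<pi>\<close> for all \<open>A\<close>: then \<open>S x\<close> is the conditional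
  expectation of \<open>z\<close> given \<open>x\<close>, and conditional Jensen applied to the convex functions \<open>F x\<close> bounds the cost
  of \<open>q\<close> by that of \<open>\<pi>\<close>. Such a kernel is first sought as a functional \<open>\<beta>(A, f)\<close>, additive in the set \<open>A\<close> and
  linear in the function \<open>f\<close>. For finitely many sets the barycenter condition can be met by a separation
  argument, where the supporting functions are maxima of finitely many linear functions and hence are
  controlled by the order; Tychonoff's theorem then yields all sets at once. Since \<open>0\<close> is not in the convex
  hull of the support of \<open>\<nu>\<close>, a linear function is bounded below by a positive constant on the support, which
  makes \<open>\<beta>\<close> countably additive and absolutely continuous in \<open>A\<close>. Finally \<open>\<beta>\<close> is disintegrated after
  encoding the Euclidean space into the unit interval.
\<close>

section \<open>Disintegration over the unit interval\<close>

text \<open>The kernels carry free mass: the average of \<open>q x\<close> over \<open>\<mu>\<close>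
  is prescribed, the mass of each \<open>q x\<close> is not. So the mass of \<open>\<nu>\<close> at
  \<open>y\<close> may go to whichever \<open>x\<close> suits it best, and the largest value of a
  linear functional of the barycenters is the integral over \<open>\<nu>\<close> of a maximum of
  linear functions of \<open>y\<close>. That maximum has no constant term; it is convex and
  positively homogeneous. This is how homogeneous test functions, and not all convex ones, come in.

  Kernels themselves are a poor domain for compactness: along a sequence their mass may concentrate
  on sets of \<open>x\<close> that shrink to a null set, and the limit has no density. The numbers
  \<open>\<beta> (A, f)\<close> stay in fixed intervals, and pointwise convergence is the only
  topology needed for them. The price is that a limit is only finitely additive in \<open>A\<close>.
  This is repaired after the limit: the mass over \<open>A\<close> is dominated by a component of
  the barycenter over \<open>A\<close>, which is an integral against \<open>\<pi>\<close> and so is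
  countably additive.

  The unit interval is used because the conditional measures are built from distribution
  functions.\<close>

lemma ternary_digit:
  fixes c :: "nat \<Rightarrow> int"
  assumes c: "\<And>i. c i \<in> {0, 1}"
  shows "\<lfloor>3 ^ Suc j * (\<Sum>i. of_int (c i) * (1/3::real) ^ Suc i)\<rfloor> mod 3 = c j"
    and "(\<Sum>i. of_int (c i) * (1/3::real) ^ Suc i) \<in> {0..1/2}"
proof -
  have bounds: "summable (\<lambda>i. of_int (b i) * (1/3::real) ^ Suc i) \<and>
      (\<Sum>i. of_int (b i) * (1/3::real) ^ Suc i) \<in> {0..1/2}"
    if b: "\<And>i. b i \<in> {0, 1}" for b :: "nat \<Rightarrow> int"
  proof -
    have g: "(\<lambda>i. (1/3::real) ^ Suc i) sums (1/2)"
      using sums_mult[OF geometric_sums[of "1/3::real"], of "1/3"] by simp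
    have b01: "0 \<le> real_of_int (b i)" "real_of_int (b i) \<le> 1" for i
      using b[of i] by auto
    have le: "of_int (b i) * (1/3::real) ^ Suc i \<le> (1/3::real) ^ Suc i"
      "0 \<le> of_int (b i) * (1/3::real) ^ Suc i" for i
      using b01[of i] by (auto simp: mult_left_le_one_le)
    have s: "summable (\<lambda>i. of_int (b i) * (1/3::real) ^ Suc i)"
      by (rule summable_comparison_test'[OF sums_summable[OF g], of 0])
         (use le in \<open>simp add: abs_of_nonneg\<close>)
    moreover have "(\<Sum>i. of_int (b i) * (1/3::real) ^ Suc i) \<le> (\<Sum>i. (1/3::real) ^ Suc i)"
      by (rule suminf_le[OF le(1) s sums_summable[OF g]])
    moreover have "0 \<le> (\<Sum>i. of_int (b i) * (1/3::real) ^ Suc i)"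
      by (rule suminf_nonneg[OF s le(2)])
    ultimately show ?thesis
      using sums_unique[OF g] by simp
  qed
  have s: "summable (\<lambda>i. of_int (c i) * (1/3::real) ^ Suc i)"
    using bounds[of c] c by auto
  show "(\<Sum>i. of_int (c i) * (1/3::real) ^ Suc i) \<in> {0..1/2}"
    using bounds[of c] c by auto
  \<comment> \<open>\<open>t\<close> is the tail behind digit \<open>j\<close>, rescaled to a full
    expansion. Digits 0 and 1 in base 3 keep it at most 1/2, so the floor removes it; in base 2 a
    tail of ones would carry.\<close>
  define t where "t = (\<Sum>i. of_int (c (i + Suc j)) * (1/3::real) ^ Suc i)"
  have t: "t \<in> {0..1/2}"
    unfolding t_def using bounds[of "\<lambda>i. c (i + Suc j)"] c by auto
  \<comment> \<open>The digits before \<open>j\<close> contribute \<open>3 * K\<close> after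
    multiplication by \<open>3 ^ Suc j\<close>, which vanishes modulo 3.\<close>
  define K where "K = (\<Sum>i<j. c i * 3 ^ (j - Suc i))"
  have "(\<Sum>i. of_int (c i) * (1/3::real) ^ Suc i) =
      (\<Sum>i. of_int (c (i + Suc j)) * (1/3::real) ^ Suc (i + Suc j)) +
      (\<Sum>i<Suc j. of_int (c i) * (1/3::real) ^ Suc i)"
    by (rule suminf_split_initial_segment[OF s])
  also have "(\<Sum>i. of_int (c (i + Suc j)) * (1/3::real) ^ Suc (i + Suc j)) = (1/3) ^ Suc j * t"
    unfolding t_def using bounds[of "\<lambda>i. c (i + Suc j)"] c
    by (subst suminf_mult[symmetric]) (auto simp: power_add mult_ac)
  finally have "3 ^ Suc j * (\<Sum>i. of_int (c i) * (1/3::real) ^ Suc i) =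
      3 ^ Suc j * (1/3) ^ Suc j * t + (\<Sum>i<Suc j. of_int (c i) * (3 ^ Suc j * (1/3::real) ^ Suc i))"
    by (simp only: distrib_left sum_distrib_left mult_ac)
  also have "3 ^ Suc j * (1/3::real) ^ Suc j = 1"
    by (simp add: power_mult_distrib[symmetric] del: power_Suc)
  also have "(\<Sum>i<Suc j. of_int (c i) * (3 ^ Suc j * (1/3::real) ^ Suc i)) =
      (\<Sum>i<Suc j. of_int (c i) * 3 ^ (j - i))"
  proof (rule sum.cong)
    fix i assume "i \<in> {..<Suc j}"
    then have "(3::real) ^ Suc j = 3 ^ Suc i * 3 ^ (j - i)"
      by (metis Suc_leI Suc_diff_le diff_Suc_Suc le_add_diff_inverse lessThan_iff power_add)
    then show "real_of_int (c i) * (3 ^ Suc j * (1/3::real) ^ Suc i) = of_int (c i) * 3 ^ (j - i)"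
      by (simp add: power_divide field_simps)
  qed simp
  also have "\<dots> = of_int (3 * K + c j)"
  proof -
    have "(\<Sum>i<j. real_of_int (c i) * 3 ^ (j - i)) = 3 * of_int K"
      unfolding K_def of_int_sum sum_distrib_left
    proof (rule sum.cong)
      fix i assume "i \<in> {..<j}"
      then have "j - i = Suc (j - Suc i)" by auto
      then show "real_of_int (c i) * 3 ^ (j - i) = 3 * real_of_int (c i * 3 ^ (j - Suc i))"
        by simp
    qed simp
    then show ?thesis by simp
  qed
  finally have "\<lfloor>3 ^ Suc j * (\<Sum>i. of_int (c i) * (1/3::real) ^ Suc i)\<rfloor> = 3 * K + c j"
    using t by (intro floor_unique) auto
  then show "\<lfloor>3 ^ Suc j * (\<Sum>i. of_int (c i) * (1/3::real) ^ Suc i)\<rfloor> mod 3 = c j"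
    using c[of j] by auto
qed

text \<open>
  The ternary digits of the code of \<open>y\<close> record which balls of radius \<open>1 / (n + 1)\<close> around the points
  \<open>d m\<close> of a dense sequence contain \<open>y\<close>. To decode, take for each \<open>n\<close> the first such \<open>d m\<close> and let \<open>n\<close>
  tend to infinity.
\<close>

lemma borel_code_in_real:
  obtains e :: "'e::{banach, second_countable_topology} \<Rightarrow> real" and dec :: "real \<Rightarrow> 'e"
  where "e \<in> borel_measurable borel" "dec \<in> borel_measurable borel"
    "\<And>y. dec (e y) = y" "\<And>y. 0 \<le> e y" "\<And>y. e y < 1"
proof -
  obtain D :: "'e set" where D: "countable D" "\<And>U. open U \<Longrightarrow> U \<noteq> {} \<Longrightarrow> \<exists>d\<in>D. d \<in> U"
    by (rule countable_dense_setE) blast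
  define d where "d = from_nat_into D"
  have dense: "\<exists>m. dist (d m) y < 1 / real (Suc n)" for y n
  proof -
    obtain z where "z \<in> D" "z \<in> ball y (1 / real (Suc n))"
      using D(2)[of "ball y (1 / real (Suc n))"] by auto
    then show ?thesis
      using from_nat_into_surj[OF D(1), of z] by (auto simp: d_def dist_commute)
  qed
  define c :: "'e \<Rightarrow> nat \<Rightarrow> int" where
    "c y j = (if dist (d (fst (prod_decode j))) y < 1 / real (Suc (snd (prod_decode j))) then 1 else 0)"
    for y j
  have c01: "c y j \<in> {0, 1}" for y j by (simp add: c_def)
  define e where "e y = (\<Sum>i. of_int (c y i) * (1/3::real) ^ Suc i)" for y
  define dig where "dig j r = \<lfloor>3 ^ Suc j * r\<rfloor> mod 3" for j and r :: real
  \<comment> \<open>Outside the range of \<open>e\<close> the \<open>LEAST\<close> and the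
    \<open>lim\<close> may be arbitrary; \<open>dec\<close> is Borel on the whole line all the
    same.\<close>
  define dec where "dec r = lim (\<lambda>n. d (LEAST m. dig (prod_encode (m, n)) r = 1))" for r
  have dige: "dig j (e y) = c y j" for j y
    unfolding dig_def e_def by (rule ternary_digit) (rule c01)
  have "e \<in> borel_measurable borel"
    unfolding e_def c_def by measurable
  moreover have "dec \<in> borel_measurable borel"
  proof -
    have [measurable]: "(\<lambda>r. dig j r) \<in> borel \<rightarrow>\<^sub>M count_space UNIV" for j
      unfolding dig_def by measurable
    show ?thesis
      unfolding dec_def
    proof (rule borel_measurable_lim_metric)
      fix n
      show "(\<lambda>r. d (LEAST m. dig (prod_encode (m, n)) r = 1)) \<in> borel_measurable borel"
        by measurable
    qed
  qed
  moreover have "dec (e y) = y" for y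
  proof -
    have "dist (d (LEAST m. dig (prod_encode (m, n)) (e y) = 1)) y < 1 / real (Suc n)" for n
      using LeastI_ex[OF dense[of y n]] by (simp add: dige c_def)
    then have "(\<lambda>n. dist (d (LEAST m. dig (prod_encode (m, n)) (e y) = 1)) y) \<longlonglongrightarrow> 0"
      by (intro real_tendsto_sandwich[OF _ _ tendsto_const LIMSEQ_Suc[OF lim_1_over_n]] always_eventually allI)
         (simp_all add: less_imp_le)
    then have "(\<lambda>n. d (LEAST m. dig (prod_encode (m, n)) (e y) = 1)) \<longlonglongrightarrow> y"
      by (simp add: tendsto_dist_iff[symmetric])
    then show ?thesis
      unfolding dec_def by (rule limI)
  qed
  moreover have "0 \<le> e y" "e y < 1" for y
    using ternary_digit(2)[of "c y", OF c01] unfolding e_def by auto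
  ultimately show thesis by (rule that)
qed

text \<open>Continuity at the empty set upgrades finite additivity to countable additivity. In this
  form the condition can be checked by monotone limits of sets alone.\<close>

lemma measure_of_additive:
  fixes f :: "'a set \<Rightarrow> real"
  assumes nonneg: "\<And>A. A \<in> sets M \<Longrightarrow> 0 \<le> f A"
    and add: "\<And>A B. A \<in> sets M \<Longrightarrow> B \<in> sets M \<Longrightarrow> A \<inter> B = {} \<Longrightarrow> f (A \<union> B) = f A + f B"
    and cont: "\<And>A. range A \<subseteq> sets M \<Longrightarrow> decseq A \<Longrightarrow> (\<Inter>i. A i) = {} \<Longrightarrow> (\<lambda>i. f (A i)) \<longlonglongrightarrow> 0"
  obtains N where "sets N = sets M" "finite_measure N" "\<And>A. A \<in> sets M \<Longrightarrow> emeasure N A = ennreal (f A)"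
proof -
  have f0: "f {} = 0" using add[of "{}" "{}"] by simp
  define N where "N = measure_of (space M) (sets M) (\<lambda>A. ennreal (f A))"
  have sets_N: "sets N = sets M" by (simp add: N_def)
  have em: "emeasure N A = ennreal (f A)" if "A \<in> sets M" for A
  proof (rule emeasure_measure_of[OF N_def])
    show pos: "positive (sets N) (\<lambda>A. ennreal (f A))"
      by (simp add: positive_def f0)
    show "countably_additive (sets N) (\<lambda>A. ennreal (f A))"
      unfolding sets_N
    proof (rule sets.empty_continuous_imp_countably_additive)
      show "additive (sets M) (\<lambda>A. ennreal (f A))"
        by (auto simp: additive_def add nonneg ennreal_plus)
      show "positive (sets M) (\<lambda>A. ennreal (f A))"
        using pos sets_N by simp
      fix A :: "nat \<Rightarrow> 'a set" assume "range A \<subseteq> sets M" "decseq A" "(\<Inter>i. A i) = {}"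
      with cont[of A] show "(\<lambda>i. ennreal (f (A i))) \<longlonglongrightarrow> 0"
        by (auto intro!: tendsto_ennrealI simp flip: ennreal_0)
    qed simp
  qed (use that sets.space_closed sets_N in auto)
  have "finite_measure N"
    by (rule finite_measureI) (use em[of "space M"] sets_eq_imp_space_eq[OF sets_N] in auto)
  then show thesis
    using that[OF sets_N _ em] by simp
qed


text \<open>Test the hypothesis on the set where the conclusion fails; finiteness of the integral of
  \<open>g\<close> permits the subtraction in \<open>ennreal\<close>.\<close>

lemma AE_le_of_set_nn_integral_le:
  fixes f g :: "'a \<Rightarrow> ennreal"
  assumes [measurable]: "f \<in> borel_measurable M" "g \<in> borel_measurable M"
    and fin: "(\<integral>\<^sup>+x. g x \<partial>M) \<noteq> \<infinity>"
    and le: "\<And>A. A \<in> sets M \<Longrightarrow> (\<integral>\<^sup>+x\<in>A. f x \<partial>M) \<le> (\<integral>\<^sup>+x\<in>A. g x \<partial>M)"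
  shows "AE x in M. f x \<le> g x"
proof -
  define A where "A = {x \<in> space M. g x < f x}"
  have [measurable]: "A \<in> sets M" unfolding A_def by measurable
  have "(\<integral>\<^sup>+x\<in>A. g x \<partial>M) \<le> (\<integral>\<^sup>+x. g x \<partial>M)"
    by (intro nn_integral_mono) (simp add: indicator_def)
  then have finA: "(\<integral>\<^sup>+x\<in>A. g x \<partial>M) \<noteq> \<infinity>"
    using fin by (auto simp: top_unique)
  have "(\<integral>\<^sup>+x. f x * indicator A x - g x * indicator A x \<partial>M) =
      (\<integral>\<^sup>+x\<in>A. f x \<partial>M) - (\<integral>\<^sup>+x\<in>A. g x \<partial>M)"
    using finA by (intro nn_integral_diff) (auto intro!: AE_I2 simp: indicator_def A_def)
  also have "\<dots> = 0"
    using le[of A] finA by (auto simp: diff_eq_0_iff_ennreal less_top[symmetric] top_unique)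
  finally have "AE x in M. f x * indicator A x - g x * indicator A x = 0"
    by (subst (asm) nn_integral_0_iff_AE) auto
  with AE_space show ?thesis
  proof eventually_elim
    case (elim x)
    then show ?case
      by (cases "x \<in> A") (auto simp: diff_eq_0_iff_ennreal A_def)
  qed
qed

text \<open>The classical construction of regular conditional distributions. For each
  \<open>t\<close> the density of \<open>m _ {..t}\<close> with respect to \<open>m _ UNIV\<close>
  is a candidate for the conditional distribution function at \<open>t\<close>; it is regularized
  along the rationals, and measures on the line are then compared by their distribution
  functions.\<close>

lemma disintegration_unit_interval:
  fixes m :: "'x set \<Rightarrow> real set \<Rightarrow> real" and M :: "'x measure"
  assumes nonempty: "space M \<noteq> {}"
    and nonneg: "\<And>A B. A \<in> sets M \<Longrightarrow> B \<in> sets borel \<Longrightarrow> 0 \<le> m A B"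
    and add1: "\<And>A A' B. A \<in> sets M \<Longrightarrow> A' \<in> sets M \<Longrightarrow> A \<inter> A' = {} \<Longrightarrow> B \<in> sets borel \<Longrightarrow>
      m (A \<union> A') B = m A B + m A' B"
    and add2: "\<And>A B B'. A \<in> sets M \<Longrightarrow> B \<in> sets borel \<Longrightarrow> B' \<in> sets borel \<Longrightarrow> B \<inter> B' = {} \<Longrightarrow>
      m A (B \<union> B') = m A B + m A B'"
    and cont1: "\<And>A. range A \<subseteq> sets M \<Longrightarrow> decseq A \<Longrightarrow> (\<Inter>i. A i) = {} \<Longrightarrow> (\<lambda>i. m (A i) UNIV) \<longlonglongrightarrow> 0"
    and cont2: "\<And>B. range B \<subseteq> sets borel \<Longrightarrow> decseq B \<Longrightarrow> (\<Inter>i. B i) = {} \<Longrightarrow>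
      (\<lambda>i. m (space M) (B i)) \<longlonglongrightarrow> 0"
    and supp: "m (space M) {..<0} = 0" "m (space M) {1<..} = 0"
  obtains M' \<kappa> where "sets M' = sets M" "finite_measure M'"
    "\<And>A. A \<in> sets M \<Longrightarrow> emeasure M' A = m A UNIV"
    "\<kappa> \<in> M \<rightarrow>\<^sub>M prob_algebra borel"
    "\<And>A B. A \<in> sets M \<Longrightarrow> B \<in> sets borel \<Longrightarrow> (\<integral>\<^sup>+x\<in>A. emeasure (\<kappa> x) B \<partial>M') = m A B"
proof -
  have mono1: "m A B \<le> m A' B" if "A \<subseteq> A'" "A \<in> sets M" "A' \<in> sets M" "B \<in> sets borel" for A A' B
    using add1[of A "A' - A" B] nonneg[of "A' - A" B] that by (simp add: Un_absorb1)
  have mono2: "m A B \<le> m A B'" if "B \<subseteq> B'" "A \<in> sets M" "B \<in> sets borel" "B' \<in> sets borel" for A B B'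
    using add2[of A B "B' - B"] nonneg[of A "B' - B"] that by (simp add: Un_absorb1)
  have mono_sp: "m A B \<le> m (space M) B" if "A \<in> sets M" "B \<in> sets borel" for A B
    using mono1[of A "space M" B] that sets.sets_into_space by auto

  have ex_N: "\<exists>N. sets N = sets M \<and> finite_measure N \<and> (\<forall>A\<in>sets M. emeasure N A = ennreal (m A B))"
    if B: "B \<in> sets borel" for B
  proof (rule measure_of_additive[of M "\<lambda>A. m A B"])
    fix A :: "nat \<Rightarrow> 'x set" assume A: "range A \<subseteq> sets M" "decseq A" "(\<Inter>i. A i) = {}"
    show "(\<lambda>i. m (A i) B) \<longlonglongrightarrow> 0"
      by (rule real_tendsto_sandwich[OF _ _ tendsto_const cont1[OF A]])
         (use A B nonneg mono2 in \<open>auto intro!: always_eventually\<close>)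
  qed (use B nonneg add1 in auto)
  define N where "N B = (SOME N. sets N = sets M \<and> finite_measure N \<and>
    (\<forall>A\<in>sets M. emeasure N A = ennreal (m A B)))" for B
  have N: "sets (N B) = sets M" "finite_measure (N B)"
      "\<And>A. A \<in> sets M \<Longrightarrow> emeasure (N B) A = ennreal (m A B)" if "B \<in> sets borel" for B
    using someI_ex[OF ex_N[OF that]] by (auto simp: N_def)
  define M' where "M' = N UNIV"
  have sets_M' [simp, measurable_cong]: "sets M' = sets M" and em_M': "\<And>A. A \<in> sets M \<Longrightarrow> emeasure M' A = m A UNIV"
    using N[of UNIV] by (auto simp: M'_def)
  have space_M' [simp]: "space M' = space M" by (rule sets_eq_imp_space_eq) simp
  interpret M': finite_measure M' using N[of UNIV] by (simp add: M'_def)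

  \<comment> \<open>Cutting at 1 and fixing the values for \<open>t < 0\<close> and
    \<open>t \<ge> 1\<close> alters the densities only on null sets, but makes the bounds in
    \<open>E01\<close> and the limits of \<open>G\<close> hold at every single
    \<open>x\<close>.\<close>
  define E where "E t x = (if t < 0 then 0 else if t \<ge> 1 then 1 else min 1 (enn2real (RN_deriv M' (N {..t}) x)))"
    for t :: real and x
  have E_meas [measurable]: "E t \<in> borel_measurable M" for t
    unfolding E_def by measurable
  have E01: "0 \<le> E t x" "E t x \<le> 1" for t x by (auto simp: E_def)
  have E_int: "(\<integral>\<^sup>+x\<in>A. E t x \<partial>M') = m A {..t}" if A: "A \<in> sets M" for A t
  proof (cases "t < 0 \<or> t \<ge> 1")
    case True
    then consider "t < 0" | "t \<ge> 1" by blast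
    then show ?thesis
    proof cases
      case 1
      have "m A {..t} \<le> m A {..<0}"
        using 1 A by (intro mono2) auto
      also have "\<dots> \<le> m (space M) {..<0}" using A by (intro mono_sp) auto
      finally have "m A {..t} = 0" using supp nonneg[of A "{..t}"] A by simp
      then show ?thesis using 1 by (simp add: E_def)
    next
      case 2
      have "m A {t<..} \<le> m A {1<..}"
        using 2 A by (intro mono2) auto
      also have "\<dots> \<le> m (space M) {1<..}" using A by (intro mono_sp) auto
      finally have "m A {t<..} = 0" using supp nonneg[of A "{t<..}"] A by simp
      moreover have "m A ({..t} \<union> {t<..}) = m A {..t} + m A {t<..}"
        using A by (intro add2) auto
      moreover have "{..t} \<union> {t<..} = UNIV" by auto
      ultimately have "m A {..t} = m A UNIV" by simp
      then show ?thesis using 2 A by (simp add: E_def em_M')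
    qed
  next
    case False
    let ?R = "RN_deriv M' (N {..t})"
    \<comment> \<open>Domination by \<open>M'\<close> serves twice: it gives absolute continuity and
      a density of at most 1.\<close>
    have le: "emeasure (N {..t}) B \<le> emeasure M' B" if "B \<in> sets M" for B
      using that mono2[of "{..t}" UNIV B] by (auto simp: N em_M' intro!: ennreal_leI)
    have "absolutely_continuous M' (N {..t})"
      unfolding absolutely_continuous_def
      using le by (auto simp: null_sets_def N M'_def) (metis le_zero_eq)
    then have dens: "density M' ?R = N {..t}"
      by (intro M'.density_RN_deriv) (simp_all add: N)
    have int: "(\<integral>\<^sup>+x\<in>B. ?R x \<partial>M') = m B {..t}" if "B \<in> sets M" for B
      using that dens N(3)[of "{..t}" B] emeasure_density[of ?R M' B] by simp
    have "AE x in M'. ?R x \<le> 1"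
    proof (rule AE_le_of_set_nn_integral_le)
      show "(\<integral>\<^sup>+x\<in>B. ?R x \<partial>M') \<le> (\<integral>\<^sup>+x\<in>B. 1 \<partial>M')" if "B \<in> sets M'" for B
        using that le[of B] int[of B] by (simp add: N)
    qed (auto simp: em_M')
    then have "(\<integral>\<^sup>+x\<in>A. E t x \<partial>M') = (\<integral>\<^sup>+x\<in>A. ?R x \<partial>M')"
    proof (intro nn_integral_cong_AE, eventually_elim)
      case (elim x)
      then have "enn2real (?R x) \<le> 1" "?R x < top"
        by (auto intro: enn2real_leI order_le_less_trans[of _ 1])
      then show ?case using False by (simp add: E_def)
    qed
    then show ?thesis using int[OF A] by simp
  qed

  \<comment> \<open>An infimum over the rationals to the right of \<open>t\<close> is monotone and right continuous in \<open>t\<close> whatever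
    the choice of the densities, so \<open>G x\<close> is a distribution function for every single \<open>x\<close>.\<close>
  define R where "R t = {r \<in> \<rat>. t < r}" for t :: real
  have R_ne: "\<exists>r. r \<in> R t \<and> r < s" if "t < s" for t s
    using Rats_dense_in_real[OF that] by (auto simp: R_def)
  have R_ne': "R t \<noteq> {}" for t using R_ne[of t "t+1"] by auto
  have R_count: "countable (R t)" for t
    unfolding R_def by (rule countable_subset[OF _ countable_rat]) auto
  define G where "G x t = (INF r\<in>R t. E r x)" for x t
  have bdd: "bdd_below ((\<lambda>r. E r x) ` R t)" for x t
    by (rule bdd_belowI[of _ 0]) (auto simp: E01)
  have G_le: "G x t \<le> E r x" if "r \<in> R t" for r x t
    unfolding G_def by (rule cINF_lower[OF bdd that])
  have G_nonneg: "0 \<le> G x t" for x t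
    unfolding G_def by (rule cINF_greatest[OF R_ne']) (rule E01)
  have G_mono: "G x s \<le> G x t" if "s \<le> t" for x s t
    unfolding G_def by (rule cINF_superset_mono[OF R_ne' bdd]) (use that in \<open>auto simp: R_def\<close>)
  have G_right: "continuous (at_right t) (G x)" for x t
    unfolding continuous_within
  proof (rule order_tendstoI)
    fix c assume c: "c < G x t"
    show "\<forall>\<^sub>F s in at_right t. c < G x s"
      by (rule eventually_mono[OF eventually_at_right_less[of t]]) (meson c G_mono less_le_trans less_imp_le)
  next
    fix c assume "G x t < c"
    then obtain r where r: "r \<in> R t" "E r x < c"
      unfolding G_def using cINF_less_iff[OF R_ne' bdd] by auto
    then have "t < r" by (simp add: R_def)
    show "\<forall>\<^sub>F s in at_right t. G x s < c"
      using eventually_at_right_real[OF \<open>t < r\<close>]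
    proof eventually_elim
      case (elim s)
      then have "G x s \<le> E r x" using r by (intro G_le) (auto simp: R_def)
      with r show ?case by simp
    qed
  qed
  have G_bot: "(G x \<longlongrightarrow> 0) at_bot" for x
  proof (rule tendsto_eventually)
    show "\<forall>\<^sub>F t in at_bot. G x t = 0"
      using eventually_le_at_bot[of "-1::real"]
    proof eventually_elim
      case (elim t)
      then obtain r where "r \<in> R t" "r < 0" using R_ne[of t 0] by auto
      then show ?case using G_le[of r t x] G_nonneg[of x t] by (simp add: E_def)
    qed
  qed
  have G_top: "(G x \<longlongrightarrow> 1) at_top" for x
  proof (rule tendsto_eventually)
    show "\<forall>\<^sub>F t in at_top. G x t = 1"
      using eventually_ge_at_top[of "1::real"]
    proof eventually_elim
      case (elim t)
      then have "(\<lambda>r. E r x) ` R t = {1}" using R_ne'[of t] by (auto simp: E_def R_def)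
      then show ?case by (simp add: G_def)
    qed
  qed
  have G_meas [measurable]: "(\<lambda>x. G x t) \<in> borel_measurable M" for t
    unfolding G_def by (intro borel_measurable_cINF_real R_count E_meas bdd)

  \<comment> \<open>For the lower bound, \<open>E t \<le> E r\<close> holds almost everywhere for
    all of the countably many rational \<open>r > t\<close> at once. For the upper bound a single
    \<open>r\<close> close to \<open>t\<close> is enough: the error is the mass of a half-open
    interval to the right of \<open>t\<close>, and these intervals shrink to the empty set.\<close>
  have G_int: "(\<integral>\<^sup>+x\<in>A. G x t \<partial>M') = m A {..t}" if A: "A \<in> sets M" for A t
  proof (rule antisym)
    have "AE x in M'. \<forall>r\<in>R t. ennreal (E t x) \<le> ennreal (E r x)"
    proof (subst AE_ball_countable[OF R_count], rule ballI)
      fix r assume r: "r \<in> R t"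
      show "AE x in M'. ennreal (E t x) \<le> ennreal (E r x)"
      proof (rule AE_le_of_set_nn_integral_le)
        show "(\<integral>\<^sup>+x. E r x \<partial>M') \<noteq> \<infinity>"
          using E_int[of "space M" r] nn_integral_cong[of M' "\<lambda>x. ennreal (E r x) * indicator (space M) x" "\<lambda>x. E r x"]
          by (metis (no_types, lifting) ennreal_neq_top infinity_ennreal_def indicator_simps(1) mult.right_neutral sets.top space_M')
        show "(\<integral>\<^sup>+x\<in>B. E t x \<partial>M') \<le> (\<integral>\<^sup>+x\<in>B. E r x \<partial>M')" if "B \<in> sets M'" for B
          using that r mono2[of "{..t}" "{..r}" B] by (auto simp: E_int R_def intro!: ennreal_leI)
      qed auto
    qed
    then have "AE x in M'. E t x \<le> G x t"
      by eventually_elim (auto simp: G_def E01 intro!: cINF_greatest R_ne')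
    then have "(\<integral>\<^sup>+x\<in>A. E t x \<partial>M') \<le> (\<integral>\<^sup>+x\<in>A. G x t \<partial>M')"
      by (intro nn_integral_mono_AE, eventually_elim) (auto intro!: mult_right_mono ennreal_leI)
    then show "m A {..t} \<le> (\<integral>\<^sup>+x\<in>A. G x t \<partial>M')" by (simp add: E_int A)
  next
    have le: "(\<integral>\<^sup>+x\<in>A. G x t \<partial>M') \<le> ennreal (m A {..t} + m (space M) {t<..t + 1 / real (Suc n)})" for n
    proof -
      obtain r where r: "r \<in> R t" "r < t + 1 / real (Suc n)" using R_ne[of t "t + 1 / real (Suc n)"] by auto
      have "(\<integral>\<^sup>+x\<in>A. G x t \<partial>M') \<le> (\<integral>\<^sup>+x\<in>A. E r x \<partial>M')"
        by (intro nn_integral_mono mult_right_mono ennreal_leI G_le r) auto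
      also have "\<dots> = m A {..r}" by (rule E_int[OF A])
      also have "m A {..r} = m A ({..t} \<union> {t<..r})"
        using r by (intro arg_cong[of _ _ "m A"]) (auto simp: R_def)
      also have "\<dots> = m A {..t} + m A {t<..r}" using A by (intro add2) auto
      also have "m A {t<..r} \<le> m A {t<..t + 1 / real (Suc n)}" using r A by (intro mono2) auto
      also have "\<dots> \<le> m (space M) {t<..t + 1 / real (Suc n)}" using A by (intro mono_sp) auto
      finally show ?thesis by (simp add: ennreal_leI)
    qed
    have "(\<lambda>n. m (space M) {t<..t + 1 / real (Suc n)}) \<longlonglongrightarrow> 0"
    proof (rule cont2)
      show "decseq (\<lambda>n. {t<..t + 1 / real (Suc n)})"
      proof (rule antimonoI)
        fix i j :: nat assume "i \<le> j"
        then have "1 / real (Suc j) \<le> 1 / real (Suc i)" by (simp add: frac_le)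
        then show "{t<..t + 1 / real (Suc j)} \<subseteq> {t<..t + 1 / real (Suc i)}" by auto
      qed
      show "(\<Inter>n. {t<..t + 1 / real (Suc n)}) = {}"
      proof -
        have "False" if s: "t < s" "\<And>n. s \<le> t + 1 / real (Suc n)" for s
        proof -
          obtain n where "inverse (real (Suc n)) < s - t" using reals_Archimedean[of "s - t"] s(1) by auto
          then show False using s(2)[of n] by (simp add: inverse_eq_divide)
        qed
        then show ?thesis by force
      qed
    qed auto
    then have "(\<lambda>n. ennreal (m A {..t} + m (space M) {t<..t + 1 / real (Suc n)})) \<longlonglongrightarrow> ennreal (m A {..t} + 0)"
      by (intro tendsto_ennrealI tendsto_add tendsto_const)
    then show "(\<integral>\<^sup>+x\<in>A. G x t \<partial>M') \<le> m A {..t}"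
      using le by (auto intro: LIMSEQ_le_const)
  qed

  define \<kappa> where "\<kappa> x = interval_measure (G x)" for x
  have real_distr: "real_distribution (\<kappa> x)" for x
    unfolding \<kappa>_def by (rule real_distribution_interval_measure[OF G_mono G_right G_bot G_top])
  have cdf_\<kappa>: "cdf (\<kappa> x) = G x" for x
    unfolding \<kappa>_def by (rule cdf_interval_measure[OF G_mono G_right G_bot])
  have em_\<kappa>: "emeasure (\<kappa> x) {..t} = G x t" for x t
  proof -
    interpret real_distribution "\<kappa> x" by (rule real_distr)
    show ?thesis using cdf_\<kappa>[of x] by (simp add: emeasure_eq_measure cdf_def fun_eq_iff)
  qed
  have \<kappa>_meas: "\<kappa> \<in> M \<rightarrow>\<^sub>M prob_algebra borel"
  proof (rule measurable_prob_algebra_generated[where \<Omega>=UNIV and G="range (\<lambda>t::real. {..t})"])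
    show "sets (borel::real measure) = sigma_sets UNIV (range (\<lambda>t. {..t}))"
      by (simp add: borel_eq_atMost)
    show "Int_stable (range (\<lambda>t::real. {..t}))"
      by (auto simp: Int_stable_def)
    show "prob_space (\<kappa> x)" for x using real_distr[of x] by (simp add: real_distribution_def)
    show "sets (\<kappa> x) = sets borel" for x by (simp add: \<kappa>_def)
    show "(\<lambda>x. emeasure (\<kappa> x) A) \<in> borel_measurable M" if "A \<in> range (\<lambda>t. {..t})" for A
      using that by (auto simp: em_\<kappa>)
  qed auto
  have "(\<integral>\<^sup>+x\<in>A. emeasure (\<kappa> x) B \<partial>M') = m A B" if A: "A \<in> sets M" and B: "B \<in> sets borel" for A B
  proof -
    \<comment> \<open>Restricting \<open>M'\<close> to the fixed set \<open>A\<close> turns the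
      claim into the equality of two finite Borel measures on the line,
      \<open>D \<bind> \<kappa>\<close> and the measure \<open>L\<close> with values
      \<open>m A\<close>.\<close>
    define D where "D = density M' (indicator A)"
    have D: "sets D = sets M" "space D = space M" by (auto simp: D_def)
    have \<kappa>_meas': "\<kappa> \<in> D \<rightarrow>\<^sub>M subprob_algebra borel"
      using measurable_prob_algebraD[OF \<kappa>_meas] by (simp add: measurable_cong_sets[OF D(1)])
    have \<kappa>_B [measurable]: "(\<lambda>x. emeasure (\<kappa> x) C) \<in> borel_measurable M" if "C \<in> sets borel" for C
      using measurable_emeasure_kernel[OF measurable_prob_algebraD[OF \<kappa>_meas] that] .
    have em1: "emeasure (D \<bind> \<kappa>) C = (\<integral>\<^sup>+x\<in>A. emeasure (\<kappa> x) C \<partial>M')" if "C \<in> sets borel" for C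
      using emeasure_bind[OF _ \<kappa>_meas' that] nonempty D A that
      by (simp add: D_def nn_integral_density mult.commute)
    obtain L where L: "sets L = sets borel" "finite_measure L" "\<And>C. C \<in> sets borel \<Longrightarrow> emeasure L C = ennreal (m A C)"
    proof (rule measure_of_additive[of borel "m A"])
      fix C :: "nat \<Rightarrow> real set" assume C: "range C \<subseteq> sets borel" "decseq C" "(\<Inter>i. C i) = {}"
      show "(\<lambda>i. m A (C i)) \<longlonglongrightarrow> 0"
        by (rule real_tendsto_sandwich[OF _ _ tendsto_const cont2[OF C]])
           (use A C nonneg mono_sp in \<open>auto intro!: always_eventually\<close>)
    qed (use A nonneg add2 in auto)
    have sb: "sets (D \<bind> \<kappa>) = sets borel"
      using sets_bind[of D \<kappa> borel] nonempty D by (auto simp: \<kappa>_def)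
    have one: "emeasure (\<kappa> x) UNIV = 1" for x
      using prob_space.emeasure_space_1[of "\<kappa> x"] real_distr[of x] by (simp add: real_distribution_def \<kappa>_def)
    have "D \<bind> \<kappa> = L"
    proof (rule cdf_unique')
      show "finite_borel_measure L" using L by (simp add: finite_borel_measure_def finite_borel_measure_axioms_def)
      show "finite_borel_measure (D \<bind> \<kappa>)"
      proof (intro finite_borel_measure.intro finite_borel_measure_axioms.intro finite_measureI)
        show "emeasure (D \<bind> \<kappa>) (space (D \<bind> \<kappa>)) \<noteq> \<infinity>"
          using sets_eq_imp_space_eq[OF sb] A by (simp add: em1 one em_M')
      qed (rule sb)
      show "cdf (D \<bind> \<kappa>) = cdf L"
      proof
        fix t
        show "cdf (D \<bind> \<kappa>) t = cdf L t"
          unfolding cdf_def measure_def by (simp add: em1 em_\<kappa> G_int A L)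
      qed
    qed
    then show ?thesis using em1[OF B] L(3)[OF B] by simp
  qed
  then show thesis
    using that[OF sets_M' M'.finite_measure_axioms em_M' \<kappa>_meas] by blast
qed

section \<open>Bilinear couplings with prescribed barycenters\<close>

text \<open>
  The pairing \<open>\<beta> (A, f)\<close> stands for \<open>\<integral>x\<in>A. \<integral>y. f y \<partial>q x \<partial>M\<close>, where \<open>q\<close> is a nonnegative kernel which transports
  \<open>M\<close> to \<open>N\<close>; only finite additivity in \<open>A\<close> is demanded. All conditions are closed under pointwise
  limits, and the values outside the index set are fixed to \<open>0\<close> to obtain a compact set.
\<close>

definition bilinear_couplings ::
  "'x measure \<Rightarrow> 'y measure \<Rightarrow> ('x set \<times> ('y \<Rightarrow> real) \<Rightarrow> real) set" where
  "bilinear_couplings M N = {\<beta>.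
     (\<forall>A f. \<not> (A \<in> sets M \<and> integrable N f) \<longrightarrow> \<beta> (A, f) = 0) \<and>
     (\<forall>A f. A \<in> sets M \<and> integrable N f \<and> (\<forall>y\<in>space N. 0 \<le> f y) \<longrightarrow> 0 \<le> \<beta> (A, f)) \<and>
     (\<forall>A f g. A \<in> sets M \<and> integrable N f \<and> integrable N g \<longrightarrow>
        \<beta> (A, \<lambda>y. f y + g y) = \<beta> (A, f) + \<beta> (A, g)) \<and>
     (\<forall>A f r. A \<in> sets M \<and> integrable N f \<longrightarrow> \<beta> (A, \<lambda>y. r * f y) = r * \<beta> (A, f)) \<and>
     (\<forall>A B f. A \<in> sets M \<and> B \<in> sets M \<and> A \<inter> B = {} \<and> integrable N f \<longrightarrow>
        \<beta> (A \<union> B, f) = \<beta> (A, f) + \<beta> (B, f)) \<and>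
     (\<forall>f. integrable N f \<longrightarrow> \<beta> (space M, f) = (\<integral>y. f y \<partial>N))}"

section \<open>Linearity and bounds for bilinear couplings\<close>

lemma
  assumes \<beta>: "\<beta> \<in> bilinear_couplings M N"
  shows bilinear_couplings_outside: "\<not> (A \<in> sets M \<and> integrable N f) \<Longrightarrow> \<beta> (A, f) = 0"
    and bilinear_couplings_nonneg:
      "A \<in> sets M \<Longrightarrow> integrable N f \<Longrightarrow> (\<And>y. y \<in> space N \<Longrightarrow> 0 \<le> f y) \<Longrightarrow> 0 \<le> \<beta> (A, f)"
    and bilinear_couplings_add:
      "A \<in> sets M \<Longrightarrow> integrable N f \<Longrightarrow> integrable N g \<Longrightarrow> \<beta> (A, \<lambda>y. f y + g y) = \<beta> (A, f) + \<beta> (A, g)"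
    and bilinear_couplings_scale:
      "A \<in> sets M \<Longrightarrow> integrable N f \<Longrightarrow> \<beta> (A, \<lambda>y. r * f y) = r * \<beta> (A, f)"
    and bilinear_couplings_Un:
      "A \<in> sets M \<Longrightarrow> B \<in> sets M \<Longrightarrow> A \<inter> B = {} \<Longrightarrow> integrable N f \<Longrightarrow>
        \<beta> (A \<union> B, f) = \<beta> (A, f) + \<beta> (B, f)"
    and bilinear_couplings_space: "integrable N f \<Longrightarrow> \<beta> (space M, f) = (\<integral>y. f y \<partial>N)"
proof -
  note D = \<beta>[unfolded bilinear_couplings_def mem_Collect_eq]
  show "\<not> (A \<in> sets M \<and> integrable N f) \<Longrightarrow> \<beta> (A, f) = 0"
    using D[THEN conjunct1] by blast
  show "A \<in> sets M \<Longrightarrow> integrable N f \<Longrightarrow> (\<And>y. y \<in> space N \<Longrightarrow> 0 \<le> f y) \<Longrightarrow> 0 \<le> \<beta> (A, f)"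
    using D[THEN conjunct2, THEN conjunct1] by blast
  show "A \<in> sets M \<Longrightarrow> integrable N f \<Longrightarrow> integrable N g \<Longrightarrow> \<beta> (A, \<lambda>y. f y + g y) = \<beta> (A, f) + \<beta> (A, g)"
    using D[THEN conjunct2, THEN conjunct2, THEN conjunct1] by blast
  show "A \<in> sets M \<Longrightarrow> integrable N f \<Longrightarrow> \<beta> (A, \<lambda>y. r * f y) = r * \<beta> (A, f)"
    using D[THEN conjunct2, THEN conjunct2, THEN conjunct2, THEN conjunct1] by blast
  show "A \<in> sets M \<Longrightarrow> B \<in> sets M \<Longrightarrow> A \<inter> B = {} \<Longrightarrow> integrable N f \<Longrightarrow>
      \<beta> (A \<union> B, f) = \<beta> (A, f) + \<beta> (B, f)"
    using D[THEN conjunct2, THEN conjunct2, THEN conjunct2, THEN conjunct2, THEN conjunct1] by blast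
  show "integrable N f \<Longrightarrow> \<beta> (space M, f) = (\<integral>y. f y \<partial>N)"
    using D[THEN conjunct2, THEN conjunct2, THEN conjunct2, THEN conjunct2, THEN conjunct2] by blast
qed

lemma bilinear_couplings_diff:
  assumes \<beta>: "\<beta> \<in> bilinear_couplings M N" and A: "A \<in> sets M" and f: "integrable N f" and g: "integrable N g"
  shows "\<beta> (A, \<lambda>y. f y - g y) = \<beta> (A, f) - \<beta> (A, g)"
  using bilinear_couplings_add[OF \<beta> A f, of "\<lambda>y. (-1) * g y"] bilinear_couplings_scale[OF \<beta> A g, of "-1"] g
  by simp

lemma bilinear_couplings_mono:
  assumes \<beta>: "\<beta> \<in> bilinear_couplings M N" and A: "A \<in> sets M" and f: "integrable N f" and g: "integrable N g"
    and le: "\<And>y. y \<in> space N \<Longrightarrow> f y \<le> g y"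
  shows "\<beta> (A, f) \<le> \<beta> (A, g)"
  using bilinear_couplings_nonneg[OF \<beta> A, of "\<lambda>y. g y - f y"] bilinear_couplings_diff[OF \<beta> A g f] f g le
  by simp

lemma bilinear_couplings_le_integral:
  assumes \<beta>: "\<beta> \<in> bilinear_couplings M N" and A: "A \<in> sets M" and f: "integrable N f"
    and pos: "\<And>y. y \<in> space N \<Longrightarrow> 0 \<le> f y"
  shows "\<beta> (A, f) \<le> (\<integral>y. f y \<partial>N)"
proof -
  have "\<beta> (A \<union> (space M - A), f) = \<beta> (A, f) + \<beta> (space M - A, f)"
    using A f by (intro bilinear_couplings_Un[OF \<beta>]) auto
  moreover have "A \<union> (space M - A) = space M" using sets.sets_into_space[OF A] by auto
  moreover have "0 \<le> \<beta> (space M - A, f)"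
    using A f pos by (intro bilinear_couplings_nonneg[OF \<beta>]) auto
  ultimately show ?thesis using bilinear_couplings_space[OF \<beta> f] by simp
qed

text \<open>The right-hand side does not depend on \<open>\<beta>\<close> or \<open>A\<close>. It
  supplies the box for compactness, and it makes \<open>\<beta> (A, f)\<close> continuous in
  \<open>f\<close> for the norm of \<open>L1\<close>.\<close>

lemma bilinear_couplings_bound:
  assumes \<beta>: "\<beta> \<in> bilinear_couplings M N" and A: "A \<in> sets M" and f: "integrable N f"
  shows "\<bar>\<beta> (A, f)\<bar> \<le> (\<integral>y. \<bar>f y\<bar> \<partial>N)"
proof -
  have af: "integrable N (\<lambda>y. \<bar>f y\<bar>)" using f by (rule integrable_abs)
  have "\<beta> (A, f) \<le> \<beta> (A, \<lambda>y. \<bar>f y\<bar>)"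
    by (rule bilinear_couplings_mono[OF \<beta> A f af]) simp
  moreover have "\<beta> (A, \<lambda>y. (-1) * f y) \<le> \<beta> (A, \<lambda>y. \<bar>f y\<bar>)"
    using f by (intro bilinear_couplings_mono[OF \<beta> A _ af]) auto
  moreover have "\<beta> (A, \<lambda>y. \<bar>f y\<bar>) \<le> (\<integral>y. \<bar>f y\<bar> \<partial>N)"
    by (rule bilinear_couplings_le_integral[OF \<beta> A af]) simp
  ultimately show ?thesis
    unfolding bilinear_couplings_scale[OF \<beta> A f] by simp
qed

text \<open>A closed subset of a product of compact intervals, which is compact by Tychonoff's
  theorem. The interval at a pair \<open>(A, f)\<close> is given by the norm of \<open>f\<close> in
  \<open>L1\<close>.\<close>

lemma compact_bilinear_couplings: "compact (bilinear_couplings M N)"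
proof -
  define K where "K i = (if fst i \<in> sets M \<and> integrable N (snd i) then \<integral>y. \<bar>snd i y\<bar> \<partial>N else 0)"
    for i :: "'a set \<times> ('b \<Rightarrow> real)"
  define box where "box = (\<Pi>\<^sub>E i\<in>UNIV. {- K i..K i})"
  have "compactin (product_topology (\<lambda>_. euclidean) UNIV) box"
    unfolding box_def compactin_PiE by (intro disjI2 ballI) (simp add: compactin_euclidean_iff)
  then have "compact box"
    unfolding euclidean_product_topology compactin_euclidean_iff .
  moreover have "bilinear_couplings M N \<subseteq> box"
  proof
    fix \<beta> assume \<beta>: "\<beta> \<in> bilinear_couplings M N"
    have "\<bar>\<beta> (A, f)\<bar> \<le> K (A, f)" for A and f :: "'b \<Rightarrow> real"
      using bilinear_couplings_bound[OF \<beta>, of A f] bilinear_couplings_outside[OF \<beta>, of A f] by (simp add: K_def)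
    then show "\<beta> \<in> box"
      by (auto simp: box_def abs_le_iff minus_le_iff)
  qed
  moreover have "closed (bilinear_couplings M N)"
  proof -
    have c: "continuous_on UNIV (\<lambda>\<beta> :: 'a set \<times> ('b \<Rightarrow> real) \<Rightarrow> real. \<beta> i)" for i
      by (rule continuous_on_product_coordinates)
    show ?thesis
      unfolding bilinear_couplings_def
      by (intro closed_Collect_conj closed_Collect_all closed_Collect_imp open_Collect_const
          closed_Collect_eq[OF c continuous_on_const] closed_Collect_le[OF continuous_on_const c]
          closed_Collect_eq[OF c continuous_on_add[OF c c]]
          closed_Collect_eq[OF c continuous_on_mult[OF continuous_on_const c]])
  qed
  ultimately show ?thesis
    by (metis compact_Int_closed inf.absorb_iff2)
qed

text \<open>Supplies the segment along which the minimizer of the squared distance will be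
  varied.\<close>

lemma bilinear_couplings_convex:
  assumes \<beta>: "\<beta> \<in> bilinear_couplings M N" and \<beta>': "\<beta>' \<in> bilinear_couplings M N"
    and s: "0 \<le> s" "s \<le> 1"
  shows "(\<lambda>i. (1 - s) * \<beta> i + s * \<beta>' i) \<in> bilinear_couplings M N"
  unfolding bilinear_couplings_def
proof (intro CollectI conjI allI impI)
  fix A and f :: "'b \<Rightarrow> real" assume H: "A \<in> sets M \<and> integrable N f \<and> (\<forall>y\<in>space N. 0 \<le> f y)"
  show "0 \<le> (1 - s) * \<beta> (A, f) + s * \<beta>' (A, f)"
    by (intro add_nonneg_nonneg mult_nonneg_nonneg bilinear_couplings_nonneg[OF \<beta>] bilinear_couplings_nonneg[OF \<beta>'])
      (use H s in simp_all)
next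
  fix f :: "'b \<Rightarrow> real" assume "integrable N f"
  then show "(1 - s) * \<beta> (space M, f) + s * \<beta>' (space M, f) = integral\<^sup>L N f"
    by (simp add: bilinear_couplings_space[OF \<beta>] bilinear_couplings_space[OF \<beta>'] algebra_simps)
next
  fix A :: "'a set" and f :: "'b \<Rightarrow> real" assume "\<not> (A \<in> sets M \<and> integrable N f)"
  from bilinear_couplings_outside[OF \<beta> this] bilinear_couplings_outside[OF \<beta>' this]
  show "(1 - s) * \<beta> (A, f) + s * \<beta>' (A, f) = 0" by simp
next
  fix A :: "'a set" and f g :: "'b \<Rightarrow> real" assume "A \<in> sets M \<and> integrable N f \<and> integrable N g"
  then have "A \<in> sets M" "integrable N f" "integrable N g" by auto
  from bilinear_couplings_add[OF \<beta> this] bilinear_couplings_add[OF \<beta>' this]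
  show "(1 - s) * \<beta> (A, \<lambda>y. f y + g y) + s * \<beta>' (A, \<lambda>y. f y + g y) =
      (1 - s) * \<beta> (A, f) + s * \<beta>' (A, f) + ((1 - s) * \<beta> (A, g) + s * \<beta>' (A, g))"
    by (simp only: algebra_simps)
next
  fix A :: "'a set" and f :: "'b \<Rightarrow> real" and r assume "A \<in> sets M \<and> integrable N f"
  then have "A \<in> sets M" "integrable N f" by auto
  from bilinear_couplings_scale[OF \<beta> this] bilinear_couplings_scale[OF \<beta>' this]
  show "(1 - s) * \<beta> (A, \<lambda>y. r * f y) + s * \<beta>' (A, \<lambda>y. r * f y) = r * ((1 - s) * \<beta> (A, f) + s * \<beta>' (A, f))"
    by (simp only: algebra_simps)
next
  fix A B :: "'a set" and f :: "'b \<Rightarrow> real"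
  assume "A \<in> sets M \<and> B \<in> sets M \<and> A \<inter> B = {} \<and> integrable N f"
  then have "A \<in> sets M" "B \<in> sets M" "A \<inter> B = {}" "integrable N f" by auto
  from bilinear_couplings_Un[OF \<beta> this] bilinear_couplings_Un[OF \<beta>' this]
  show "(1 - s) * \<beta> (A \<union> B, f) + s * \<beta>' (A \<union> B, f) =
      (1 - s) * \<beta> (A, f) + s * \<beta>' (A, f) + ((1 - s) * \<beta> (B, f) + s * \<beta>' (B, f))"
    by (simp only: algebra_simps)
qed

text \<open>The support function of a finite set \<open>V\<close>. These are the only test functions
  to which the order is applied in the separation argument.\<close>

lemma convex_on_Max_inner:
  fixes V :: "'e::real_inner set"
  assumes "finite V" "V \<noteq> {}"
  shows "convex_on UNIV (\<lambda>z. Max ((\<lambda>u. u \<bullet> z) ` V))"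
    and "0 \<le> t \<Longrightarrow> Max ((\<lambda>u. u \<bullet> (t *\<^sub>R z)) ` V) = t * Max ((\<lambda>u. u \<bullet> z) ` V)"
proof -
  have ge: "u \<bullet> z \<le> Max ((\<lambda>u. u \<bullet> z) ` V)" if "u \<in> V" for u z
    using that assms by (intro Max_ge) auto
  show "convex_on UNIV (\<lambda>z. Max ((\<lambda>u. u \<bullet> z) ` V))"
  proof (intro convex_onI)
    fix r :: real and x y :: 'e assume r: "0 < r" "r < 1"
    show "Max ((\<lambda>u. u \<bullet> ((1 - r) *\<^sub>R x + r *\<^sub>R y)) ` V) \<le>
        (1 - r) * Max ((\<lambda>u. u \<bullet> x) ` V) + r * Max ((\<lambda>u. u \<bullet> y) ` V)"
    proof (rule Max.boundedI)
      fix c assume "c \<in> (\<lambda>u. u \<bullet> ((1 - r) *\<^sub>R x + r *\<^sub>R y)) ` V"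
      then obtain u where "u \<in> V" "c = (1 - r) * (u \<bullet> x) + r * (u \<bullet> y)" by (auto simp: inner_add_right)
      then show "c \<le> (1 - r) * Max ((\<lambda>u. u \<bullet> x) ` V) + r * Max ((\<lambda>u. u \<bullet> y) ` V)"
        using r ge[of u] by (simp add: add_mono mult_left_mono)
    qed (use assms in auto)
  qed auto
  assume t: "0 \<le> t"
  have "Max ((\<lambda>u. u \<bullet> (t *\<^sub>R z)) ` V) = Max ((\<lambda>r. t * r) ` ((\<lambda>u. u \<bullet> z) ` V))"
    by (simp add: image_image)
  also have "\<dots> = t * Max ((\<lambda>u. u \<bullet> z) ` V)"
    using assms t by (intro mono_Max_commute[symmetric] monoI) (auto intro: mult_left_mono)
  finally show "Max ((\<lambda>u. u \<bullet> (t *\<^sub>R z)) ` V) = t * Max ((\<lambda>u. u \<bullet> z) ` V)" .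
qed

text \<open>
  The mass at \<open>y\<close> is sent to those points \<open>x\<close> for which \<open>W x\<close> maximizes \<open>u \<bullet> \<eta> y\<close> among the values \<open>u\<close> of
  \<open>W\<close> of positive measure; ties are split evenly.
\<close>

lemma bilinear_coupling_maximizing:
  fixes M :: "'x measure" and N :: "'y measure" and W :: "'x \<Rightarrow> 'e::euclidean_space" and \<eta> :: "'y \<Rightarrow> 'e"
  assumes M: "prob_space M" and W: "W \<in> borel_measurable M" "finite (W ` space M)"
    and \<eta>: "integrable N \<eta>"
  obtains V \<beta> where "finite V" "V \<noteq> {}" "AE x in M. W x \<in> V" "\<beta> \<in> bilinear_couplings M N"
    "\<forall>S c. finite S \<and> S \<subseteq> sets M \<times> UNIV \<and>
      (\<forall>x\<in>space M. W x = (\<Sum>(A, v)\<in>S. (c (A, v) * indicator A x) *\<^sub>R v)) \<longrightarrow>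
      (\<Sum>(A, v)\<in>S. c (A, v) * \<beta> (A, \<lambda>y. \<eta> y \<bullet> v)) = (\<integral>y. Max ((\<lambda>u. u \<bullet> \<eta> y) ` V) \<partial>N)"
proof -
  interpret prob_space M by (rule M)
  note [measurable] = W(1)
  have [measurable]: "\<eta> \<in> borel_measurable N" using \<eta> by auto
  define Q where "Q u = W -` {u} \<inter> space M" for u
  have Q [measurable]: "Q u \<in> sets M" for u unfolding Q_def by measurable
  define V where "V = {u \<in> W ` space M. measure M (Q u) \<noteq> 0}"
  have finV: "finite V" unfolding V_def using W by simp
  have "AE x in M. \<forall>u\<in>W ` space M - V. x \<notin> Q u"
  proof (subst AE_ball_countable)
    show "countable (W ` space M - V)" using W by (simp add: countable_finite)
    show "\<forall>u\<in>W ` space M - V. AE x in M. x \<notin> Q u"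
    proof
      fix u assume "u \<in> W ` space M - V"
      then have "emeasure M (Q u) = 0" by (simp add: V_def emeasure_eq_measure)
      then show "AE x in M. x \<notin> Q u" by (intro AE_not_in) (simp add: null_sets_def)
    qed
  qed
  with AE_space have AEV: "AE x in M. W x \<in> V"
    by eventually_elim (auto simp: Q_def)
  have neV: "V \<noteq> {}"
  proof
    assume "V = {}"
    then have "AE x in M. False" using AEV by simp
    then show False by simp
  qed
  define \<phi> where "\<phi> z = Max ((\<lambda>u. u \<bullet> z) ` V)" for z
  have \<phi>_ge: "u \<bullet> z \<le> \<phi> z" if "u \<in> V" for u z
    unfolding \<phi>_def using that finV by (intro Max_ge) auto
  have \<phi>_in: "\<exists>u\<in>V. u \<bullet> z = \<phi> z" for z
  proof -
    have "\<phi> z \<in> (\<lambda>u. u \<bullet> z) ` V" unfolding \<phi>_def using finV neV by (intro Max_in) auto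
    then show ?thesis by auto
  qed
  have \<phi>_meas [measurable]: "(\<lambda>y. \<phi> (\<eta> y)) \<in> borel_measurable N"
    unfolding \<phi>_def using finV by (intro borel_measurable_Max) auto
  \<comment> \<open>\<open>k y\<close> counts the maximizers at \<open>y\<close>. It is at least 1
    because \<open>V\<close> is finite and nonempty, so the functions \<open>\<alpha> u\<close>
    below are a partition of unity that charges only maximizers.\<close>
  define k where "k y = (\<Sum>u\<in>V. if u \<bullet> \<eta> y = \<phi> (\<eta> y) then 1 else (0::real))" for y
  have k: "1 \<le> k y" for y
  proof -
    obtain u where u: "u \<in> V" "u \<bullet> \<eta> y = \<phi> (\<eta> y)" using \<phi>_in by blast
    have "(if u \<bullet> \<eta> y = \<phi> (\<eta> y) then 1 else (0::real)) \<le> k y"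
      unfolding k_def using u finV by (intro member_le_sum) auto
    with u show ?thesis by simp
  qed
  define \<alpha> where "\<alpha> u y = (if u \<bullet> \<eta> y = \<phi> (\<eta> y) then 1 else 0) / k y" for u y
  have \<alpha>_meas [measurable]: "\<alpha> u \<in> borel_measurable N" for u
    unfolding \<alpha>_def k_def by measurable
  have \<alpha>01: "0 \<le> \<alpha> u y" "\<alpha> u y \<le> 1" for u y
    using k[of y] by (auto simp: \<alpha>_def)
  have \<alpha>_sum: "(\<Sum>u\<in>V. \<alpha> u y) = 1" for y
    using k[of y] unfolding \<alpha>_def sum_divide_distrib[symmetric] k_def[symmetric] by simp
  have \<alpha>_max: "(u \<bullet> \<eta> y) * \<alpha> u y = \<phi> (\<eta> y) * \<alpha> u y" for u y
    by (simp add: \<alpha>_def)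
  have int: "integrable N (\<lambda>y. f y * \<alpha> u y)" if "integrable N f" for f u
    using \<alpha>01 by (intro Bochner_Integration.integrable_bound[OF that])
      (use that in \<open>auto simp: abs_mult intro!: mult_left_le AE_I2\<close>)
  \<comment> \<open>Inside a level set \<open>Q u\<close> the mass assigned to \<open>u\<close> is
    spread proportionally to \<open>M\<close>; the levels of measure zero had to be left out of
    \<open>V\<close> for this division.\<close>
  define \<beta> where "\<beta> i = (if fst i \<in> sets M \<and> integrable N (snd i)
    then \<Sum>u\<in>V. measure M (fst i \<inter> Q u) / measure M (Q u) * (\<integral>y. snd i y * \<alpha> u y \<partial>N) else 0)"
    for i :: "'x set \<times> ('y \<Rightarrow> real)"
  have \<beta>_eq: "\<beta> (A, f) = (\<Sum>u\<in>V. measure M (A \<inter> Q u) / measure M (Q u) * (\<integral>y. f y * \<alpha> u y \<partial>N))"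
    if "A \<in> sets M" "integrable N f" for A f
    using that by (simp add: \<beta>_def)
  have \<beta>_mem: "\<beta> \<in> bilinear_couplings M N"
    unfolding bilinear_couplings_def
  proof (intro CollectI conjI allI impI)
    fix A and f :: "'y \<Rightarrow> real" assume "\<not> (A \<in> sets M \<and> integrable N f)"
    then show "\<beta> (A, f) = 0" by (auto simp: \<beta>_def)
  next
    fix A and f :: "'y \<Rightarrow> real" assume H: "A \<in> sets M \<and> integrable N f \<and> (\<forall>y\<in>space N. 0 \<le> f y)"
    then show "0 \<le> \<beta> (A, f)"
      using \<alpha>01 by (subst \<beta>_eq)
        (auto intro!: sum_nonneg mult_nonneg_nonneg divide_nonneg_nonneg integral_nonneg_AE AE_I2)
  next
    fix A and f g :: "'y \<Rightarrow> real" assume H: "A \<in> sets M \<and> integrable N f \<and> integrable N g"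
    then show "\<beta> (A, \<lambda>y. f y + g y) = \<beta> (A, f) + \<beta> (A, g)"
      by (simp add: \<beta>_eq distrib_right distrib_left sum.distrib int)
  next
    fix A and f :: "'y \<Rightarrow> real" and r assume H: "A \<in> sets M \<and> integrable N f"
    then show "\<beta> (A, \<lambda>y. r * f y) = r * \<beta> (A, f)"
      by (simp add: \<beta>_eq sum_distrib_left mult.assoc mult.left_commute)
  next
    fix A B and f :: "'y \<Rightarrow> real" assume H: "A \<in> sets M \<and> B \<in> sets M \<and> A \<inter> B = {} \<and> integrable N f"
    have "measure M ((A \<union> B) \<inter> Q u) = measure M (A \<inter> Q u) + measure M (B \<inter> Q u)" for u
      unfolding Int_Un_distrib2 using H by (intro finite_measure_Union) auto
    then show "\<beta> (A \<union> B, f) = \<beta> (A, f) + \<beta> (B, f)"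
      using H sets.Un[of A M B] by (simp add: \<beta>_eq add_divide_distrib distrib_right sum.distrib)
  next
    fix f :: "'y \<Rightarrow> real" assume f: "integrable N f"
    have "\<beta> (space M, f) = (\<Sum>u\<in>V. \<integral>y. f y * \<alpha> u y \<partial>N)"
      unfolding \<beta>_eq[OF sets.top f]
    proof (rule sum.cong)
      fix u assume "u \<in> V"
      moreover have "space M \<inter> Q u = Q u" by (auto simp: Q_def)
      ultimately show "measure M (space M \<inter> Q u) / measure M (Q u) * (\<integral>y. f y * \<alpha> u y \<partial>N) = (\<integral>y. f y * \<alpha> u y \<partial>N)"
        by (simp add: V_def)
    qed simp
    also have "\<dots> = (\<integral>y. (\<Sum>u\<in>V. f y * \<alpha> u y) \<partial>N)"
      by (rule Bochner_Integration.integral_sum[symmetric]) (rule int[OF f])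
    also have "\<dots> = (\<integral>y. f y \<partial>N)"
      by (simp add: sum_distrib_left[symmetric] \<alpha>_sum)
    finally show "\<beta> (space M, f) = (\<integral>y. f y \<partial>N)" .
  qed
  have "(\<Sum>(A, v)\<in>S. c (A, v) * \<beta> (A, \<lambda>y. \<eta> y \<bullet> v)) = (\<integral>y. \<phi> (\<eta> y) \<partial>N)"
    if S: "finite S" "S \<subseteq> sets M \<times> UNIV"
      and W_eq: "\<And>x. x \<in> space M \<Longrightarrow> W x = (\<Sum>(A, v)\<in>S. (c (A, v) * indicator A x) *\<^sub>R v)" for S c
  proof -
    have int_v: "integrable N (\<lambda>y. \<eta> y \<bullet> v)" for v using \<eta> by simp
    have ind: "(\<integral>x. indicator B x *\<^sub>R v \<partial>M) = measure M B *\<^sub>R v" if "B \<in> sets M" for B and v :: 'e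
      using that sets.sets_into_space[OF that]
      by (subst integral_scaleR_left) (auto simp: emeasure_eq_measure Int_absorb2)
    \<comment> \<open>Integrating \<open>W\<close> over \<open>Q u\<close>, where it equals
      \<open>u\<close>, through its given representation. This converts a sum over the pairs in
      \<open>S\<close> into a sum over the levels in \<open>V\<close>.\<close>
    have bary: "(\<Sum>(A, v)\<in>S. (c (A, v) * measure M (A \<inter> Q u)) *\<^sub>R v) = measure M (Q u) *\<^sub>R u" for u
    proof -
      have "measure M (Q u) *\<^sub>R u = (\<integral>x. indicator (Q u) x *\<^sub>R u \<partial>M)"
        by (simp add: ind)
      also have "\<dots> = (\<integral>x. (\<Sum>i\<in>S. indicator (fst i \<inter> Q u) x *\<^sub>R (c i *\<^sub>R snd i)) \<partial>M)"
      proof (rule Bochner_Integration.integral_cong)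
        fix x assume x: "x \<in> space M"
        have "indicator (Q u) x *\<^sub>R u = indicator (Q u) x *\<^sub>R W x"
          using x by (auto simp: Q_def indicator_def)
        also have "\<dots> = (\<Sum>i\<in>S. indicator (fst i \<inter> Q u) x *\<^sub>R (c i *\<^sub>R snd i))"
          unfolding W_eq[OF x] scaleR_sum_right
          by (intro sum.cong) (auto simp: indicator_def split: if_splits)
        finally show "indicator (Q u) x *\<^sub>R u = (\<Sum>i\<in>S. indicator (fst i \<inter> Q u) x *\<^sub>R (c i *\<^sub>R snd i))" .
      qed simp
      also have "\<dots> = (\<Sum>i\<in>S. \<integral>x. indicator (fst i \<inter> Q u) x *\<^sub>R (c i *\<^sub>R snd i) \<partial>M)"
        using S by (intro Bochner_Integration.integral_sum integrable_scaleR_left integrable_real_indicator)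
          (auto simp: emeasure_eq_measure)
      also have "\<dots> = (\<Sum>i\<in>S. (c i * measure M (fst i \<inter> Q u)) *\<^sub>R snd i)"
        using S by (intro sum.cong refl, subst ind) (auto simp: mult.commute)
      finally show ?thesis by (simp add: case_prod_beta)
    qed
    have "(\<Sum>(A, v)\<in>S. c (A, v) * \<beta> (A, \<lambda>y. \<eta> y \<bullet> v)) =
        (\<Sum>i\<in>S. c i * (\<Sum>u\<in>V. measure M (fst i \<inter> Q u) / measure M (Q u) * (\<integral>y. (\<eta> y \<bullet> snd i) * \<alpha> u y \<partial>N)))"
      using S by (intro sum.cong) (auto simp: \<beta>_eq int_v)
    also have "\<dots> = (\<Sum>u\<in>V. \<Sum>i\<in>S. c i * measure M (fst i \<inter> Q u) / measure M (Q u) * (\<integral>y. (\<eta> y \<bullet> snd i) * \<alpha> u y \<partial>N))"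
      by (subst sum.swap) (simp add: sum_distrib_left mult.assoc)
    also have "\<dots> = (\<Sum>u\<in>V. \<integral>y. (u \<bullet> \<eta> y) * \<alpha> u y \<partial>N)"
    proof (rule sum.cong)
      fix u assume u: "u \<in> V"
      have "(\<Sum>i\<in>S. c i * measure M (fst i \<inter> Q u) / measure M (Q u) * (\<integral>y. (\<eta> y \<bullet> snd i) * \<alpha> u y \<partial>N)) =
          (\<integral>y. (\<Sum>i\<in>S. c i * measure M (fst i \<inter> Q u) / measure M (Q u) * ((\<eta> y \<bullet> snd i) * \<alpha> u y)) \<partial>N)"
        using int[OF int_v] by (subst Bochner_Integration.integral_sum) auto
      also have "\<dots> = (\<integral>y. (u \<bullet> \<eta> y) * \<alpha> u y \<partial>N)"
      proof (rule Bochner_Integration.integral_cong)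
        fix y
        have "(\<Sum>i\<in>S. c i * measure M (fst i \<inter> Q u) / measure M (Q u) * ((\<eta> y \<bullet> snd i) * \<alpha> u y)) =
            (\<eta> y \<bullet> (\<Sum>i\<in>S. (c i * measure M (fst i \<inter> Q u)) *\<^sub>R snd i)) / measure M (Q u) * \<alpha> u y"
          by (simp add: inner_sum_right sum_divide_distrib sum_distrib_right sum_distrib_left mult_ac)
        also have "(\<Sum>i\<in>S. (c i * measure M (fst i \<inter> Q u)) *\<^sub>R snd i) = measure M (Q u) *\<^sub>R u"
          using bary[of u] by (simp add: case_prod_beta)
        finally show "(\<Sum>i\<in>S. c i * measure M (fst i \<inter> Q u) / measure M (Q u) * ((\<eta> y \<bullet> snd i) * \<alpha> u y)) =
            (u \<bullet> \<eta> y) * \<alpha> u y"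
          using u by (simp add: V_def inner_commute)
      qed simp
      finally show "(\<Sum>i\<in>S. c i * measure M (fst i \<inter> Q u) / measure M (Q u) * (\<integral>y. (\<eta> y \<bullet> snd i) * \<alpha> u y \<partial>N)) =
          (\<integral>y. (u \<bullet> \<eta> y) * \<alpha> u y \<partial>N)" .
    qed simp
    also have "\<dots> = (\<integral>y. (\<Sum>u\<in>V. (u \<bullet> \<eta> y) * \<alpha> u y) \<partial>N)"
      using int[OF int_v] by (subst Bochner_Integration.integral_sum) (auto simp: inner_commute)
    also have "\<dots> = (\<integral>y. \<phi> (\<eta> y) \<partial>N)"
      by (simp add: \<alpha>_max sum_distrib_left[symmetric] \<alpha>_sum)
    finally show ?thesis .
  qed
  then show thesis
    by (intro that[OF finV neV AEV \<beta>_mem]) (simp add: \<phi>_def)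
qed

text \<open>
  Let \<open>\<beta>0\<close> minimize the squared distance of the barycenters to their targets and let \<open>c\<close> be the residual.
  By minimality \<open>\<beta>0\<close> is at least as good in the direction \<open>c\<close> as the maximizing coupling for
  \<open>W = \<Sum>c(A, v) 1\<^sub>A v\<close>, which by the order assumption is at least as good as the targets. So \<open>c = 0\<close>.
\<close>

lemma finite_barycentric_coupling:
  fixes M :: "'x measure" and N :: "'y measure" and P :: "'p measure"
    and g :: "'p \<Rightarrow> 'e::euclidean_space" and \<eta> :: "'y \<Rightarrow> 'e"
  assumes M: "prob_space M" and p [measurable]: "p \<in> P \<rightarrow>\<^sub>M M" and distr: "distr P M p = M"
    and g: "integrable P g" and \<eta>: "integrable N \<eta>"
    and order: "\<And>\<phi>. convex_on UNIV \<phi> \<Longrightarrow> (\<And>t x. 0 \<le> t \<Longrightarrow> \<phi> (t *\<^sub>R x) = t * \<phi> x) \<Longrightarrow>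
      (\<integral>\<omega>. \<phi> (g \<omega>) \<partial>P) \<le> (\<integral>y. \<phi> (\<eta> y) \<partial>N)"
    and S: "finite S" "S \<subseteq> sets M \<times> UNIV"
  shows "\<exists>\<beta>\<in>bilinear_couplings M N. \<forall>(A, v)\<in>S.
    \<beta> (A, \<lambda>y. \<eta> y \<bullet> v) = (\<integral>\<omega>. indicator A (p \<omega>) * (g \<omega> \<bullet> v) \<partial>P)"
proof -
  have [measurable]: "g \<in> borel_measurable P" using g by auto
  define b where "b i \<beta> = \<beta> (fst i, \<lambda>y. \<eta> y \<bullet> snd i)"
    for i :: "'x set \<times> 'e" and \<beta> :: "'x set \<times> ('y \<Rightarrow> real) \<Rightarrow> real"
  define t where "t i = (\<integral>\<omega>. indicator (fst i) (p \<omega>) * (g \<omega> \<bullet> snd i) \<partial>P)" for i :: "'x set \<times> 'e"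
  have int_i: "integrable P (\<lambda>\<omega>. indicator (fst i) (p \<omega>) * (g \<omega> \<bullet> snd i))" if "i \<in> S" for i
  proof -
    have [measurable]: "fst i \<in> sets M" using that S by auto
    have gi: "integrable P (\<lambda>\<omega>. g \<omega> \<bullet> snd i)" using g by simp
    show ?thesis
      by (rule Bochner_Integration.integrable_bound[OF gi]) (auto simp: indicator_def)
  qed
  define J where "J \<beta> = (\<Sum>i\<in>S. (b i \<beta> - t i)\<^sup>2)" for \<beta>
  have cont: "continuous_on U J" for U
    unfolding J_def b_def
    by (intro continuous_on_sum continuous_on_power continuous_on_diff continuous_on_const
        continuous_on_subset[OF continuous_on_product_coordinates subset_UNIV])
  \<comment> \<open>Every admissible \<open>W\<close> yields a coupling; the zero function is the
    simplest choice.\<close>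
  have ne: "bilinear_couplings M N \<noteq> {}"
    by (rule bilinear_coupling_maximizing[OF M, of "\<lambda>_. 0" N \<eta>])
      (use \<eta> in \<open>auto intro: finite_subset[of _ "{0}"]\<close>)
  obtain \<beta>0 where \<beta>0: "\<beta>0 \<in> bilinear_couplings M N"
    and min: "\<And>\<beta>. \<beta> \<in> bilinear_couplings M N \<Longrightarrow> J \<beta>0 \<le> J \<beta>"
    using continuous_attains_inf[OF compact_bilinear_couplings ne cont] by blast
  define c where "c i = t i - b i \<beta>0" for i
  define W where "W x = (\<Sum>(A, v)\<in>S. (c (A, v) * indicator A x) *\<^sub>R v)" for x
  have W_alt: "W x = (\<Sum>i\<in>S. (c i * indicator (fst i) x) *\<^sub>R snd i)" for x
    by (simp add: W_def case_prod_beta)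
  have W_inner: "W x \<bullet> z = (\<Sum>i\<in>S. c i * (indicator (fst i) x * (z \<bullet> snd i)))" for x z
    by (simp add: W_alt inner_sum_left mult.assoc inner_commute[of z])
  \<comment> \<open>\<open>W x\<close> depends only on which of the finitely many sets contain
    \<open>x\<close>, so \<open>W\<close> has finitely many values.\<close>
  have "W x = (\<Sum>i\<in>{i\<in>S. x \<in> fst i}. c i *\<^sub>R snd i)" for x
    unfolding W_alt using S by (subst sum.inter_filter) (auto intro!: sum.cong simp: indicator_def)
  then have "W ` space M \<subseteq> (\<lambda>T. \<Sum>i\<in>T. c i *\<^sub>R snd i) ` Pow S" by auto
  then have W_fin: "finite (W ` space M)"
    by (rule finite_subset) (use S in simp)
  have W_meas [measurable]: "W \<in> borel_measurable M"
    unfolding W_alt using S by (intro borel_measurable_sum borel_measurable_scaleR) auto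
  obtain V \<beta>1 where V: "finite V" "V \<noteq> {}" "AE x in M. W x \<in> V" and \<beta>1: "\<beta>1 \<in> bilinear_couplings M N"
    and eq: "\<forall>S c. finite S \<and> S \<subseteq> sets M \<times> UNIV \<and>
      (\<forall>x\<in>space M. W x = (\<Sum>(A, v)\<in>S. (c (A, v) * indicator A x) *\<^sub>R v)) \<longrightarrow>
      (\<Sum>(A, v)\<in>S. c (A, v) * \<beta>1 (A, \<lambda>y. \<eta> y \<bullet> v)) = (\<integral>y. Max ((\<lambda>u. u \<bullet> \<eta> y) ` V) \<partial>N)"
    by (rule bilinear_coupling_maximizing[OF M W_meas W_fin \<eta>])

  \<comment> \<open>Paired with \<open>c\<close>, the targets give the integral of
    \<open>W (p \<omega>) \<bullet> g \<omega>\<close>. Since \<open>p\<close> has law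
    \<open>M\<close>, \<open>W (p \<omega>)\<close> lies in \<open>V\<close> almost everywhere, so
    the integrand is at most the maximum over \<open>V\<close>, to which \<open>order\<close>
    applies.\<close>
  have "(\<Sum>i\<in>S. c i * t i) = (\<Sum>i\<in>S. \<integral>\<omega>. c i * (indicator (fst i) (p \<omega>) * (g \<omega> \<bullet> snd i)) \<partial>P)"
    by (simp add: t_def)
  also have "\<dots> = (\<integral>\<omega>. (\<Sum>i\<in>S. c i * (indicator (fst i) (p \<omega>) * (g \<omega> \<bullet> snd i))) \<partial>P)"
    by (rule Bochner_Integration.integral_sum[symmetric]) (rule integrable_mult_right[OF int_i])
  also have "\<dots> = (\<integral>\<omega>. W (p \<omega>) \<bullet> g \<omega> \<partial>P)"
    by (simp add: W_inner)
  also have "\<dots> \<le> (\<integral>\<omega>. Max ((\<lambda>u. u \<bullet> g \<omega>) ` V) \<partial>P)"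
  proof (rule integral_mono_AE)
    have "integrable P (\<lambda>\<omega>. (\<Sum>i\<in>S. c i * (indicator (fst i) (p \<omega>) * (g \<omega> \<bullet> snd i))))"
      by (intro Bochner_Integration.integrable_sum integrable_mult_right[OF int_i])
    then show "integrable P (\<lambda>\<omega>. W (p \<omega>) \<bullet> g \<omega>)"
      by (simp add: W_inner)
    have "integrable P (\<lambda>\<omega>. \<Sum>u\<in>V. \<bar>u \<bullet> g \<omega>\<bar>)"
      using g by (intro Bochner_Integration.integrable_sum integrable_abs) auto
    then show "integrable P (\<lambda>\<omega>. Max ((\<lambda>u. u \<bullet> g \<omega>) ` V))"
    proof (rule Bochner_Integration.integrable_bound)
      show "(\<lambda>\<omega>. Max ((\<lambda>u. u \<bullet> g \<omega>) ` V)) \<in> borel_measurable P"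
        using V by (intro borel_measurable_Max) auto
      have "\<bar>Max ((\<lambda>u. u \<bullet> z) ` V)\<bar> \<le> (\<Sum>u\<in>V. \<bar>u \<bullet> z\<bar>)" for z
      proof -
        have "Max ((\<lambda>u. u \<bullet> z) ` V) \<in> (\<lambda>u. u \<bullet> z) ` V" using V by (intro Max_in) auto
        then obtain u where "u \<in> V" "Max ((\<lambda>u. u \<bullet> z) ` V) = u \<bullet> z" by auto
        then show ?thesis using V(1) member_le_sum[of u V "\<lambda>u. \<bar>u \<bullet> z\<bar>"] by simp
      qed
      then show "AE \<omega> in P. norm (Max ((\<lambda>u. u \<bullet> g \<omega>) ` V)) \<le> norm (\<Sum>u\<in>V. \<bar>u \<bullet> g \<omega>\<bar>)"
        by (simp add: abs_of_nonneg sum_nonneg)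
    qed
    have "AE x in distr P M p. W x \<in> V" unfolding distr by (rule V(3))
    then have "AE \<omega> in P. W (p \<omega>) \<in> V" by (rule AE_distrD[OF p])
    then show "AE \<omega> in P. W (p \<omega>) \<bullet> g \<omega> \<le> Max ((\<lambda>u. u \<bullet> g \<omega>) ` V)"
      by eventually_elim (use V(1) in \<open>auto intro!: Max_ge\<close>)
  qed
  also have "\<dots> \<le> (\<integral>y. Max ((\<lambda>u. u \<bullet> \<eta> y) ` V) \<partial>N)"
    by (rule order[OF convex_on_Max_inner(1)[OF V(1,2)] convex_on_Max_inner(2)[OF V(1,2)]])
  also have "\<dots> = (\<Sum>i\<in>S. c i * b i \<beta>1)"
    using eq[rule_format, of S c] S by (simp add: W_def case_prod_beta b_def)
  finally have ge: "(\<Sum>i\<in>S. c i * t i) \<le> (\<Sum>i\<in>S. c i * b i \<beta>1)" .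

  define d where "d i = b i \<beta>1 - b i \<beta>0" for i
  \<comment> \<open>First variation of \<open>J\<close> from \<open>\<beta>0\<close> towards
    \<open>\<beta>1\<close>: the residual becomes \<open>s * d i - c i\<close> up to sign. Expanding
    the squares, dividing by \<open>s\<close> and letting \<open>s\<close> tend to 0 shows that
    \<open>c\<close> has nonpositive inner product with \<open>d\<close>.\<close>
  have le: "2 * (\<Sum>i\<in>S. c i * d i) \<le> s * (\<Sum>i\<in>S. (d i)\<^sup>2)" if s: "0 < s" "s \<le> 1" for s
  proof -
    have "J \<beta>0 \<le> J (\<lambda>i. (1 - s) * \<beta>0 i + s * \<beta>1 i)"
      using s by (intro min bilinear_couplings_convex[OF \<beta>0 \<beta>1]) auto
    also have "\<dots> = (\<Sum>i\<in>S. (s * d i - c i)\<^sup>2)"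
      unfolding J_def by (intro sum.cong refl arg_cong[of _ _ "\<lambda>r. r\<^sup>2"]) (simp add: b_def d_def c_def algebra_simps)
    also have "\<dots> = s\<^sup>2 * (\<Sum>i\<in>S. (d i)\<^sup>2) - 2 * s * (\<Sum>i\<in>S. c i * d i) + J \<beta>0"
      unfolding J_def sum_distrib_left sum_subtractf[symmetric] sum.distrib[symmetric]
      by (intro sum.cong refl) (simp add: c_def power2_eq_square algebra_simps)
    finally have "s * (2 * (\<Sum>i\<in>S. c i * d i)) \<le> s * (s * (\<Sum>i\<in>S. (d i)\<^sup>2))"
      by (simp add: power2_eq_square mult_ac)
    then show ?thesis using s by (simp only: mult_le_cancel_left_pos)
  qed
  have "2 * (\<Sum>i\<in>S. c i * d i) \<le> 0"
  proof (rule tendsto_lowerbound[of "\<lambda>n. 1 / real (Suc n) * (\<Sum>i\<in>S. (d i)\<^sup>2)" _ sequentially])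
    have "(\<lambda>n. 1 / real (Suc n) * (\<Sum>i\<in>S. (d i)\<^sup>2)) \<longlonglongrightarrow> 0 * (\<Sum>i\<in>S. (d i)\<^sup>2)"
      by (rule tendsto_mult[OF LIMSEQ_Suc[OF lim_1_over_n] tendsto_const])
    then show "(\<lambda>n. 1 / real (Suc n) * (\<Sum>i\<in>S. (d i)\<^sup>2)) \<longlonglongrightarrow> 0" by simp
    show "\<forall>\<^sub>F n in sequentially. 2 * (\<Sum>i\<in>S. c i * d i) \<le> 1 / real (Suc n) * (\<Sum>i\<in>S. (d i)\<^sup>2)"
      by (intro always_eventually allI le) auto
  qed simp
  then have "(\<Sum>i\<in>S. c i * b i \<beta>1) \<le> (\<Sum>i\<in>S. c i * b i \<beta>0)"
    by (simp add: d_def right_diff_distrib sum_subtractf)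
  \<comment> \<open>The values of \<open>c\<close> on the targets, on \<open>\<beta>1\<close> and on
    \<open>\<beta>0\<close> are now ordered increasingly, while the first exceeds the last by
    exactly the sum of the squares of \<open>c\<close>.\<close>
  with ge have "(\<Sum>i\<in>S. (c i)\<^sup>2) \<le> 0"
    by (simp add: c_def power2_eq_square right_diff_distrib sum_subtractf)
  then have "\<forall>i\<in>S. (c i)\<^sup>2 = 0"
    using S(1) by (subst sum_nonneg_eq_0_iff[symmetric]) (auto intro!: antisym sum_nonneg)
  then have "\<forall>i\<in>S. b i \<beta>0 = t i" by (simp add: c_def)
  then show ?thesis
    using \<beta>0 by (intro bexI[of _ \<beta>0]) (auto simp: b_def t_def)
qed

text \<open>Each barycenter condition is an equation for one coordinate of \<open>\<beta>\<close>,
  hence closed, and any finitely many can be met together; the finite intersection property in the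
  compact set of couplings does the rest.\<close>

lemma barycentric_coupling:
  fixes M :: "'x measure" and N :: "'y measure" and P :: "'p measure"
    and g :: "'p \<Rightarrow> 'e::euclidean_space" and \<eta> :: "'y \<Rightarrow> 'e"
  assumes M: "prob_space M" and p [measurable]: "p \<in> P \<rightarrow>\<^sub>M M" and distr: "distr P M p = M"
    and g: "integrable P g" and \<eta>: "integrable N \<eta>"
    and order: "\<And>\<phi>. convex_on UNIV \<phi> \<Longrightarrow> (\<And>t x. 0 \<le> t \<Longrightarrow> \<phi> (t *\<^sub>R x) = t * \<phi> x) \<Longrightarrow>
      (\<integral>\<omega>. \<phi> (g \<omega>) \<partial>P) \<le> (\<integral>y. \<phi> (\<eta> y) \<partial>N)"
  obtains \<beta> where "\<beta> \<in> bilinear_couplings M N"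
    "\<And>A v. A \<in> sets M \<Longrightarrow> \<beta> (A, \<lambda>y. \<eta> y \<bullet> v) = (\<integral>\<omega>. indicator A (p \<omega>) * (g \<omega> \<bullet> v) \<partial>P)"
proof -
  define C where "C i = {\<beta>. \<beta> (fst i, \<lambda>y. \<eta> y \<bullet> snd i) = (\<integral>\<omega>. indicator (fst i) (p \<omega>) * (g \<omega> \<bullet> snd i) \<partial>P)}"
    for i :: "'x set \<times> 'e"
  have "bilinear_couplings M N \<inter> \<Inter> (C ` (sets M \<times> UNIV)) \<noteq> {}"
  proof (rule compact_imp_fip[OF compact_bilinear_couplings])
    show "closed T" if "T \<in> C ` (sets M \<times> UNIV)" for T
      using that unfolding C_def
      by (auto intro!: closed_Collect_eq continuous_on_const continuous_on_product_coordinates)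
    show "bilinear_couplings M N \<inter> \<Inter> F \<noteq> {}" if F: "finite F" "F \<subseteq> C ` (sets M \<times> UNIV)" for F
    proof -
      obtain S where S: "finite S" "S \<subseteq> sets M \<times> UNIV" "F = C ` S"
        using finite_subset_image[OF F] by auto
      obtain \<beta> where "\<beta> \<in> bilinear_couplings M N"
        "\<forall>(A, v)\<in>S. \<beta> (A, \<lambda>y. \<eta> y \<bullet> v) = (\<integral>\<omega>. indicator A (p \<omega>) * (g \<omega> \<bullet> v) \<partial>P)"
        using finite_barycentric_coupling[OF M p distr g \<eta> order S(1,2)] by blast
      then have "\<beta> \<in> bilinear_couplings M N \<inter> \<Inter> F"
        unfolding S(3) C_def by auto
      then show ?thesis by blast
    qed
  qed
  then obtain \<beta> where \<beta>: "\<beta> \<in> bilinear_couplings M N" "\<And>i. i \<in> sets M \<times> UNIV \<Longrightarrow> \<beta> \<in> C i" by auto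
  show thesis
    by (rule that[OF \<beta>(1)]) (use \<beta>(2)[of "(A, v)" for A v] in \<open>auto simp: C_def\<close>)
qed

section \<open>Kernels\<close>

text \<open>The masses of \<open>q x\<close> may exceed 1, so \<open>q\<close> is not a kernel of
  subprobability measures. Both claims go through one induction on \<open>f\<close>, because the
  steps for the integral use the measurability of the inner integrals.\<close>

lemma
  fixes q :: "'x \<Rightarrow> 'y measure" and f :: "'y \<Rightarrow> ennreal"
  assumes q: "\<And>x. x \<in> space M \<Longrightarrow> sets (q x) = sets N"
    and meas: "\<And>A. A \<in> sets N \<Longrightarrow> (\<lambda>x. emeasure (q x) A) \<in> borel_measurable M"
    and f: "f \<in> borel_measurable N"
  shows borel_measurable_kernel_nn_integral: "(\<lambda>x. \<integral>\<^sup>+y. f y \<partial>q x) \<in> borel_measurable M"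
    and nn_integral_kernel: "(\<And>A. A \<in> sets N \<Longrightarrow> (\<integral>\<^sup>+x. emeasure (q x) A \<partial>M) = emeasure N A) \<Longrightarrow>
      (\<integral>\<^sup>+x. \<integral>\<^sup>+y. f y \<partial>q x \<partial>M) = (\<integral>\<^sup>+y. f y \<partial>N)"
proof -
  have mq: "g \<in> borel_measurable (q x)" if "x \<in> space M" "g \<in> borel_measurable N" for x and g :: "'y \<Rightarrow> ennreal"
    using that q by (simp cong: measurable_cong_sets)
  have "(\<lambda>x. \<integral>\<^sup>+y. f y \<partial>q x) \<in> borel_measurable M \<and>
    ((\<forall>A\<in>sets N. (\<integral>\<^sup>+x. emeasure (q x) A \<partial>M) = emeasure N A) \<longrightarrow>
      (\<integral>\<^sup>+x. \<integral>\<^sup>+y. f y \<partial>q x \<partial>M) = (\<integral>\<^sup>+y. f y \<partial>N))"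
    using f
  proof (induction f rule: borel_measurable_induct)
    case (cong f g)
    have "(\<integral>\<^sup>+y. f y \<partial>q x) = (\<integral>\<^sup>+y. g y \<partial>q x)" if "x \<in> space M" for x
      using sets_eq_imp_space_eq[OF q[OF that]] cong(3) by (intro nn_integral_cong) auto
    moreover have "(\<integral>\<^sup>+y. f y \<partial>N) = (\<integral>\<^sup>+y. g y \<partial>N)"
      by (intro nn_integral_cong cong)
    ultimately show ?case
      using cong.IH by (auto cong: measurable_cong nn_integral_cong)
  next
    case (set A)
    then have "(\<integral>\<^sup>+y. indicator A y \<partial>q x) = emeasure (q x) A" if "x \<in> space M" for x
      using q[OF that] by simp
    with set show ?case
      using meas[OF set] by (auto cong: measurable_cong nn_integral_cong)
  next
    case (mult g c)
    have "(\<integral>\<^sup>+y. c * g y \<partial>q x) = c * (\<integral>\<^sup>+y. g y \<partial>q x)" if "x \<in> space M" for x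
      by (intro nn_integral_cmult mq that mult)
    with mult show ?case
      by (auto cong: measurable_cong nn_integral_cong simp: nn_integral_cmult)
  next
    case (add g h)
    have "(\<integral>\<^sup>+y. h y + g y \<partial>q x) = (\<integral>\<^sup>+y. h y \<partial>q x) + (\<integral>\<^sup>+y. g y \<partial>q x)" if "x \<in> space M" for x
      by (intro nn_integral_add mq that add)
    with add show ?case
      by (auto cong: measurable_cong nn_integral_cong simp: nn_integral_add)
  next
    case (seq U)
    have eq: "(\<integral>\<^sup>+y. (SUP i. U i) y \<partial>q x) = (SUP i. \<integral>\<^sup>+y. U i y \<partial>q x)" if "x \<in> space M" for x
      unfolding SUP_apply by (intro nn_integral_monotone_convergence_SUP mq that seq)
    have inc: "incseq (\<lambda>i x. \<integral>\<^sup>+y. U i y \<partial>q x)"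
      using seq(3) by (auto simp: incseq_def le_fun_def intro!: nn_integral_mono)
    have "(\<lambda>x. SUP i. \<integral>\<^sup>+y. U i y \<partial>q x) \<in> borel_measurable M"
      using seq by (intro borel_measurable_SUP) auto
    moreover have "(\<integral>\<^sup>+x. \<integral>\<^sup>+y. (SUP i. U i) y \<partial>q x \<partial>M) = (\<integral>\<^sup>+y. (SUP i. U i) y \<partial>N)"
      if "\<forall>A\<in>sets N. (\<integral>\<^sup>+x. emeasure (q x) A \<partial>M) = emeasure N A"
    proof -
      have "(\<integral>\<^sup>+x. \<integral>\<^sup>+y. (SUP i. U i) y \<partial>q x \<partial>M) = (\<integral>\<^sup>+x. (SUP i. \<integral>\<^sup>+y. U i y \<partial>q x) \<partial>M)"
        by (intro nn_integral_cong eq)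
      also have "\<dots> = (SUP i. \<integral>\<^sup>+x. \<integral>\<^sup>+y. U i y \<partial>q x \<partial>M)"
        using seq inc by (intro nn_integral_monotone_convergence_SUP) auto
      also have "\<dots> = (SUP i. \<integral>\<^sup>+y. U i y \<partial>N)"
        using seq that by auto
      also have "\<dots> = (\<integral>\<^sup>+y. (SUP i. U i) y \<partial>N)"
        unfolding SUP_apply by (intro nn_integral_monotone_convergence_SUP[symmetric] seq)
      finally show ?thesis .
    qed
    ultimately show ?case
      using eq by (auto cong: measurable_cong)
  qed
  then show "(\<lambda>x. \<integral>\<^sup>+y. f y \<partial>q x) \<in> borel_measurable M"
    and "(\<And>A. A \<in> sets N \<Longrightarrow> (\<integral>\<^sup>+x. emeasure (q x) A \<partial>M) = emeasure N A) \<Longrightarrow>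
      (\<integral>\<^sup>+x. \<integral>\<^sup>+y. f y \<partial>q x \<partial>M) = (\<integral>\<^sup>+y. f y \<partial>N)"
    by auto
qed

text \<open>Where \<open>f\<close> is not integrable against \<open>q x\<close> the Bochner integral
  is 0; finiteness of the absolute integral makes this a measurable case distinction.\<close>

lemma borel_measurable_kernel_integral:
  fixes q :: "'x \<Rightarrow> 'y measure" and f :: "'y \<Rightarrow> real"
  assumes q: "\<And>x. x \<in> space M \<Longrightarrow> sets (q x) = sets N"
    and meas: "\<And>A. A \<in> sets N \<Longrightarrow> (\<lambda>x. emeasure (q x) A) \<in> borel_measurable M"
    and f [measurable]: "f \<in> borel_measurable N"
  shows "(\<lambda>x. \<integral>y. f y \<partial>q x) \<in> borel_measurable M"
proof -
  note mk = borel_measurable_kernel_nn_integral[OF q meas]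
  have [measurable]: "(\<lambda>x. \<integral>\<^sup>+y. ennreal (f y) \<partial>q x) \<in> borel_measurable M"
    "(\<lambda>x. \<integral>\<^sup>+y. ennreal (- f y) \<partial>q x) \<in> borel_measurable M"
    "(\<lambda>x. \<integral>\<^sup>+y. ennreal \<bar>f y\<bar> \<partial>q x) \<in> borel_measurable M"
    by (intro mk; simp)+
  have "(\<integral>y. f y \<partial>q x) = (if (\<integral>\<^sup>+y. ennreal \<bar>f y\<bar> \<partial>q x) < \<infinity>
      then enn2real (\<integral>\<^sup>+y. ennreal (f y) \<partial>q x) - enn2real (\<integral>\<^sup>+y. ennreal (- f y) \<partial>q x) else 0)"
    if "x \<in> space M" for x
  proof -
    have "f \<in> borel_measurable (q x)" using q[OF that] by (simp cong: measurable_cong_sets)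
    then have "integrable (q x) f \<longleftrightarrow> (\<integral>\<^sup>+y. ennreal \<bar>f y\<bar> \<partial>q x) < \<infinity>"
      by (simp add: integrable_iff_bounded)
    then show ?thesis
      by (simp add: real_lebesgue_integral_def not_integrable_integral_eq)
  qed
  then show ?thesis by (simp cong: measurable_cong)
qed

text \<open>Fubini for kernels: the iterated integral of \<open>\<bar>f y\<bar>\<close> equals its
  integral over \<open>N\<close>, which is finite, so \<open>f\<close> is integrable against almost
  every \<open>q x\<close>. Positive and negative parts are then treated separately.\<close>

lemma
  fixes q :: "'x \<Rightarrow> 'y measure" and f :: "'y \<Rightarrow> real"
  assumes q: "\<And>x. x \<in> space M \<Longrightarrow> sets (q x) = sets N"
    and meas: "\<And>A. A \<in> sets N \<Longrightarrow> (\<lambda>x. emeasure (q x) A) \<in> borel_measurable M"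
    and total: "\<And>A. A \<in> sets N \<Longrightarrow> (\<integral>\<^sup>+x. emeasure (q x) A \<partial>M) = emeasure N A"
    and f: "integrable N f"
  shows AE_integrable_kernel: "AE x in M. integrable (q x) f"
    and integrable_kernel_integral: "integrable M (\<lambda>x. \<integral>y. f y \<partial>q x)"
    and integral_abs_kernel_integral_le: "(\<integral>x. \<bar>\<integral>y. f y \<partial>q x\<bar> \<partial>M) \<le> (\<integral>y. \<bar>f y\<bar> \<partial>N)"
    and integral_kernel: "(\<integral>x. \<integral>y. f y \<partial>q x \<partial>M) = (\<integral>y. f y \<partial>N)"
proof -
  have [measurable]: "f \<in> borel_measurable N" using f by auto
  have mq: "f \<in> borel_measurable (q x)" if "x \<in> space M" for x
    using q[OF that] by (simp cong: measurable_cong_sets)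
  have nn: "(\<integral>\<^sup>+x. \<integral>\<^sup>+y. ennreal (g y) \<partial>q x \<partial>M) = (\<integral>\<^sup>+y. ennreal (g y) \<partial>N)"
    "(\<lambda>x. \<integral>\<^sup>+y. ennreal (g y) \<partial>q x) \<in> borel_measurable M"
    if [measurable]: "g \<in> borel_measurable N" for g
    by (rule nn_integral_kernel[OF q meas _ total] borel_measurable_kernel_nn_integral[OF q meas]; simp)+
  have abs_fin: "(\<integral>\<^sup>+y. ennreal \<bar>f y\<bar> \<partial>N) < \<infinity>"
    using f by (simp add: integrable_iff_bounded)
  then have "AE x in M. (\<integral>\<^sup>+y. ennreal \<bar>f y\<bar> \<partial>q x) \<noteq> \<infinity>"
    using nn[of "\<lambda>y. \<bar>f y\<bar>"] by (intro nn_integral_PInf_AE) auto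
  with AE_space show AE_int: "AE x in M. integrable (q x) f"
    by eventually_elim (use mq in \<open>auto simp: integrable_iff_bounded less_top[symmetric]\<close>)
  have le: "AE x in M. ennreal \<bar>\<integral>y. f y \<partial>q x\<bar> \<le> (\<integral>\<^sup>+y. ennreal \<bar>f y\<bar> \<partial>q x)"
    using AE_int integral_norm_bound_ennreal[of _ f] by (auto elim!: eventually_mono)
  have m [measurable]: "(\<lambda>x. \<integral>y. f y \<partial>q x) \<in> borel_measurable M"
    by (rule borel_measurable_kernel_integral[OF q meas]) simp_all
  have le': "(\<integral>\<^sup>+x. ennreal \<bar>\<integral>y. f y \<partial>q x\<bar> \<partial>M) \<le> (\<integral>\<^sup>+y. ennreal \<bar>f y\<bar> \<partial>N)"
    using nn_integral_mono_AE[OF le] nn(1)[of "\<lambda>y. \<bar>f y\<bar>"] by simp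
  then show int: "integrable M (\<lambda>x. \<integral>y. f y \<partial>q x)"
    using abs_fin by (auto simp: integrable_iff_bounded)
  have "ennreal (\<integral>x. \<bar>\<integral>y. f y \<partial>q x\<bar> \<partial>M) = (\<integral>\<^sup>+x. ennreal \<bar>\<integral>y. f y \<partial>q x\<bar> \<partial>M)"
    by (intro nn_integral_eq_integral[symmetric] integrable_abs int) auto
  also note le'
  also have "(\<integral>\<^sup>+y. ennreal \<bar>f y\<bar> \<partial>N) = ennreal (\<integral>y. \<bar>f y\<bar> \<partial>N)"
    by (intro nn_integral_eq_integral integrable_abs f) auto
  finally show "(\<integral>x. \<bar>\<integral>y. f y \<partial>q x\<bar> \<partial>M) \<le> (\<integral>y. \<bar>f y\<bar> \<partial>N)"
    by (simp add: integral_nonneg_AE)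
  have fin: "(\<integral>\<^sup>+y. ennreal (g y) \<partial>N) < \<infinity>" if "\<And>y. g y \<le> \<bar>f y\<bar>" for g
    by (rule order_le_less_trans[OF nn_integral_mono abs_fin]) (rule ennreal_leI[OF that])
  \<comment> \<open>To be used for \<open>f\<close> and \<open>- f\<close>. The conversion
    \<open>enn2real\<close> loses nothing, since the inner integrals are finite almost
    everywhere.\<close>
  have pos: "(\<integral>x. enn2real (\<integral>\<^sup>+y. ennreal (g y) \<partial>q x) \<partial>M) = enn2real (\<integral>\<^sup>+y. ennreal (g y) \<partial>N) \<and>
      integrable M (\<lambda>x. enn2real (\<integral>\<^sup>+y. ennreal (g y) \<partial>q x))"
    if g [measurable]: "g \<in> borel_measurable N" and le: "\<And>y. g y \<le> \<bar>f y\<bar>" for g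
  proof -
    have "AE x in M. (\<integral>\<^sup>+y. ennreal (g y) \<partial>q x) \<noteq> \<infinity>"
      using nn[OF g] fin[OF le] by (intro nn_integral_PInf_AE) auto
    then have "(\<integral>\<^sup>+x. ennreal (enn2real (\<integral>\<^sup>+y. ennreal (g y) \<partial>q x)) \<partial>M) = (\<integral>\<^sup>+x. \<integral>\<^sup>+y. ennreal (g y) \<partial>q x \<partial>M)"
      by (intro nn_integral_cong_AE, eventually_elim) (simp add: less_top)
    then have *: "(\<integral>\<^sup>+x. ennreal (enn2real (\<integral>\<^sup>+y. ennreal (g y) \<partial>q x)) \<partial>M) = (\<integral>\<^sup>+y. ennreal (g y) \<partial>N)"
      using nn[OF g] by simp
    have "integrable M (\<lambda>x. enn2real (\<integral>\<^sup>+y. ennreal (g y) \<partial>q x))"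
      using * fin[OF le] nn(2)[OF g] by (intro integrableI_bounded) auto
    then show ?thesis
      using * nn(2)[OF g] by (auto simp: integral_eq_nn_integral)
  qed
  have "(\<integral>x. \<integral>y. f y \<partial>q x \<partial>M) =
      (\<integral>x. enn2real (\<integral>\<^sup>+y. ennreal (f y) \<partial>q x) - enn2real (\<integral>\<^sup>+y. ennreal (- f y) \<partial>q x) \<partial>M)"
    using AE_int by (intro integral_cong_AE) (auto intro!: borel_measurable_diff borel_measurable_enn2real nn(2) simp: real_lebesgue_integral_def)
  also have "\<dots> = enn2real (\<integral>\<^sup>+y. ennreal (f y) \<partial>N) - enn2real (\<integral>\<^sup>+y. ennreal (- f y) \<partial>N)"
    using pos[of f] pos[of "\<lambda>y. - f y"] by (subst Bochner_Integration.integral_diff) auto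
  also have "\<dots> = (\<integral>y. f y \<partial>N)"
    by (rule real_lebesgue_integral_def[OF f, symmetric])
  finally show "(\<integral>x. \<integral>y. f y \<partial>q x \<partial>M) = (\<integral>y. f y \<partial>N)" .
qed

text \<open>The excess of \<open>f\<close> over \<open>g\<close> has norm 0 in \<open>L1\<close>, so
  \<open>\<beta>\<close> does not see it. The almost everywhere form is required because the
  half-space bound holds only on the support.\<close>

lemma bilinear_couplings_mono_AE:
  assumes \<beta>: "\<beta> \<in> bilinear_couplings M N" and A: "A \<in> sets M" and f: "integrable N f" and g: "integrable N g"
    and le: "AE y in N. f y \<le> g y"
  shows "\<beta> (A, f) \<le> \<beta> (A, g)"
proof -
  define h where "h y = max 0 (f y - g y)" for y
  have h: "integrable N h" unfolding h_def using f g by (intro integrable_max) auto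
  have "(\<integral>y. \<bar>h y\<bar> \<partial>N) = 0"
    using le by (intro integral_eq_zero_AE) (auto simp: h_def elim!: eventually_mono)
  then have "\<beta> (A, h) = 0"
    using bilinear_couplings_bound[OF \<beta> A h] by simp
  moreover have "\<beta> (A, f) \<le> \<beta> (A, \<lambda>y. g y + h y)"
    by (rule bilinear_couplings_mono[OF \<beta> A f Bochner_Integration.integrable_add[OF g h]]) (simp add: h_def)
  ultimately show ?thesis
    using bilinear_couplings_add[OF \<beta> A g h] by simp
qed

text \<open>
  Both sides are linear in \<open>f\<close> and bounded in \<open>L\<^sup>1(N)\<close>, so it is enough to compare them on indicators.
\<close>

lemma bilinear_coupling_kernel:
  fixes k :: "'x \<Rightarrow> 'y measure"
  assumes \<beta>: "\<beta> \<in> bilinear_couplings M N" and fin: "finite_measure N"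
    and k: "\<And>x. x \<in> space M \<Longrightarrow> sets (k x) = sets N"
    and meas: "\<And>B. B \<in> sets N \<Longrightarrow> (\<lambda>x. emeasure (k x) B) \<in> borel_measurable M"
    and k_eq: "\<And>A B. A \<in> sets M \<Longrightarrow> B \<in> sets N \<Longrightarrow> (\<integral>\<^sup>+x\<in>A. emeasure (k x) B \<partial>M) = \<beta> (A, indicator B)"
    and A [measurable]: "A \<in> sets M" and f: "integrable N f"
  shows "\<beta> (A, f) = (\<integral>x. indicator A x * (\<integral>y. f y \<partial>k x) \<partial>M)"
proof -
  interpret finite_measure N by (rule fin)
  have total: "(\<integral>\<^sup>+x. emeasure (k x) B \<partial>M) = emeasure N B" if "B \<in> sets N" for B
  proof -
    have "(\<integral>\<^sup>+x. emeasure (k x) B \<partial>M) = (\<integral>\<^sup>+x\<in>space M. emeasure (k x) B \<partial>M)"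
      by (intro nn_integral_cong) simp
    also have "\<dots> = emeasure N B"
      using that sets.sets_into_space[OF that] bilinear_couplings_space[OF \<beta>, of "indicator B"]
      by (subst k_eq) (auto simp: emeasure_eq_measure Int_absorb2)
    finally show ?thesis .
  qed
  note K = k meas total
  have AE_k: "AE x in M. integrable (k x) f" if "integrable N f" for f :: "'y \<Rightarrow> real"
    by (rule AE_integrable_kernel[OF K that])
  define \<Delta> where "\<Delta> f = \<beta> (A, f) - (\<integral>x. indicator A x * (\<integral>y. f y \<partial>k x) \<partial>M)" for f :: "'y \<Rightarrow> real"
  have int_A: "integrable M (\<lambda>x. indicator A x * (\<integral>y. f y \<partial>k x))" if "integrable N f" for f :: "'y \<Rightarrow> real"
    using integrable_mult_indicator[OF A integrable_kernel_integral[OF K that]] unfolding real_scaleR_def .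
  have \<Delta>_bound: "\<bar>\<Delta> f\<bar> \<le> 2 * (\<integral>y. \<bar>f y\<bar> \<partial>N)" if f: "integrable N f" for f
  proof -
    have "\<bar>\<integral>x. indicator A x * (\<integral>y. f y \<partial>k x) \<partial>M\<bar> \<le> (\<integral>x. \<bar>\<integral>y. f y \<partial>k x\<bar> \<partial>M)"
    proof (rule order_trans[OF integral_abs_bound integral_mono])
      show "integrable M (\<lambda>x. \<bar>indicator A x * (\<integral>y. f y \<partial>k x)\<bar>)" by (rule integrable_abs[OF int_A[OF f]])
      show "integrable M (\<lambda>x. \<bar>\<integral>y. f y \<partial>k x\<bar>)" by (rule integrable_abs[OF integrable_kernel_integral[OF K f]])
    qed (simp add: indicator_def)
    also have "\<dots> \<le> (\<integral>y. \<bar>f y\<bar> \<partial>N)" by (rule integral_abs_kernel_integral_le[OF K f])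
    finally show ?thesis
      using bilinear_couplings_bound[OF \<beta> A f] unfolding \<Delta>_def by linarith
  qed
  have \<Delta>_add: "\<Delta> (\<lambda>y. f y + g y) = \<Delta> f + \<Delta> g" if f: "integrable N f" and g: "integrable N g" for f g
  proof -
    have "(\<integral>x. indicator A x * (\<integral>y. f y + g y \<partial>k x) \<partial>M) =
        (\<integral>x. indicator A x * (\<integral>y. f y \<partial>k x) + indicator A x * (\<integral>y. g y \<partial>k x) \<partial>M)"
    proof (rule integral_cong_AE)
      show "AE x in M. indicator A x * (\<integral>y. f y + g y \<partial>k x) =
          indicator A x * (\<integral>y. f y \<partial>k x) + indicator A x * (\<integral>y. g y \<partial>k x)"
        using AE_k[OF f] AE_k[OF g]
        by eventually_elim (simp add: distrib_left)
    qed (use int_A[OF f] int_A[OF g] int_A[of "\<lambda>y. f y + g y"] f g in auto)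
    then show ?thesis
      unfolding \<Delta>_def bilinear_couplings_add[OF \<beta> A f g] using int_A[OF f] int_A[OF g] by simp
  qed
  have \<Delta>_scale: "\<Delta> (\<lambda>y. c * f y) = c * \<Delta> f" if f: "integrable N f" for c f
    unfolding \<Delta>_def bilinear_couplings_scale[OF \<beta> A f]
    by (simp add: right_diff_distrib mult.left_commute)
  have "\<Delta> f = 0"
    using f
  proof (induction f rule: integrable_induct)
    case (base B c)
    have B: "integrable N (indicator B :: _ \<Rightarrow> real)" using base by auto
    have "(\<integral>x. indicator A x * (\<integral>y. indicator B y \<partial>k x) \<partial>M) = (\<integral>x. indicator A x * measure (k x) B \<partial>M)"
    proof (rule Bochner_Integration.integral_cong)
      fix x assume "x \<in> space M"
      then show "indicator A x * (\<integral>y. indicator B y \<partial>k x) = indicator A x * measure (k x) B"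
        using k[of x] base(1) sets.sets_into_space[of B N] sets_eq_imp_space_eq[OF k, of x]
        by (simp add: Int_absorb2)
    qed simp
    also have "\<dots> = enn2real (\<integral>\<^sup>+x. ennreal (indicator A x * measure (k x) B) \<partial>M)"
      using meas[OF base(1)] by (intro integral_eq_nn_integral) (auto simp: measure_def)
    also have "(\<integral>\<^sup>+x. ennreal (indicator A x * measure (k x) B) \<partial>M) = (\<integral>\<^sup>+x\<in>A. emeasure (k x) B \<partial>M)"
    proof (rule nn_integral_cong_AE)
      have "AE x in M. emeasure (k x) B \<noteq> \<infinity>"
        using meas[OF base(1)] total[OF base(1)] by (intro nn_integral_PInf_AE) (auto simp: emeasure_eq_measure)
      then show "AE x in M. ennreal (indicator A x * measure (k x) B) = emeasure (k x) B * indicator A x"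
        by eventually_elim (auto simp: measure_def indicator_def less_top)
    qed
    also have "enn2real \<dots> = \<beta> (A, indicator B)"
      using k_eq[OF A base(1)] bilinear_couplings_nonneg[OF \<beta> A B] by simp
    finally have "\<Delta> (indicator B) = 0" by (simp add: \<Delta>_def)
    then show ?case
      using \<Delta>_scale[OF B, of c] by (simp add: mult.commute)
  next
    case (add f g)
    then show ?case using \<Delta>_add by simp
  next
    case (lim f s)
    have s: "integrable N (s i)" and \<Delta>s: "\<Delta> (s i) = 0" for i using lim by auto
    have *: "\<bar>\<Delta> f\<bar> \<le> 2 * (\<integral>y. \<bar>f y - s i y\<bar> \<partial>N)" for i
    proof -
      have "\<Delta> f = \<Delta> (\<lambda>y. s i y + (f y - s i y))" by simp
      also have "\<dots> = \<Delta> (\<lambda>y. f y - s i y)"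
        using s[of i] lim.hyps \<Delta>s[of i] by (subst \<Delta>_add) auto
      finally show ?thesis using \<Delta>_bound[of "\<lambda>y. f y - s i y"] s[of i] lim.hyps by simp
    qed
    \<comment> \<open>The approximating simple functions are bounded by
      \<open>2 * norm (f y)\<close>, whence the factor 3 in the dominating function.\<close>
    have "(\<lambda>i. \<integral>y. \<bar>f y - s i y\<bar> \<partial>N) \<longlonglongrightarrow> (\<integral>y. 0 \<partial>N)"
    proof (rule integral_dominated_convergence[where w="\<lambda>y. 3 * norm (f y)"])
      show "AE y in N. (\<lambda>i. \<bar>f y - s i y\<bar>) \<longlonglongrightarrow> 0"
        using lim by (intro AE_I2 tendsto_rabs_zero) (auto intro!: tendsto_eq_intros)
      have "norm \<bar>f y - s i y\<bar> \<le> 3 * norm (f y)" if "y \<in> space N" for y i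
        using lim(3)[OF that, of i] by simp
      then show "AE y in N. norm \<bar>f y - s i y\<bar> \<le> 3 * norm (f y)" for i by auto
    qed (use lim s in auto)
    then have "(\<lambda>i. 2 * (\<integral>y. \<bar>f y - s i y\<bar> \<partial>N)) \<longlonglongrightarrow> 2 * 0"
      by (intro tendsto_mult tendsto_const) simp
    then have "\<bar>\<Delta> f\<bar> \<le> 2 * 0"
      by (rule LIMSEQ_le_const) (use * in blast)
    then show ?case by simp
  qed
  then show ?thesis by (simp add: \<Delta>_def)
qed

text \<open>Dominated convergence. It gives the continuity at the empty set of the barycenter over
  \<open>A\<close>, from which that of the mass over \<open>A\<close> will be derived.\<close>

lemma indicator_decseq_integral_tendsto_0:
  fixes h :: "'a \<Rightarrow> real"
  assumes h: "integrable P h" and p [measurable]: "p \<in> P \<rightarrow>\<^sub>M M"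
    and A: "range A \<subseteq> sets M" "decseq A" "(\<Inter>i. A i) = {}"
  shows "(\<lambda>i. \<integral>\<omega>. indicator (A i) (p \<omega>) * h \<omega> \<partial>P) \<longlonglongrightarrow> 0"
proof -
  have [measurable]: "A i \<in> sets M" for i using A(1) by auto
  have [measurable]: "h \<in> borel_measurable P" using h by auto
  have "(\<lambda>i. \<integral>\<omega>. indicator (A i) (p \<omega>) * h \<omega> \<partial>P) \<longlonglongrightarrow> (\<integral>\<omega>. 0 \<partial>P)"
  proof (rule integral_dominated_convergence[where w="\<lambda>\<omega>. \<bar>h \<omega>\<bar>"])
    have "(\<lambda>i. indicator (A i) (p \<omega>) * h \<omega>) \<longlonglongrightarrow> 0" for \<omega>
    proof -
      obtain n where n: "p \<omega> \<notin> A n" using A(3) by auto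
      have "indicator (A i) (p \<omega>) * h \<omega> = 0" if "n \<le> i" for i
        using n decseqD[OF A(2) that] by (auto simp: indicator_def)
      then show ?thesis
        by (intro tendsto_eventually) (auto simp: eventually_sequentially)
    qed
    then show "AE \<omega> in P. (\<lambda>i. indicator (A i) (p \<omega>) * h \<omega>) \<longlonglongrightarrow> 0" by simp
  qed (use h in \<open>auto simp: indicator_def\<close>)
  then show ?thesis by simp
qed

text \<open>
  The lower bound \<open>b \<le> y \<bullet> w\<close> controls the mass \<open>\<beta> (A, 1)\<close> by the barycenter over \<open>A\<close>. This is what makes
  \<open>\<beta>\<close> countably additive and absolutely continuous in \<open>A\<close>; otherwise the mass could escape to a null set.
\<close>

lemma barycentric_kernel:
  fixes M :: "'x measure" and \<nu> :: "'e::euclidean_space measure" and P :: "'p measure" and g :: "'p \<Rightarrow> 'e"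
  assumes M: "prob_space M" and p [measurable]: "p \<in> P \<rightarrow>\<^sub>M M" and distr: "distr P M p = M"
    and g: "integrable P g"
    and Y: "closed Y" "Y \<noteq> {}" and fin: "finite_measure \<nu>"
    and sets_\<nu>: "sets \<nu> = sets (restrict_space borel Y)" and int_\<nu>: "integrable \<nu> (\<lambda>y. y)"
    and order: "\<And>\<phi>. convex_on UNIV \<phi> \<Longrightarrow> (\<And>t x. 0 \<le> t \<Longrightarrow> \<phi> (t *\<^sub>R x) = t * \<phi> x) \<Longrightarrow>
      (\<integral>\<omega>. \<phi> (g \<omega>) \<partial>P) \<le> (\<integral>y. \<phi> y \<partial>\<nu>)"
    and b: "0 < b" "AE y in \<nu>. b \<le> y \<bullet> w"
  obtains q where "\<And>x. sets (q x) = sets \<nu>" "\<And>x. finite_measure (q x)"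
    "\<And>B. B \<in> sets \<nu> \<Longrightarrow> (\<lambda>x. emeasure (q x) B) \<in> borel_measurable M"
    "\<And>B. B \<in> sets \<nu> \<Longrightarrow> (\<integral>\<^sup>+x. emeasure (q x) B \<partial>M) = emeasure \<nu> B"
    "\<And>A v. A \<in> sets M \<Longrightarrow>
      (\<integral>x. indicator A x * (\<integral>y. y \<bullet> v \<partial>q x) \<partial>M) = (\<integral>\<omega>. indicator A (p \<omega>) * (g \<omega> \<bullet> v) \<partial>P)"
proof -
  interpret M: prob_space M by (rule M)
  interpret \<nu>: finite_measure \<nu> by (rule fin)
  note [measurable_cong] = sets_\<nu>
  have space_\<nu>: "space \<nu> = Y" using sets_eq_imp_space_eq[OF sets_\<nu>] by (simp add: space_restrict_space)
  obtain y0 where y0: "y0 \<in> Y" using Y by auto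
  have [measurable]: "Y \<in> sets borel" using Y by auto
  obtain e :: "'e \<Rightarrow> real" and dec :: "real \<Rightarrow> 'e"
    where e_meas: "e \<in> borel_measurable borel" and dec_meas [measurable]: "dec \<in> borel_measurable borel"
      and dec_e: "\<And>y. dec (e y) = y" and e01: "\<And>y. 0 \<le> e y" "\<And>y. e y < 1"
    by (rule borel_code_in_real) blast
  have [measurable]: "e \<in> borel_measurable \<nu>"
    using measurable_restrict_space1[OF e_meas] by (simp cong: measurable_cong_sets)
  \<comment> \<open>The decoder, forced into \<open>Y\<close> by the default \<open>y0\<close>, so
    that it is a measurable map into \<open>\<nu>\<close> on the whole line.\<close>
  define \<eta> where "\<eta> r = (if dec r \<in> Y then dec r else y0)" for r
  have \<eta>_meas [measurable]: "\<eta> \<in> borel_measurable borel" unfolding \<eta>_def by measurable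
  have \<eta>_meas' [measurable]: "\<eta> \<in> borel \<rightarrow>\<^sub>M \<nu>"
    unfolding measurable_cong_sets[OF refl sets_\<nu>]
    by (rule measurable_restrict_space2) (auto simp: \<eta>_def y0)
  have \<eta>_e: "\<eta> (e y) = y" if "y \<in> Y" for y using that by (simp add: \<eta>_def dec_e)
  \<comment> \<open>From here on the target is the image of \<open>\<nu>\<close> under the code,
    with barycenters taken of \<open>\<eta>\<close>; decoding recovers \<open>\<nu>\<close>.\<close>
  define N where "N = distr \<nu> borel e"
  have sets_N [simp, measurable_cong]: "sets N = sets borel" and space_N [simp]: "space N = UNIV"
    by (auto simp: N_def)
  interpret N: finite_measure N unfolding N_def by (rule \<nu>.finite_measure_distr) simp
  have distr_\<eta>: "distr N \<nu> \<eta> = \<nu>"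
  proof -
    have "distr N \<nu> \<eta> = distr \<nu> \<nu> (\<lambda>y. \<eta> (e y))"
      unfolding N_def by (subst distr_distr) (auto simp: comp_def)
    also have "\<dots> = distr \<nu> \<nu> (\<lambda>y. y)"
      by (intro distr_cong) (auto simp: \<eta>_e space_\<nu>)
    finally show ?thesis by (simp add: distr_id2)
  qed
  have int_\<eta>: "integrable N \<eta>"
  proof -
    have "integrable (distr N \<nu> \<eta>) (\<lambda>y. y)" unfolding distr_\<eta> by (rule int_\<nu>)
    then show ?thesis
      using int_\<nu> by (subst (asm) integrable_distr_eq) (auto intro: borel_measurable_integrable)
  qed
  have order_N: "(\<integral>\<omega>. \<phi> (g \<omega>) \<partial>P) \<le> (\<integral>r. \<phi> (\<eta> r) \<partial>N)"
    if \<phi>: "convex_on UNIV \<phi>" "\<And>t x. 0 \<le> t \<Longrightarrow> \<phi> (t *\<^sub>R x) = t * \<phi> x" for \<phi>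
  proof -
    have "continuous_on UNIV \<phi>" by (rule convex_on_continuous[OF open_UNIV \<phi>(1)])
    then have "\<phi> \<in> borel_measurable borel" by (rule borel_measurable_continuous_onI)
    from measurable_restrict_space1[OF this] have "\<phi> \<in> borel_measurable \<nu>" by (simp cong: measurable_cong_sets)
    then have "(\<integral>y. \<phi> y \<partial>distr N \<nu> \<eta>) = (\<integral>r. \<phi> (\<eta> r) \<partial>N)"
      by (intro integral_distr) auto
    then show ?thesis using order[OF \<phi>] by (simp add: distr_\<eta>)
  qed
  obtain \<beta> where \<beta>: "\<beta> \<in> bilinear_couplings M N"
    and \<beta>_bary: "\<And>A v. A \<in> sets M \<Longrightarrow> \<beta> (A, \<lambda>r. \<eta> r \<bullet> v) = (\<integral>\<omega>. indicator A (p \<omega>) * (g \<omega> \<bullet> v) \<partial>P)"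
    by (rule barycentric_coupling[OF M p distr g int_\<eta> order_N]) blast+

  define m where "m A B = \<beta> (A, indicator B)" for A B
  have int_ind: "integrable N (indicator B :: real \<Rightarrow> real)" if "B \<in> sets borel" for B
    using that by (simp add: integrable_indicator_iff N.emeasure_eq_measure)
  have m_space: "m (space M) B = measure N B" if "B \<in> sets borel" for B
    unfolding m_def bilinear_couplings_space[OF \<beta> int_ind[OF that]] using that by simp
  have b_N: "AE r in N. b \<le> \<eta> r \<bullet> w"
  proof -
    have "AE y in distr N \<nu> \<eta>. b \<le> y \<bullet> w" unfolding distr_\<eta> by (rule b(2))
    then show ?thesis by (rule AE_distrD[rotated]) simp
  qed
  have m_le: "b * m A UNIV \<le> (\<integral>\<omega>. indicator A (p \<omega>) * (g \<omega> \<bullet> w) \<partial>P)" if A: "A \<in> sets M" for A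
  proof -
    have "b * m A UNIV = \<beta> (A, \<lambda>r. b * indicator UNIV r)"
      unfolding m_def using A int_ind[of UNIV] by (subst bilinear_couplings_scale[OF \<beta>]) auto
    also have "\<dots> \<le> \<beta> (A, \<lambda>r. \<eta> r \<bullet> w)"
      using b_N int_\<eta> by (intro bilinear_couplings_mono_AE[OF \<beta> A]) auto
    finally show ?thesis unfolding \<beta>_bary[OF A] .
  qed
  have m_nonneg: "0 \<le> m A B" if "A \<in> sets M" "B \<in> sets borel" for A B
    unfolding m_def using that int_ind by (intro bilinear_couplings_nonneg[OF \<beta>]) auto
  obtain M' \<kappa> where sets_M' [measurable_cong]: "sets M' = sets M" and finM': "finite_measure M'"
    and M'_eq: "\<And>A. A \<in> sets M \<Longrightarrow> emeasure M' A = m A UNIV"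
    and \<kappa>: "\<kappa> \<in> M \<rightarrow>\<^sub>M prob_algebra borel"
    and \<kappa>_eq: "\<And>A B. A \<in> sets M \<Longrightarrow> B \<in> sets borel \<Longrightarrow> (\<integral>\<^sup>+x\<in>A. emeasure (\<kappa> x) B \<partial>M') = m A B"
  proof (rule disintegration_unit_interval[of M m])
    show "space M \<noteq> {}" by (rule M.not_empty)
    show "0 \<le> m A B" if "A \<in> sets M" "B \<in> sets borel" for A B by (rule m_nonneg[OF that])
    show "m (A \<union> A') B = m A B + m A' B"
      if "A \<in> sets M" "A' \<in> sets M" "A \<inter> A' = {}" "B \<in> sets borel" for A A' B
      unfolding m_def by (rule bilinear_couplings_Un[OF \<beta> that(1-3) int_ind[OF that(4)]])
    show "m A (B \<union> B') = m A B + m A B'"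
      if "A \<in> sets M" "B \<in> sets borel" "B' \<in> sets borel" "B \<inter> B' = {}" for A B B'
    proof -
      have "(indicator (B \<union> B') :: real \<Rightarrow> real) = (\<lambda>r. indicator B r + indicator B' r)"
        using that(4) by (auto simp: fun_eq_iff indicator_def)
      then show ?thesis
        unfolding m_def using bilinear_couplings_add[OF \<beta> that(1) int_ind[OF that(2)] int_ind[OF that(3)]] by simp
    qed
    show "(\<lambda>i. m (A i) UNIV) \<longlonglongrightarrow> 0" if A: "range A \<subseteq> sets M" "decseq A" "(\<Inter>i. A i) = {}" for A
    proof (rule real_tendsto_sandwich[OF _ _ tendsto_const])
      have "(\<lambda>i. 1 / b * (\<integral>\<omega>. indicator (A i) (p \<omega>) * (g \<omega> \<bullet> w) \<partial>P)) \<longlonglongrightarrow> 1 / b * 0"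
        using g by (intro tendsto_mult tendsto_const indicator_decseq_integral_tendsto_0[OF _ p A]) auto
      then show "(\<lambda>i. 1 / b * (\<integral>\<omega>. indicator (A i) (p \<omega>) * (g \<omega> \<bullet> w) \<partial>P)) \<longlonglongrightarrow> 0" by simp
      show "\<forall>\<^sub>F i in sequentially. 0 \<le> m (A i) UNIV"
        using A m_nonneg by (intro always_eventually) auto
      have "m (A i) UNIV \<le> 1 / b * (\<integral>\<omega>. indicator (A i) (p \<omega>) * (g \<omega> \<bullet> w) \<partial>P)" for i
        using m_le[of "A i"] A(1) b(1) by (auto simp: field_simps)
      then show "\<forall>\<^sub>F i in sequentially. m (A i) UNIV \<le> 1 / b * (\<integral>\<omega>. indicator (A i) (p \<omega>) * (g \<omega> \<bullet> w) \<partial>P)"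
        by simp
    qed
    show "(\<lambda>i. m (space M) (B i)) \<longlonglongrightarrow> 0" if B: "range B \<subseteq> sets borel" "decseq B" "(\<Inter>i. B i) = {}" for B
    proof -
      have "(\<lambda>i. measure N (B i)) \<longlonglongrightarrow> measure N (\<Inter>i. B i)"
        using B by (intro N.finite_Lim_measure_decseq) auto
      then show ?thesis using B m_space by (simp add: range_subsetD)
    qed
    show "m (space M) {..<0} = 0" "m (space M) {1<..} = 0"
      using e01 by (auto simp: m_space N_def measure_distr vimage_def not_less less_imp_le not_le[symmetric] simp del: not_le)
  qed (rule that)
  interpret M': finite_measure M' by (rule finM')
  have space_M' [simp]: "space M' = space M" by (rule sets_eq_imp_space_eq[OF sets_M'])

  \<comment> \<open>Over an \<open>M\<close>-null set \<open>A\<close> the barycenter vanishes,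
    because \<open>p \<omega>\<close> avoids \<open>A\<close> almost everywhere; \<open>m_le\<close>
    then leaves no mass over \<open>A\<close>.\<close>
  have ac: "absolutely_continuous M M'"
    unfolding absolutely_continuous_def
  proof
    fix A assume A: "A \<in> null_sets M"
    then have [measurable]: "A \<in> sets M" by auto
    have "AE x in distr P M p. x \<notin> A" unfolding distr using A by (rule AE_not_in)
    then have "AE \<omega> in P. p \<omega> \<notin> A" by (rule AE_distrD[OF p])
    then have "(\<integral>\<omega>. indicator A (p \<omega>) * (g \<omega> \<bullet> w) \<partial>P) = 0"
      by (intro integral_eq_zero_AE) (auto elim!: eventually_mono)
    then have "m A UNIV = 0"
      using m_le[of A] m_nonneg[of A UNIV] b(1) by (auto simp: mult_le_0_iff)
    then show "A \<in> null_sets M'" using M'_eq[of A] sets_M' by (auto simp: null_sets_def)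
  qed
  \<comment> \<open>The detour through \<open>enn2real\<close> makes the density finite at every
    \<open>x\<close> and not just almost everywhere, so that each \<open>k x\<close> is a finite
    measure.\<close>
  define \<delta> where "\<delta> x = ennreal (enn2real (RN_deriv M M' x))" for x
  have \<delta>_meas [measurable]: "\<delta> \<in> borel_measurable M" unfolding \<delta>_def by measurable
  have dens: "density M \<delta> = M'"
  proof -
    have "AE x in M. RN_deriv M M' x \<noteq> \<infinity>"
      by (rule M.RN_deriv_finite[OF M'.sigma_finite_measure_axioms ac sets_M'])
    then have "AE x in M. \<delta> x = RN_deriv M M' x"
      by eventually_elim (simp add: \<delta>_def less_top)
    then have "density M \<delta> = density M (RN_deriv M M')"
      by (intro density_cong) auto
    then show ?thesis by (simp add: M.density_RN_deriv[OF ac sets_M'])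
  qed
  \<comment> \<open>\<open>\<kappa>\<close> consists of probability measures and disintegrates with
    respect to \<open>M'\<close>. The factor \<open>\<delta> x\<close> passes to \<open>M\<close>
    and is the mass of the kernel at \<open>x\<close>.\<close>
  define k where "k x = scale_measure (\<delta> x) (\<kappa> x)" for x
  have \<kappa>_prob: "prob_space (\<kappa> x)" "sets (\<kappa> x) = sets borel" if "x \<in> space M" for x
    using measurable_space[OF \<kappa> that] by (auto simp: space_prob_algebra)
  have \<kappa>_em [measurable]: "(\<lambda>x. emeasure (\<kappa> x) B) \<in> borel_measurable M" if "B \<in> sets borel" for B
    using measurable_emeasure_kernel[OF measurable_prob_algebraD[OF \<kappa>] that] .
  have sets_k: "sets (k x) = sets N" if "x \<in> space M" for x
    using \<kappa>_prob[OF that] by (simp add: k_def)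
  have k_meas: "(\<lambda>x. emeasure (k x) B) \<in> borel_measurable M" if "B \<in> sets N" for B
    using that unfolding k_def by (simp add: emeasure_scale_measure)
  have k_eq: "(\<integral>\<^sup>+x\<in>A. emeasure (k x) B \<partial>M) = \<beta> (A, indicator B)" if [measurable]: "A \<in> sets M" "B \<in> sets N" for A B
  proof -
    have "(\<integral>\<^sup>+x\<in>A. emeasure (k x) B \<partial>M) = (\<integral>\<^sup>+x. \<delta> x * (emeasure (\<kappa> x) B * indicator A x) \<partial>M)"
      by (simp add: k_def emeasure_scale_measure mult.assoc)
    also have "\<dots> = (\<integral>\<^sup>+x\<in>A. emeasure (\<kappa> x) B \<partial>density M \<delta>)"
      using that by (intro nn_integral_density[symmetric]) auto
    also have "\<dots> = m A B" unfolding dens using that by (intro \<kappa>_eq) auto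
    finally show ?thesis by (simp add: m_def)
  qed
  \<comment> \<open>The null measure off \<open>space M\<close> keeps the \<sigma>-algebra and the
    finiteness correct for all \<open>x\<close>.\<close>
  define q where "q x = (if x \<in> space M then distr (k x) \<nu> \<eta> else null_measure \<nu>)" for x
  have \<eta>_k: "\<eta> \<in> k x \<rightarrow>\<^sub>M \<nu>" if "x \<in> space M" for x
    using \<eta>_meas' sets_k[OF that] by (simp cong: measurable_cong_sets)
  have q_em: "emeasure (q x) B = emeasure (k x) (\<eta> -` B)" if "x \<in> space M" "B \<in> sets \<nu>" for x B
    using that \<eta>_k[OF that(1)] sets_eq_imp_space_eq[OF sets_k[OF that(1)]] by (simp add: q_def emeasure_distr)
  have vim: "\<eta> -` B \<in> sets N" if "B \<in> sets \<nu>" for B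
    using measurable_sets[OF \<eta>_meas' that] by simp
  show thesis
  proof (rule that[of q])
    show "sets (q x) = sets \<nu>" for x by (simp add: q_def)
    show "finite_measure (q x)" for x
    proof (cases "x \<in> space M")
      case True
      interpret prob_space "\<kappa> x" using \<kappa>_prob[OF True] by simp
      have "emeasure (k x) (space (k x)) \<noteq> \<infinity>"
        using emeasure_space_1 by (simp add: k_def space_scale_measure emeasure_scale_measure \<delta>_def)
      then have "finite_measure (k x)" by (rule finite_measureI)
      then show ?thesis
        using True \<eta>_k[OF True] by (simp add: q_def finite_measure.finite_measure_distr)
    next
      case False
      then show ?thesis by (auto simp: q_def intro!: finite_measureI)
    qed
    show q_meas: "(\<lambda>x. emeasure (q x) B) \<in> borel_measurable M" if "B \<in> sets \<nu>" for B
      using k_meas[OF vim[OF that]] by (simp add: q_em that cong: measurable_cong)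
    show "(\<integral>\<^sup>+x. emeasure (q x) B \<partial>M) = emeasure \<nu> B" if B: "B \<in> sets \<nu>" for B
    proof -
      have "(\<integral>\<^sup>+x. emeasure (q x) B \<partial>M) = (\<integral>\<^sup>+x\<in>space M. emeasure (k x) (\<eta> -` B) \<partial>M)"
        by (intro nn_integral_cong) (simp add: q_em B)
      also have "\<dots> = m (space M) (\<eta> -` B)"
        unfolding m_def by (rule k_eq[OF sets.top vim[OF B]])
      also have "\<dots> = emeasure N (\<eta> -` B)"
        using vim[OF B] by (simp add: m_space N.emeasure_eq_measure)
      also have "\<dots> = emeasure (distr N \<nu> \<eta>) B"
        using B by (simp add: emeasure_distr)
      finally show ?thesis by (simp add: distr_\<eta>)
    qed
    show "(\<integral>x. indicator A x * (\<integral>y. y \<bullet> v \<partial>q x) \<partial>M) = (\<integral>\<omega>. indicator A (p \<omega>) * (g \<omega> \<bullet> v) \<partial>P)"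
      if A: "A \<in> sets M" for A v
    proof -
      have [measurable]: "(\<lambda>y. y \<bullet> v) \<in> borel_measurable \<nu>"
        by (rule borel_measurable_integrable) (rule integrable_inner_left[OF int_\<nu>])
      have "(\<integral>x. indicator A x * (\<integral>y. y \<bullet> v \<partial>q x) \<partial>M) = (\<integral>x. indicator A x * (\<integral>r. \<eta> r \<bullet> v \<partial>k x) \<partial>M)"
      proof (rule Bochner_Integration.integral_cong)
        fix x assume "x \<in> space M"
        then show "indicator A x * (\<integral>y. y \<bullet> v \<partial>q x) = indicator A x * (\<integral>r. \<eta> r \<bullet> v \<partial>k x)"
          using \<eta>_k[of x] by (simp add: q_def integral_distr)
      qed simp
      also have "\<dots> = \<beta> (A, \<lambda>r. \<eta> r \<bullet> v)"
        using int_\<eta> by (intro bilinear_coupling_kernel[OF \<beta> N.finite_measure_axioms sets_k k_meas k_eq A, symmetric]) auto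
      finally show ?thesis unfolding \<beta>_bary[OF A] .
    qed
  qed
qed

section \<open>Barycenters and sublinear functions\<close>

text \<open>A hyperplane strictly separating the mean from \<open>C\<close> would contradict the
  integrated inequality.\<close>

lemma (in prob_space) integral_in_closed_convex:
  fixes f :: "'a \<Rightarrow> 'b::euclidean_space"
  assumes C: "closed C" "convex C" and f: "integrable M f" and in_C: "AE x in M. f x \<in> C"
  shows "(\<integral>x. f x \<partial>M) \<in> C"
proof (rule ccontr)
  assume "(\<integral>x. f x \<partial>M) \<notin> C"
  then obtain a b where ab: "a \<bullet> (\<integral>x. f x \<partial>M) < b" "\<forall>x\<in>C. b < a \<bullet> x"
    using separating_hyperplane_closed_point[OF C(2,1)] by blast
  have "(\<integral>x. b \<partial>M) \<le> (\<integral>x. a \<bullet> f x \<partial>M)"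
    using f in_C ab(2) by (intro integral_mono_AE) (auto elim!: eventually_mono intro: less_imp_le)
  also have "\<dots> = a \<bullet> (\<integral>x. f x \<partial>M)" using f by simp
  finally show False using ab(1) by (simp add: prob_space)
qed

text \<open>Continuity bounds \<open>\<phi>\<close> on the compact unit sphere, and homogeneity
  extends the bound. It makes the test functions integrable under finite first moments.\<close>

lemma sublinear_bound:
  fixes \<phi> :: "'e::euclidean_space \<Rightarrow> real"
  assumes \<phi>: "convex_on UNIV \<phi>" "\<And>t x. 0 \<le> t \<Longrightarrow> \<phi> (t *\<^sub>R x) = t * \<phi> x"
  obtains K where "\<And>x. \<bar>\<phi> x\<bar> \<le> K * norm x"
proof -
  have "continuous_on UNIV \<phi>" by (rule convex_on_continuous[OF open_UNIV \<phi>(1)])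
  then have "compact (\<phi> ` sphere 0 1)"
    by (intro compact_continuous_image compact_sphere) (rule continuous_on_subset, auto)
  then obtain K where "\<forall>r\<in>\<phi> ` sphere 0 1. norm r \<le> K"
    using compact_imp_bounded bounded_iff by metis
  then have K: "\<bar>\<phi> x\<bar> \<le> K" if "norm x = 1" for x
    using that by simp
  have "\<bar>\<phi> x\<bar> \<le> K * norm x" for x
  proof (cases "x = 0")
    case True
    then show ?thesis using \<phi>(2)[of 0 x] by simp
  next
    case False
    have "\<phi> x = \<phi> (norm x *\<^sub>R (x /\<^sub>R norm x))" using False by simp
    also have "\<dots> = norm x * \<phi> (x /\<^sub>R norm x)" by (rule \<phi>(2)) simp
    finally show ?thesis
      using K[of "x /\<^sub>R norm x"] False by (simp add: abs_mult mult.commute)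
  qed
  then show thesis by (rule that)
qed

lemma finite_measure_normalize:
  fixes f :: "'a \<Rightarrow> 'b::{banach, second_countable_topology}"
  assumes "finite_measure M" and nz: "measure M (space M) \<noteq> 0"
  defines "D \<equiv> density M (\<lambda>_. ennreal (1 / measure M (space M)))"
  shows "prob_space D" and "integrable M f \<Longrightarrow> integrable D f"
    and "integrable M f \<Longrightarrow> (\<integral>x. f x \<partial>D) = (1 / measure M (space M)) *\<^sub>R (\<integral>x. f x \<partial>M)"
proof -
  interpret finite_measure M by fact
  show "prob_space D"
  proof
    have "0 < measure M (space M)" using nz by (simp add: zero_less_measure_iff)
    then show "emeasure D (space D) = 1"
      by (simp add: D_def emeasure_density nn_integral_cmult emeasure_eq_measure ennreal_mult[symmetric])
  qed
  show "integrable M f \<Longrightarrow> integrable D f"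
    unfolding D_def by (subst integrable_density) auto
  show "integrable M f \<Longrightarrow> (\<integral>x. f x \<partial>D) = (1 / measure M (space M)) *\<^sub>R (\<integral>x. f x \<partial>M)"
    unfolding D_def by (subst integral_density) auto
qed

text \<open>For the normalized measure the mean of \<open>(y, \<phi> y)\<close> lies in the
  epigraph, which is closed and convex. Homogeneity then cancels the normalization, so any finite
  mass is allowed; for mass zero both sides are 0.\<close>

lemma sublinear_jensen:
  fixes \<phi> :: "'e::euclidean_space \<Rightarrow> real"
  assumes fin: "finite_measure m" and int: "integrable m (\<lambda>y. y)" and int_\<phi>: "integrable m \<phi>"
    and \<phi>: "convex_on UNIV \<phi>" "\<And>t x. 0 \<le> t \<Longrightarrow> \<phi> (t *\<^sub>R x) = t * \<phi> x"
  shows "\<phi> (\<integral>y. y \<partial>m) \<le> (\<integral>y. \<phi> y \<partial>m)"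
proof (cases "measure m (space m) = 0")
  case True
  interpret finite_measure m by (rule fin)
  have "space m \<in> null_sets m" using True by (simp add: null_sets_def emeasure_eq_measure)
  then have "AE y in m. False" by (simp add: AE_iff_null)
  then have "(\<integral>y. y \<partial>m) = 0" "(\<integral>y. \<phi> y \<partial>m) = 0"
    by (auto intro!: integral_eq_zero_AE elim!: eventually_mono)
  then show ?thesis using \<phi>(2)[of 0 0] by simp
next
  case False
  define r where "r = 1 / measure m (space m)"
  have r: "0 < r" using False by (simp add: r_def less_le)
  define D where "D = density m (\<lambda>_. ennreal r)"
  note norm = finite_measure_normalize[OF fin False, folded r_def, folded D_def]
  interpret D: prob_space D by (rule norm(1))
  have cont: "continuous_on UNIV \<phi>" by (rule convex_on_continuous[OF open_UNIV \<phi>(1)])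
  define E where "E = {p :: 'e \<times> real. \<phi> (fst p) \<le> snd p}"
  have "closed E"
    unfolding E_def
    by (intro closed_Collect_le continuous_on_compose2[OF cont] continuous_intros) auto
  moreover have "convex E"
  proof -
    have "E = epigraph UNIV \<phi>" by (auto simp: E_def epigraph_def)
    then show ?thesis using \<phi>(1) by (simp add: convex_epigraph)
  qed
  moreover have int_D: "integrable D (\<lambda>y. y)" "integrable D \<phi>"
    by (rule norm(2)[OF int] norm(2)[OF int_\<phi>])+
  have int_p: "integrable D (\<lambda>y. (y, \<phi> y))"
  proof -
    have "integrable D (\<lambda>y. (y, 0::real) + (0::'e, \<phi> y))"
      by (intro Bochner_Integration.integrable_add
          integrable_bounded_linear[OF bounded_linear_Pair[OF bounded_linear_ident bounded_linear_zero]]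
          integrable_bounded_linear[OF bounded_linear_Pair[OF bounded_linear_zero bounded_linear_ident]] int_D)
    then show ?thesis by simp
  qed
  ultimately have "(\<integral>y. (y, \<phi> y) \<partial>D) \<in> E"
    by (intro D.integral_in_closed_convex) (auto simp: E_def)
  then have "\<phi> (\<integral>y. y \<partial>D) \<le> (\<integral>y. \<phi> y \<partial>D)"
    using integral_bounded_linear[OF bounded_linear_fst int_p] integral_bounded_linear[OF bounded_linear_snd int_p]
    by (simp add: E_def)
  then have "\<phi> (r *\<^sub>R (\<integral>y. y \<partial>m)) \<le> r * (\<integral>y. \<phi> y \<partial>m)"
    using norm(3)[OF int] norm(3)[OF int_\<phi>] by simp
  then show ?thesis using r by (simp add: \<phi>(2))
qed

section \<open>Conical hulls, barycenters and the support\<close>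

lemma convex_hull_subset_conical_hull: "convex hull Y \<subseteq> conical_hull Y"
proof
  fix z assume "z \<in> convex hull Y"
  then obtain k :: nat and u y where u: "\<forall>i\<in>{1..k}. 0 \<le> u i \<and> y i \<in> Y" "sum u {1..k} = 1"
    and z: "(\<Sum>i\<in>{1..k}. u i *\<^sub>R y i) = z"
    unfolding convex_hull_indexed by blast
  have "k \<ge> 1" using u(2) by (cases "k = 0") auto
  moreover have "z = (\<Sum>i<k. u (Suc i) *\<^sub>R y (Suc i))"
    unfolding z[symmetric] by (rule sum.reindex_bij_witness[of _ Suc "\<lambda>i. i - 1"]) auto
  moreover have "\<forall>i<k. 0 \<le> u (Suc i) \<and> y (Suc i) \<in> Y" using u(1) by auto
  ultimately show "z \<in> conical_hull Y"
    unfolding conical_hull_def by (intro CollectI exI[of _ k] exI[of _ "\<lambda>i. u (Suc i)"] exI[of _ "\<lambda>i. y (Suc i)"]) auto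
qed

lemma conical_hull_scaleR:
  assumes "0 \<le> t" "z \<in> conical_hull Y"
  shows "t *\<^sub>R z \<in> conical_hull Y"
proof -
  obtain n :: nat and l y where n: "n \<ge> 1" "\<forall>i<n. 0 \<le> l i \<and> y i \<in> Y" "z = (\<Sum>i<n. l i *\<^sub>R y i)"
    using assms(2) unfolding conical_hull_def by auto
  then show ?thesis
    unfolding conical_hull_def using assms(1)
    by (intro CollectI exI[of _ n] exI[of _ "\<lambda>i. t * l i"] exI[of _ y]) (auto simp: scaleR_sum_right)
qed

lemma integrable_id_compact:
  fixes Y :: "'e::euclidean_space set"
  assumes "compact Y" and m: "m \<in> borel_finite_measures Y"
  shows "integrable m (\<lambda>y. y)"
proof -
  have fin: "finite_measure m" and sets_m: "sets m = sets (restrict_space borel Y)"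
    using m by (auto simp: borel_finite_measures_def)
  have sp: "space m = Y" using sets_eq_imp_space_eq[OF sets_m] by (simp add: space_restrict_space)
  obtain B where "\<And>y. y \<in> Y \<Longrightarrow> norm y \<le> B"
    using compact_imp_bounded[OF assms(1)] by (auto simp: bounded_iff)
  then show ?thesis
    using sp by (intro finite_measure.integrable_const_bound[OF fin, of _ B] AE_I2)
      (auto simp: measurable_cong_sets[OF sets_m refl] intro!: measurable_restrict_space1)
qed

text \<open>The conical hull of a compact set need not be closed, so the normalized barycenter is
  first placed in the compact convex hull and then scaled by the mass. Mass zero gives
  \<open>0 *\<^sub>R y0\<close>.\<close>

lemma barycenter_in_conical_hull:
  fixes Y :: "'e::euclidean_space set"
  assumes Y: "compact Y" "Y \<noteq> {}" and m: "m \<in> borel_finite_measures Y"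
  shows "(\<integral>y. y \<partial>m) \<in> conical_hull Y"
proof -
  have fin: "finite_measure m" and sets_m: "sets m = sets (restrict_space borel Y)"
    using m by (auto simp: borel_finite_measures_def)
  have sp: "space m = Y" using sets_eq_imp_space_eq[OF sets_m] by (simp add: space_restrict_space)
  note int = integrable_id_compact[OF Y(1) m]
  interpret finite_measure m by (rule fin)
  obtain y0 where y0: "y0 \<in> convex hull Y" using Y(2) hull_subset[of Y convex] by blast
  show ?thesis
  proof (cases "measure m (space m) = 0")
    case True
    have "space m \<in> null_sets m" using True by (simp add: null_sets_def emeasure_eq_measure)
    then have "AE y in m. False" by (simp add: AE_iff_null)
    then have "(\<integral>y. y \<partial>m) = 0 *\<^sub>R y0"
      by (auto intro!: integral_eq_zero_AE elim!: eventually_mono)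
    then show ?thesis
      using conical_hull_scaleR[of 0 y0 Y] y0 convex_hull_subset_conical_hull[of Y] by auto
  next
    case False
    define D where "D = density m (\<lambda>_. ennreal (1 / measure m (space m)))"
    note norm = finite_measure_normalize[OF fin False, folded D_def]
    interpret D: prob_space D by (rule norm(1))
    have "(\<integral>y. y \<partial>D) \<in> convex hull Y"
    proof (rule D.integral_in_closed_convex)
      show "closed (convex hull Y)" by (intro compact_imp_closed compact_convex_hull Y)
      show "AE y in D. y \<in> convex hull Y"
        using sp hull_subset[of Y convex] by (intro AE_I2) (auto simp: D_def)
      show "integrable D (\<lambda>y. y)" by (rule norm(2)[OF int])
    qed (rule convex_convex_hull)
    then have "(\<integral>y. y \<partial>D) \<in> conical_hull Y" using convex_hull_subset_conical_hull by blast
    then have "measure m (space m) *\<^sub>R (\<integral>y. y \<partial>D) \<in> conical_hull Y"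
      by (rule conical_hull_scaleR[OF measure_nonneg])
    then show ?thesis using norm(3)[OF int] False by simp
  qed
qed

text \<open>The support is compact, so its convex hull is compact and strictly separated from 0. Its
  complement in \<open>Y\<close> is a union of open null sets, which Lindelof's theorem reduces to a
  countable union and hence to a null set.\<close>

lemma support_in_open_half_space:
  fixes Y :: "'e::euclidean_space set"
  assumes Y: "compact Y" and \<nu>: "\<nu> \<in> borel_prob_measures Y" and supp: "0 \<notin> convex hull (measure_support \<nu>)"
  obtains w b where "0 < b" "AE y in \<nu>. b \<le> y \<bullet> w"
proof -
  have sets_\<nu>: "sets \<nu> = sets (restrict_space borel Y)"
    using \<nu> by (auto simp: borel_prob_measures_def)
  have sp: "space \<nu> = Y" using sets_eq_imp_space_eq[OF sets_\<nu>] by (simp add: space_restrict_space)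
  define F where "F = {U :: 'e set. open U \<and> emeasure \<nu> (U \<inter> Y) = 0}"
  have supp_eq: "measure_support \<nu> = Y - \<Union>F"
    unfolding measure_support_def F_def sp by (auto simp: zero_less_iff_neq_zero)
  have "open (\<Union>F)" by (intro open_Union) (auto simp: F_def)
  then have "compact (measure_support \<nu>)" unfolding supp_eq by (intro compact_diff Y)
  then have "closed (convex hull (measure_support \<nu>))"
    by (intro compact_imp_closed compact_convex_hull)
  then obtain w b where wb: "0 < b" "\<forall>y\<in>convex hull (measure_support \<nu>). b < w \<bullet> y"
    using separating_hyperplane_closed_0[OF convex_convex_hull _ supp] by blast
  obtain F' where F': "F' \<subseteq> F" "countable F'" "\<Union>F' = \<Union>F"
    by (rule Lindelof[of F]) (auto simp: F_def)
  have "(\<Union>U\<in>F'. U \<inter> Y) \<in> null_sets \<nu>"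
  proof (rule null_sets_UN'[OF F'(2)])
    fix U assume "U \<in> F'"
    then have "open U" "emeasure \<nu> (U \<inter> Y) = 0" using F'(1) by (auto simp: F_def)
    moreover have "U \<inter> Y \<in> sets \<nu>"
      using \<open>open U\<close> unfolding sets_\<nu> sets_restrict_space by (auto simp: Int_commute)
    ultimately show "U \<inter> Y \<in> null_sets \<nu>" by (simp add: null_sets_def)
  qed
  then have "AE y in \<nu>. y \<notin> (\<Union>U\<in>F'. U \<inter> Y)" by (rule AE_not_in)
  with AE_space have "AE y in \<nu>. b \<le> y \<bullet> w"
  proof eventually_elim
    case (elim y)
    then have "y \<in> measure_support \<nu>" using F'(3) by (auto simp: supp_eq sp)
    then have "y \<in> convex hull (measure_support \<nu>)" by (rule hull_inc)
    then show ?case using wb(2) by (auto simp: inner_commute less_imp_le)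
  qed
  then show thesis using that wb(1) by blast
qed

lemma ext_integral_eq_integral:
  assumes "integrable M f"
  shows "ext_integral M f = ereal (\<integral>x. f x \<partial>M)"
proof -
  have "(\<integral>\<^sup>+x. ennreal (f x) \<partial>M) \<noteq> \<infinity>" "(\<integral>\<^sup>+x. ennreal (- f x) \<partial>M) \<noteq> \<infinity>"
    using assms by (auto simp: real_integrable_def)
  then show ?thesis
    unfolding ext_integral_def real_lebesgue_integral_def[OF assms]
    by (cases "\<integral>\<^sup>+x. ennreal (f x) \<partial>M"; cases "\<integral>\<^sup>+x. ennreal (- f x) \<partial>M") (auto simp: enn2ereal_ennreal)
qed

section \<open>Comparison of the transport costs\<close>

lemma borel_prob_measuresD:
  assumes "M \<in> borel_prob_measures E"
  shows "prob_space M" "sets M = sets (restrict_space borel E)" "space M = E"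
  using assms sets_eq_imp_space_eq[of M "restrict_space borel E"]
  by (auto simp: borel_prob_measures_def space_restrict_space)

lemma transport_kernels_iff:
  assumes \<mu>: "\<mu> \<in> borel_prob_measures X" and \<nu>: "\<nu> \<in> borel_prob_measures Y"
  shows "q \<in> transport_kernels \<mu> \<nu> \<longleftrightarrow>
    (\<forall>x\<in>space \<mu>. finite_measure (q x) \<and> sets (q x) = sets \<nu>) \<and>
    (\<forall>B\<in>sets \<nu>. (\<lambda>x. emeasure (q x) B) \<in> borel_measurable \<mu> \<and>
      (\<integral>\<^sup>+x. emeasure (q x) B \<partial>\<mu>) = emeasure \<nu> B)"
  using borel_prob_measuresD[OF \<mu>] borel_prob_measuresD[OF \<nu>]
  unfolding transport_kernels_def nonneg_kernels_def borel_finite_measures_def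
  by (auto cong: measurable_cong_sets)

text \<open>Sublinearity gives Jensen's inequality for each \<open>q x\<close> whatever its mass;
  integration over \<open>\<mu>\<close> then turns the averaged kernel into \<open>\<nu>\<close>.
  Compactness of \<open>Y\<close> supplies the first moments.\<close>

lemma
  fixes Y :: "'e::euclidean_space set" and \<mu> :: "'x::topological_space measure"
  assumes Y: "compact Y" and \<mu>: "\<mu> \<in> borel_prob_measures X" and \<nu>: "\<nu> \<in> borel_prob_measures Y"
    and q: "q \<in> transport_kernels \<mu> \<nu>"
  shows transport_kernels_barycenter_in: "x \<in> X \<Longrightarrow> (\<integral>y. y \<partial>q x) \<in> conical_hull Y"
    and transport_kernels_integrable_barycenter: "integrable \<mu> (\<lambda>x. \<integral>y. y \<partial>q x)"
    and transport_kernels_barycenter_phc_le: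
      "phc_le (distr \<mu> (restrict_space borel (conical_hull Y)) (\<lambda>x. \<integral>y. y \<partial>q x)) \<nu>"
proof -
  note \<mu>' = borel_prob_measuresD[OF \<mu>] and \<nu>' = borel_prob_measuresD[OF \<nu>]
  interpret \<mu>: prob_space \<mu> by (rule \<mu>')
  interpret \<nu>: prob_space \<nu> by (rule \<nu>')
  have q_fin: "q x \<in> borel_finite_measures Y" if "x \<in> X" for x
    using q[unfolded transport_kernels_iff[OF \<mu> \<nu>]] that \<mu>' \<nu>' by (auto simp: borel_finite_measures_def)
  have K: "\<And>x. x \<in> space \<mu> \<Longrightarrow> sets (q x) = sets \<nu>"
    "\<And>B. B \<in> sets \<nu> \<Longrightarrow> (\<lambda>x. emeasure (q x) B) \<in> borel_measurable \<mu>"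
    "\<And>B. B \<in> sets \<nu> \<Longrightarrow> (\<integral>\<^sup>+x. emeasure (q x) B \<partial>\<mu>) = emeasure \<nu> B"
    using q[unfolded transport_kernels_iff[OF \<mu> \<nu>]] by auto
  have Y_ne: "Y \<noteq> {}" using \<nu>.not_empty \<nu>'(3) by simp
  define S where "S x = (\<integral>y. y \<partial>q x)" for x
  define Z where "Z = conical_hull Y"
  show S_Z: "x \<in> X \<Longrightarrow> (\<integral>y. y \<partial>q x) \<in> conical_hull Y" for x
    by (rule barycenter_in_conical_hull[OF Y Y_ne q_fin])
  have int_q: "x \<in> X \<Longrightarrow> integrable (q x) (\<lambda>y. y)" for x
    by (rule integrable_id_compact[OF Y q_fin])
  have \<nu>_fin: "\<nu> \<in> borel_finite_measures Y"
    using \<nu>' \<nu>.finite_measure_axioms by (simp add: borel_finite_measures_def)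
  have int_\<nu>: "integrable \<nu> (\<lambda>y. y)" by (rule integrable_id_compact[OF Y \<nu>_fin])
  have S_meas [measurable]: "S \<in> borel_measurable \<mu>"
  proof (subst borel_measurable_euclidean_space, intro ballI)
    fix v :: 'e assume "v \<in> Basis"
    have "(\<lambda>x. \<integral>y. y \<bullet> v \<partial>q x) \<in> borel_measurable \<mu>"
      by (rule borel_measurable_kernel_integral[OF K(1,2)])
        (auto intro!: borel_measurable_integrable integrable_inner_left int_\<nu>)
    moreover have "S x \<bullet> v = (\<integral>y. y \<bullet> v \<partial>q x)" if "x \<in> space \<mu>" for x
      using int_q[of x] \<mu>'(3) that by (simp add: S_def)
    ultimately show "(\<lambda>x. S x \<bullet> v) \<in> borel_measurable \<mu>"
      by (subst measurable_cong)
  qed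
  have norm_S: "norm (S x) \<le> (\<integral>y. norm y \<partial>q x)" for x
    unfolding S_def by (rule integral_norm_bound)
  have int_norm: "integrable \<mu> (\<lambda>x. \<integral>y. norm y \<partial>q x)"
    by (rule integrable_kernel_integral[OF K]) (use int_\<nu> in auto)
  have int_S: "integrable \<mu> S"
    by (rule Bochner_Integration.integrable_bound[OF int_norm S_meas])
      (use norm_S in \<open>auto intro!: AE_I2 order_trans[OF _ abs_ge_self]\<close>)
  then show "integrable \<mu> (\<lambda>x. \<integral>y. y \<partial>q x)" unfolding S_def .
  define \<gamma> where "\<gamma> = distr \<mu> (restrict_space borel Z) S"
  have S_Z': "S \<in> \<mu> \<rightarrow>\<^sub>M restrict_space borel Z"
    using S_Z by (intro measurable_restrict_space2) (auto simp: \<mu>'(3) S_def Z_def)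
  have integral_\<gamma>: "(\<integral>z. \<phi> z \<partial>\<gamma>) = (\<integral>x. \<phi> (S x) \<partial>\<mu>)" if "\<phi> \<in> borel_measurable borel" for \<phi> :: "'e \<Rightarrow> real"
    unfolding \<gamma>_def using that by (intro integral_distr S_Z' measurable_restrict_space1)
  have "phc_le \<gamma> \<nu>"
    unfolding phc_le_def
  proof (intro conjI allI impI)
    show "prob_space \<gamma>" unfolding \<gamma>_def by (rule \<mu>.prob_space_distr[OF S_Z'])
    show "prob_space \<nu>" by (rule \<nu>')
    show "integrable \<gamma> norm"
      unfolding \<gamma>_def using int_S
      by (subst integrable_distr_eq[OF S_Z']) (auto intro!: measurable_restrict_space1)
    show "integrable \<nu> norm" using int_\<nu> by (rule integrable_norm)
    fix \<phi> :: "'e \<Rightarrow> real"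
    assume "convex_on UNIV \<phi> \<and> (\<forall>t\<ge>0. \<forall>x. \<phi> (t *\<^sub>R x) = t * \<phi> x)"
    then have \<phi>: "convex_on UNIV \<phi>" "\<And>t x. 0 \<le> t \<Longrightarrow> \<phi> (t *\<^sub>R x) = t * \<phi> x" by auto
    obtain K' where K': "\<And>x. \<bar>\<phi> x\<bar> \<le> K' * norm x"
      using sublinear_bound[of \<phi>] \<phi> by blast
    have "continuous_on UNIV \<phi>" by (rule convex_on_continuous[OF open_UNIV \<phi>(1)])
    then have \<phi>_meas [measurable]: "\<phi> \<in> borel_measurable borel" by (rule borel_measurable_continuous_onI)
    have int_\<phi>: "integrable m \<phi>" if m: "integrable m (\<lambda>y. y)" "sets m = sets (restrict_space borel Y)" for m
    proof (rule Bochner_Integration.integrable_bound)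
      show "integrable m (\<lambda>y. K' * norm y)" using m(1) by (intro integrable_mult_right integrable_norm)
      show "\<phi> \<in> borel_measurable m"
        unfolding measurable_cong_sets[OF m(2) refl] by (rule measurable_restrict_space1[OF \<phi>_meas])
      show "AE y in m. norm (\<phi> y) \<le> norm (K' * norm y)"
        using K' by (auto intro!: AE_I2 order_trans[OF _ abs_ge_self] simp del: abs_mult)
    qed
    have int_\<phi>_\<nu>: "integrable \<nu> \<phi>" by (rule int_\<phi>[OF int_\<nu> \<nu>'(2)])
    have "(\<integral>z. \<phi> z \<partial>\<gamma>) = (\<integral>x. \<phi> (S x) \<partial>\<mu>)" by (rule integral_\<gamma>[OF \<phi>_meas])
    also have "\<dots> \<le> (\<integral>x. \<integral>y. \<phi> y \<partial>q x \<partial>\<mu>)"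
    proof (rule integral_mono)
      show "integrable \<mu> (\<lambda>x. \<phi> (S x))"
      proof (rule Bochner_Integration.integrable_bound)
        show "integrable \<mu> (\<lambda>x. K' * norm (S x))" using int_S by (intro integrable_mult_right integrable_norm)
        show "AE x in \<mu>. norm (\<phi> (S x)) \<le> norm (K' * norm (S x))"
          using K' by (auto intro!: AE_I2 order_trans[OF _ abs_ge_self] simp del: abs_mult)
      qed measurable
      show "integrable \<mu> (\<lambda>x. \<integral>y. \<phi> y \<partial>q x)"
        by (rule integrable_kernel_integral[OF K int_\<phi>_\<nu>])
      fix x assume "x \<in> space \<mu>"
      then have x: "x \<in> X" using \<mu>'(3) by simp
      show "\<phi> (S x) \<le> (\<integral>y. \<phi> y \<partial>q x)"
        unfolding S_def using q_fin[OF x] int_q[OF x] \<phi>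
        by (intro sublinear_jensen int_\<phi>) (auto simp: borel_finite_measures_def)
    qed
    also have "\<dots> = (\<integral>y. \<phi> y \<partial>\<nu>)" by (rule integral_kernel[OF K int_\<phi>_\<nu>])
    finally show "(\<integral>z. \<phi> z \<partial>\<gamma>) \<le> (\<integral>y. \<phi> y \<partial>\<nu>)" .
  qed
  then show "phc_le (distr \<mu> (restrict_space borel (conical_hull Y)) (\<lambda>x. \<integral>y. y \<partial>q x)) \<nu>"
    unfolding \<gamma>_def S_def Z_def .
qed

text \<open>A countable supremum of jointly measurable functions. It is formed in
  \<open>ereal\<close>, where it always exists, and converted back because \<open>F\<close> is real
  on \<open>X \<times> Z\<close>.\<close>

lemma borel_measurable_SUP_affine:
  fixes F :: "'x::metric_space \<Rightarrow> 'e::euclidean_space \<Rightarrow> real"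
  assumes a: "\<And>k::nat. continuous_on X (a k)" and u: "\<And>k. continuous_on X (u k)"
    and F: "\<And>x z. x \<in> X \<Longrightarrow> z \<in> Z \<Longrightarrow> ereal (F x z) = (SUP k. ereal (u k x \<bullet> z + a k x))"
    and sets_\<mu>: "sets \<mu> = sets (restrict_space borel X)" and sets_\<gamma>: "sets \<gamma> = sets (restrict_space borel Z)"
  shows "(\<lambda>(x, z). F x z) \<in> borel_measurable (\<mu> \<Otimes>\<^sub>M \<gamma>)"
proof -
  have [measurable]: "a k \<in> borel_measurable \<mu>" "u k \<in> borel_measurable \<mu>" for k
    unfolding measurable_cong_sets[OF sets_\<mu> refl]
    by (intro borel_measurable_continuous_on_restrict a u)+
  have [measurable]: "(\<lambda>z. z) \<in> borel_measurable \<gamma>"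
    unfolding measurable_cong_sets[OF sets_\<gamma> refl] by (intro measurable_restrict_space1) simp
  have [measurable]: "snd \<in> borel_measurable (\<mu> \<Otimes>\<^sub>M \<gamma>)"
    using measurable_compose[OF measurable_snd[of \<mu> \<gamma>], of "\<lambda>z. z" borel] by simp
  have aff: "(\<lambda>p. u k (fst p) \<bullet> snd p + a k (fst p)) \<in> borel_measurable (\<mu> \<Otimes>\<^sub>M \<gamma>)" for k
    by measurable
  have sp: "space (\<mu> \<Otimes>\<^sub>M \<gamma>) = X \<times> Z"
    using sets_eq_imp_space_eq[OF sets_\<mu>] sets_eq_imp_space_eq[OF sets_\<gamma>]
    by (simp add: space_pair_measure space_restrict_space)
  have "(\<lambda>p. SUP k. ereal (u k (fst p) \<bullet> snd p + a k (fst p))) \<in> borel_measurable (\<mu> \<Otimes>\<^sub>M \<gamma>)"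
    by (intro borel_measurable_SUP borel_measurable_ereal aff) auto
  moreover have "ereal (F (fst p) (snd p)) = (SUP k. ereal (u k (fst p) \<bullet> snd p + a k (fst p)))"
    if "p \<in> space (\<mu> \<Otimes>\<^sub>M \<gamma>)" for p
    using that F[of "fst p" "snd p"] by (auto simp: sp)
  ultimately have "(\<lambda>p. ereal (F (fst p) (snd p))) \<in> borel_measurable (\<mu> \<Otimes>\<^sub>M \<gamma>)"
    by (subst measurable_cong) auto
  then have "(\<lambda>p. real_of_ereal (ereal (F (fst p) (snd p)))) \<in> borel_measurable (\<mu> \<Otimes>\<^sub>M \<gamma>)"
    by (rule borel_measurable_real_of_ereal)
  then show "(\<lambda>(x, z). F x z) \<in> borel_measurable (\<mu> \<Otimes>\<^sub>M \<gamma>)"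
    by (simp add: case_prod_beta)
qed

lemma classical_transport_cost_distr_le:
  assumes \<mu>: "prob_space \<mu>" and S: "S \<in> \<mu> \<rightarrow>\<^sub>M N"
    and F: "(\<lambda>(x, z). F x z) \<in> borel_measurable (\<mu> \<Otimes>\<^sub>M N)"
  shows "classical_transport_cost F \<mu> (distr \<mu> N S) \<le> ext_integral \<mu> (\<lambda>x. F x (S x))"
proof -
  interpret prob_space \<mu> by (rule \<mu>)
  define \<pi> where "\<pi> = distr \<mu> (\<mu> \<Otimes>\<^sub>M N) (\<lambda>x. (x, S x))"
  have g [measurable]: "(\<lambda>x. (x, S x)) \<in> \<mu> \<rightarrow>\<^sub>M \<mu> \<Otimes>\<^sub>M N" using S by measurable
  have "distr \<pi> \<mu> fst = distr \<mu> \<mu> (\<lambda>x. x)"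
    unfolding \<pi>_def by (subst distr_distr) (auto simp: comp_def)
  moreover have "distr \<pi> (distr \<mu> N S) snd = distr \<mu> N S"
  proof -
    have "distr \<pi> (distr \<mu> N S) snd = distr \<pi> N snd" by (rule distr_cong) auto
    also have "\<dots> = distr \<mu> N S"
      unfolding \<pi>_def by (subst distr_distr) (auto simp: comp_def)
    finally show ?thesis .
  qed
  moreover have "sets \<pi> = sets (\<mu> \<Otimes>\<^sub>M distr \<mu> N S)"
    unfolding \<pi>_def by (simp cong: sets_pair_measure_cong)
  moreover have "prob_space \<pi>" unfolding \<pi>_def by (rule prob_space_distr[OF g])
  ultimately have "\<pi> \<in> couplings \<mu> (distr \<mu> N S)"
    by (simp add: couplings_def distr_id2)
  then have "classical_transport_cost F \<mu> (distr \<mu> N S) \<le> ext_integral \<pi> (\<lambda>(x, z). F x z)"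
    unfolding classical_transport_cost_def by (rule INF_lower)
  also have "\<dots> = ext_integral \<mu> (\<lambda>x. F x (S x))"
    unfolding ext_integral_def \<pi>_def using F by (subst (1 2) nn_integral_distr[OF g]) (auto simp: case_prod_beta)
  finally show ?thesis .
qed

text \<open>\<open>barycentric_kernel\<close> is applied to the probability space
  \<open>\<pi>\<close> with \<open>p = fst\<close> and \<open>g = snd\<close>. Passing from
  \<open>snd\<close> to its conditional expectation given \<open>fst\<close> cannot increase a cost
  that is convex in \<open>z\<close>.\<close>

lemma kernel_transport_cost_le_coupling:
  fixes X :: "'x::metric_space set" and Y Z :: "'e::euclidean_space set"
    and a :: "nat \<Rightarrow> 'x \<Rightarrow> real" and u :: "nat \<Rightarrow> 'x \<Rightarrow> 'e"
  assumes X: "compact X" and Y: "compact Y" and Z: "Z = conical_hull Y"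
    and a: "\<And>k. continuous_on X (a k)" and u: "\<And>k. continuous_on X (u k)"
    and F: "\<And>x z. x \<in> X \<Longrightarrow> z \<in> Z \<Longrightarrow> ereal (F x z) = (SUP k. ereal (u k x \<bullet> z + a k x))"
    and c: "\<And>x m. x \<in> X \<Longrightarrow> m \<in> borel_finite_measures Y \<Longrightarrow> c x m = F x (\<integral>y. y \<partial>m)"
    and \<mu>: "\<mu> \<in> borel_prob_measures X" and \<nu>: "\<nu> \<in> borel_prob_measures Y"
    and supp: "0 \<notin> convex hull (measure_support \<nu>)"
    and \<gamma>: "\<gamma> \<in> borel_prob_measures Z" and phc: "phc_le \<gamma> \<nu>" and \<pi>: "\<pi> \<in> couplings \<mu> \<gamma>"
  shows "kernel_transport_cost c \<mu> \<nu> \<le> ext_integral \<pi> (\<lambda>(x, z). F x z)"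
proof (cases "(\<integral>\<^sup>+p. ennreal (F (fst p) (snd p)) \<partial>\<pi>) = \<infinity>")
  \<comment> \<open>In \<open>ereal\<close>, subtracting anything from \<open>\<infinity>\<close>,
    even \<open>\<infinity>\<close>, leaves \<open>\<infinity>\<close>.\<close>
  case True
  then show ?thesis by (simp add: ext_integral_def case_prod_beta)
next
  case False
  note \<mu>' = borel_prob_measuresD[OF \<mu>] and \<nu>' = borel_prob_measuresD[OF \<nu>] and \<gamma>' = borel_prob_measuresD[OF \<gamma>]
  interpret \<mu>: prob_space \<mu> by (rule \<mu>')
  interpret \<nu>: prob_space \<nu> by (rule \<nu>')
  have prob_\<pi>: "prob_space \<pi>" and sets_\<pi>: "sets \<pi> = sets (\<mu> \<Otimes>\<^sub>M \<gamma>)"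
    and fst_\<pi>: "distr \<pi> \<mu> fst = \<mu>" and snd_\<pi>: "distr \<pi> \<gamma> snd = \<gamma>"
    using \<pi> by (auto simp: couplings_def)
  interpret \<pi>: prob_space \<pi> by (rule prob_\<pi>)
  have space_\<pi>: "space \<pi> = X \<times> Z"
    using sets_eq_imp_space_eq[OF sets_\<pi>] by (simp add: space_pair_measure \<mu>'(3) \<gamma>'(3))
  have fst_meas [measurable]: "fst \<in> \<pi> \<rightarrow>\<^sub>M \<mu>" and snd_meas: "snd \<in> \<pi> \<rightarrow>\<^sub>M \<gamma>"
    by (simp_all add: measurable_cong_sets[OF sets_\<pi> refl])
  have m_\<pi>: "f \<in> borel_measurable \<pi>" if "f \<in> borel_measurable (\<mu> \<Otimes>\<^sub>M \<gamma>)" for f :: "'x \<times> 'e \<Rightarrow> real"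
    using that by (simp add: measurable_cong_sets[OF sets_\<pi> refl])
  have m_\<gamma>: "f \<in> borel_measurable \<gamma>" if "f \<in> borel_measurable borel" for f :: "'e \<Rightarrow> real"
    unfolding measurable_cong_sets[OF \<gamma>'(2) refl] by (rule measurable_restrict_space1[OF that])
  have [measurable]: "(\<lambda>z. z) \<in> borel_measurable \<gamma>"
    unfolding measurable_cong_sets[OF \<gamma>'(2) refl] by (intro measurable_restrict_space1) simp
  have "integrable \<gamma> (\<lambda>z. z)"
    using phc by (simp add: phc_le_def integrable_norm_iff)
  then have "integrable (distr \<pi> \<gamma> snd) (\<lambda>z. z)" unfolding snd_\<pi> .
  then have int_snd: "integrable \<pi> snd" by (subst (asm) integrable_distr_eq[OF snd_meas]) auto
  have order: "(\<integral>p. \<phi> (snd p) \<partial>\<pi>) \<le> (\<integral>y. \<phi> y \<partial>\<nu>)"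
    if \<phi>: "convex_on UNIV \<phi>" "\<And>t x. 0 \<le> t \<Longrightarrow> \<phi> (t *\<^sub>R x) = t * \<phi> x" for \<phi> :: "'e \<Rightarrow> real"
  proof -
    have "continuous_on UNIV \<phi>" by (rule convex_on_continuous[OF open_UNIV \<phi>(1)])
    then have "\<phi> \<in> borel_measurable borel" by (rule borel_measurable_continuous_onI)
    then have "(\<integral>z. \<phi> z \<partial>distr \<pi> \<gamma> snd) = (\<integral>p. \<phi> (snd p) \<partial>\<pi>)"
      by (intro integral_distr[OF snd_meas] m_\<gamma>)
    moreover have "(\<integral>z. \<phi> z \<partial>\<gamma>) \<le> (\<integral>y. \<phi> y \<partial>\<nu>)"
      using phc \<phi> unfolding phc_le_def by blast
    ultimately show ?thesis by (simp add: snd_\<pi>)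
  qed
  obtain w b where wb: "0 < b" "AE y in \<nu>. b \<le> y \<bullet> w"
    by (rule support_in_open_half_space[OF Y \<nu> supp])
  have int_\<nu>: "integrable \<nu> (\<lambda>y. y)"
    using \<nu>' \<nu>.finite_measure_axioms by (intro integrable_id_compact[OF Y]) (simp add: borel_finite_measures_def)
  have Y_ne: "Y \<noteq> {}" using \<nu>.not_empty \<nu>'(3) by simp
  obtain q where q: "\<And>x. sets (q x) = sets \<nu>" "\<And>x. finite_measure (q x)"
    "\<And>B. B \<in> sets \<nu> \<Longrightarrow> (\<lambda>x. emeasure (q x) B) \<in> borel_measurable \<mu>"
    "\<And>B. B \<in> sets \<nu> \<Longrightarrow> (\<integral>\<^sup>+x. emeasure (q x) B \<partial>\<mu>) = emeasure \<nu> B"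
    and bary: "\<And>A v. A \<in> sets \<mu> \<Longrightarrow>
      (\<integral>x. indicator A x * (\<integral>y. y \<bullet> v \<partial>q x) \<partial>\<mu>) = (\<integral>p. indicator A (fst p) * (snd p \<bullet> v) \<partial>\<pi>)"
    by (rule barycentric_kernel[OF \<mu>'(1) fst_meas fst_\<pi> int_snd compact_imp_closed[OF Y] Y_ne
        \<nu>.finite_measure_axioms \<nu>'(2) int_\<nu> order wb]) blast+
  have q_tk: "q \<in> transport_kernels \<mu> \<nu>"
    using q by (simp add: transport_kernels_iff[OF \<mu> \<nu>])
  have q_fin: "q x \<in> borel_finite_measures Y" for x
    using q(1,2)[of x] \<nu>'(2) by (simp add: borel_finite_measures_def)
  define S where "S x = (\<integral>y. y \<partial>q x)" for x
  have S_Z: "S x \<in> Z" if "x \<in> X" for x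
    unfolding S_def Z by (rule transport_kernels_barycenter_in[OF Y \<mu> \<nu> q_tk that])
  have int_S: "integrable \<mu> S"
    unfolding S_def by (rule transport_kernels_integrable_barycenter[OF Y \<mu> \<nu> q_tk])
  then have [measurable]: "S \<in> borel_measurable \<mu>" by auto
  have S_inner: "S x \<bullet> v = (\<integral>y. y \<bullet> v \<partial>q x)" for x v
    unfolding S_def using integrable_id_compact[OF Y q_fin] by simp
  have bary': "(\<integral>x. indicator A x * (S x \<bullet> v) \<partial>\<mu>) = (\<integral>p. indicator A (fst p) * (snd p \<bullet> v) \<partial>\<pi>)"
    if "A \<in> sets \<mu>" for A v
    using bary[OF that] by (simp add: S_inner)
  have to_\<pi>: "(\<integral>p. f (fst p) \<partial>\<pi>) = (\<integral>x. f x \<partial>\<mu>)" if "f \<in> borel_measurable \<mu>" for f :: "'x \<Rightarrow> real"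
    using integral_distr[OF fst_meas that] by (simp add: fst_\<pi>)
  have int_to_\<pi>: "integrable \<pi> (\<lambda>p. f (fst p)) \<longleftrightarrow> integrable \<mu> f" if "f \<in> borel_measurable \<mu>"
    for f :: "'x \<Rightarrow> real"
    using integrable_distr_eq[OF fst_meas that] by (simp add: fst_\<pi>)
  have am [measurable]: "a k \<in> borel_measurable \<mu>" and um [measurable]: "u k \<in> borel_measurable \<mu>" for k
    unfolding measurable_cong_sets[OF \<mu>'(2) refl]
    by (intro borel_measurable_continuous_on_restrict a u)+
  have a_bdd: "\<exists>B. \<forall>x\<in>X. \<bar>a k x\<bar> \<le> B" for k
    using compact_imp_bounded[OF compact_continuous_image[OF a X]] by (auto simp: bounded_iff)
  have u_bdd: "\<exists>B. \<forall>x\<in>X. norm (u k x) \<le> B" for k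
    using compact_imp_bounded[OF compact_continuous_image[OF u X]] by (auto simp: bounded_iff)
  have int_a: "integrable \<mu> (a k)" for k
  proof -
    obtain B where "\<forall>x\<in>X. \<bar>a k x\<bar> \<le> B" using a_bdd by blast
    then show ?thesis by (intro \<mu>.integrable_const_bound[of _ B] AE_I2) (auto simp: \<mu>'(3))
  qed

  \<comment> \<open>\<open>S\<close> is the conditional expectation of \<open>z\<close> given \<open>x\<close>, so \<open>F x (S x)\<close> is bounded by the conditional
    expectation of \<open>F x z\<close> because \<open>F x\<close> is a supremum of countably many affine functions.\<close>
  define G where "G = vimage_algebra (space \<pi>) fst \<mu>"
  have sets_G: "sets G = {fst -` A \<inter> space \<pi> | A. A \<in> sets \<mu>}"
    unfolding G_def by (rule sets_vimage_algebra2) (auto simp: \<mu>'(3) space_\<pi>)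
  have "subalgebra \<pi> G"
    unfolding subalgebra_def sets_G using measurable_sets[OF fst_meas] by (auto simp: G_def)
  then interpret G: finite_measure_subalgebra \<pi> G
    by unfold_locales
  have fst_G: "fst \<in> G \<rightarrow>\<^sub>M \<mu>"
    unfolding G_def by (rule measurable_vimage_algebra1) (auto simp: \<mu>'(3) space_\<pi>)
  have on_G: "(\<lambda>p. f (fst p)) \<in> borel_measurable G" if "f \<in> borel_measurable \<mu>" for f :: "'x \<Rightarrow> real"
    by (rule measurable_compose[OF fst_G that])
  have cond_snd: "AE p in \<pi>. real_cond_exp \<pi> G (\<lambda>p. snd p \<bullet> v) p = S (fst p) \<bullet> v" for v
  proof (rule G.real_cond_exp_charact)
    show "integrable \<pi> (\<lambda>p. snd p \<bullet> v)" using int_snd by simp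
    show "integrable \<pi> (\<lambda>p. S (fst p) \<bullet> v)"
      by (subst int_to_\<pi>) (use int_S in auto)
    show "(\<lambda>p. S (fst p) \<bullet> v) \<in> borel_measurable G" by (rule on_G) measurable
    fix B assume "B \<in> sets G"
    then obtain A where A: "A \<in> sets \<mu>" "B = fst -` A \<inter> space \<pi>"
      by (auto simp: sets_G)
    have "(\<integral>p\<in>B. S (fst p) \<bullet> v \<partial>\<pi>) = (\<integral>p. indicator A (fst p) * (S (fst p) \<bullet> v) \<partial>\<pi>)"
      unfolding set_lebesgue_integral_def A(2)
      by (intro Bochner_Integration.integral_cong) (auto simp: indicator_def)
    also have "\<dots> = (\<integral>x. indicator A x * (S x \<bullet> v) \<partial>\<mu>)"
      using A(1) by (intro to_\<pi> borel_measurable_times borel_measurable_indicator borel_measurable_inner) auto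
    also have "\<dots> = (\<integral>p. indicator A (fst p) * (snd p \<bullet> v) \<partial>\<pi>)" by (rule bary'[OF A(1)])
    also have "\<dots> = (\<integral>p\<in>B. snd p \<bullet> v \<partial>\<pi>)"
      unfolding set_lebesgue_integral_def A(2)
      by (intro Bochner_Integration.integral_cong) (auto simp: indicator_def)
    finally show "(\<integral>p\<in>B. snd p \<bullet> v \<partial>\<pi>) = (\<integral>p\<in>B. S (fst p) \<bullet> v \<partial>\<pi>)" by simp
  qed
  define h where "h k p = u k (fst p) \<bullet> snd p + a k (fst p)" for k p
  \<comment> \<open>Factors depending on \<open>x\<close> are pulled out of the conditional
    expectation one coordinate at a time; \<open>u k\<close> is bounded on the compact set
    \<open>X\<close>, so the products are integrable.\<close>
  have int_uv: "integrable \<pi> (\<lambda>p. (u k (fst p) \<bullet> v) * (snd p \<bullet> v))" if "v \<in> Basis" for k v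
  proof -
    obtain B where B: "\<forall>x\<in>X. norm (u k x) \<le> B" using u_bdd by blast
    show ?thesis
    proof (rule Bochner_Integration.integrable_bound)
      show "integrable \<pi> (\<lambda>p. B * norm (snd p))" using int_snd by (intro integrable_mult_right integrable_norm)
      show "(\<lambda>p. (u k (fst p) \<bullet> v) * (snd p \<bullet> v)) \<in> borel_measurable \<pi>"
        using borel_measurable_integrable[OF int_snd] by measurable
      have "\<bar>u k (fst p) \<bullet> v\<bar> * \<bar>snd p \<bullet> v\<bar> \<le> B * norm (snd p)" if p: "p \<in> space \<pi>" for p
      proof (rule mult_mono)
        have "\<bar>u k (fst p) \<bullet> v\<bar> \<le> norm (u k (fst p))" by (rule Basis_le_norm[OF \<open>v \<in> Basis\<close>])
        also have "\<dots> \<le> B" using B p by (auto simp: space_\<pi>)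
        finally show "\<bar>u k (fst p) \<bullet> v\<bar> \<le> B" .
        then show "0 \<le> B" by linarith
        show "\<bar>snd p \<bullet> v\<bar> \<le> norm (snd p)" by (rule Basis_le_norm[OF \<open>v \<in> Basis\<close>])
      qed simp
      then have "norm ((u k (fst p) \<bullet> v) * (snd p \<bullet> v)) \<le> norm (B * norm (snd p))" if "p \<in> space \<pi>" for p
        unfolding real_norm_def abs_mult[of "u k (fst p) \<bullet> v"]
        using that by (intro order_trans[OF _ abs_ge_self])
      then show "AE p in \<pi>. norm ((u k (fst p) \<bullet> v) * (snd p \<bullet> v)) \<le> norm (B * norm (snd p))"
        by (rule AE_I2)
    qed
  qed
  have h_sum: "h k = (\<lambda>p. (\<Sum>v\<in>Basis. (u k (fst p) \<bullet> v) * (snd p \<bullet> v)) + a k (fst p))" for k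
    unfolding h_def by (subst euclidean_inner) (rule refl)
  have int_h: "integrable \<pi> (h k)" for k
    unfolding h_sum using int_uv int_a[of k] int_to_\<pi>[OF am[of k]]
    by (intro Bochner_Integration.integrable_add Bochner_Integration.integrable_sum) auto
  have cond_h: "AE p in \<pi>. real_cond_exp \<pi> G (h k) p = h k (fst p, S (fst p))" for k
  proof -
    let ?f = "\<lambda>v p. (u k (fst p) \<bullet> v) * (snd p \<bullet> v)"
    have 1: "AE p in \<pi>. real_cond_exp \<pi> G (?f v) p = (u k (fst p) \<bullet> v) * (S (fst p) \<bullet> v)" if "v \<in> Basis" for v
    proof -
      have "AE p in \<pi>. real_cond_exp \<pi> G (?f v) p = (u k (fst p) \<bullet> v) * real_cond_exp \<pi> G (\<lambda>p. snd p \<bullet> v) p"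
        using borel_measurable_integrable[OF int_snd]
        by (intro G.real_cond_exp_mult int_uv[OF that] on_G) auto
      with cond_snd[of v] show ?thesis by eventually_elim simp
    qed
    then have "AE p in \<pi>. \<forall>v\<in>Basis. real_cond_exp \<pi> G (?f v) p = (u k (fst p) \<bullet> v) * (S (fst p) \<bullet> v)"
      by (subst AE_finite_all) auto
    \<comment> \<open>The guard makes the family integrable at all indices, including those outside
      \<open>Basis\<close>; within the sum it changes nothing.\<close>
    moreover have "AE p in \<pi>. real_cond_exp \<pi> G (\<lambda>p. \<Sum>v\<in>Basis. (if v \<in> Basis then ?f v p else 0)) p =
        (\<Sum>v\<in>Basis. real_cond_exp \<pi> G (\<lambda>p. if v \<in> Basis then ?f v p else 0) p)"
    proof (rule G.real_cond_exp_sum)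
      show "integrable \<pi> (\<lambda>p. if v \<in> Basis then ?f v p else 0)" for v
        by (cases "v \<in> Basis") (simp_all add: int_uv)
    qed
    moreover have "AE p in \<pi>. real_cond_exp \<pi> G (h k) p =
        real_cond_exp \<pi> G (\<lambda>p. \<Sum>v\<in>Basis. ?f v p) p + real_cond_exp \<pi> G (\<lambda>p. a k (fst p)) p"
      unfolding h_sum using int_uv int_a[of k] int_to_\<pi>[OF am[of k]]
      by (intro G.real_cond_exp_add Bochner_Integration.integrable_sum) auto
    moreover have "AE p in \<pi>. real_cond_exp \<pi> G (\<lambda>p. a k (fst p)) p = a k (fst p)"
      using int_a[of k] int_to_\<pi>[OF am[of k]] by (intro G.real_cond_exp_F_meas on_G am) auto
    ultimately show ?thesis
      by eventually_elim (simp add: h_sum)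
  qed

  have F_eq: "ereal (F x z) = (SUP k. ereal (h k (x, z)))" if "x \<in> X" "z \<in> Z" for x z
    using F[OF that] by (simp add: h_def)
  have h_le_F: "h k (x, z) \<le> F x z" if "x \<in> X" "z \<in> Z" for k x z
    using SUP_upper[of k UNIV "\<lambda>k. ereal (h k (x, z))"] unfolding F_eq[OF that, symmetric] by simp
  have F_meas [measurable]: "(\<lambda>p. F (fst p) (snd p)) \<in> borel_measurable (\<mu> \<Otimes>\<^sub>M N)"
    if "sets N = sets (restrict_space borel Z)" for N
    using borel_measurable_SUP_affine[OF a u F \<mu>'(2) that] by (simp add: case_prod_beta)
  \<comment> \<open>The affine minorant \<open>h 0\<close> controls the negative part; the positive
    part is finite in the present case.\<close>
  have int_F: "integrable \<pi> (\<lambda>p. F (fst p) (snd p))"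
    unfolding real_integrable_def
  proof (intro conjI)
    show "(\<lambda>p. F (fst p) (snd p)) \<in> borel_measurable \<pi>" by (rule m_\<pi>[OF F_meas[OF \<gamma>'(2)]])
    show "(\<integral>\<^sup>+p. ennreal (F (fst p) (snd p)) \<partial>\<pi>) \<noteq> \<infinity>" by (rule False)
    have "(\<integral>\<^sup>+p. ennreal (- F (fst p) (snd p)) \<partial>\<pi>) \<le> (\<integral>\<^sup>+p. ennreal (- h 0 p) \<partial>\<pi>)"
      using h_le_F[of _ _ 0] by (intro nn_integral_mono ennreal_leI) (auto simp: space_\<pi>)
    moreover have "(\<integral>\<^sup>+p. ennreal (- h 0 p) \<partial>\<pi>) \<noteq> \<infinity>" using int_h[of 0] by (simp add: real_integrable_def)
    ultimately show "(\<integral>\<^sup>+p. ennreal (- F (fst p) (snd p)) \<partial>\<pi>) \<noteq> \<infinity>" by (auto simp: top_unique)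
  qed
  let ?E = "real_cond_exp \<pi> G (\<lambda>p. F (fst p) (snd p))"
  have FS_meas: "(\<lambda>x. F x (S x)) \<in> borel_measurable \<mu>"
  proof -
    have "S \<in> \<mu> \<rightarrow>\<^sub>M restrict_space borel Z"
      by (rule measurable_restrict_space2) (auto simp: \<mu>'(3) S_Z)
    then have "(\<lambda>x. (x, S x)) \<in> \<mu> \<rightarrow>\<^sub>M \<mu> \<Otimes>\<^sub>M restrict_space borel Z" by measurable
    from measurable_compose[OF this F_meas[OF refl]] show ?thesis by simp
  qed
  have "AE p in \<pi>. \<forall>k. real_cond_exp \<pi> G (h k) p \<le> ?E p"
    unfolding AE_all_countable
    using h_le_F by (intro allI G.real_cond_exp_mono int_F int_h AE_I2) (auto simp: space_\<pi>)
  moreover have "AE p in \<pi>. \<forall>k. real_cond_exp \<pi> G (h k) p = h k (fst p, S (fst p))"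
    unfolding AE_all_countable using cond_h by blast
  ultimately have le_E: "AE p in \<pi>. F (fst p) (S (fst p)) \<le> ?E p"
    using AE_space
  proof eventually_elim
    case (elim p)
    then have p: "fst p \<in> X" by (auto simp: space_\<pi>)
    have "ereal (F (fst p) (S (fst p))) \<le> ereal (?E p)"
      unfolding F_eq[OF p S_Z[OF p]] using elim by (intro SUP_least) auto
    then show ?case by simp
  qed
  have int_E: "integrable \<pi> ?E" "(\<integral>p. ?E p \<partial>\<pi>) = (\<integral>p. F (fst p) (snd p) \<partial>\<pi>)"
    using G.real_cond_exp_int[OF int_F] by auto
  have int_h0: "integrable \<pi> (\<lambda>p. h 0 (fst p, S (fst p)))"
    using integrable_cong_AE_imp[OF G.real_cond_exp_int(1)[OF int_h[of 0]] _ cond_h[of 0]]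
    by (auto simp: h_def)
  \<comment> \<open>\<open>F x (S x)\<close> is squeezed between the integrable functions
    \<open>h 0\<close> at \<open>(x, S x)\<close> and the conditional expectation of the
    cost.\<close>
  have int_FS: "integrable \<pi> (\<lambda>p. F (fst p) (S (fst p)))"
  proof (rule Bochner_Integration.integrable_bound)
    show "integrable \<pi> (\<lambda>p. \<bar>?E p\<bar> + \<bar>h 0 (fst p, S (fst p))\<bar>)"
      by (intro Bochner_Integration.integrable_add integrable_abs int_E int_h0)
    show "(\<lambda>p. F (fst p) (S (fst p))) \<in> borel_measurable \<pi>"
      by (rule measurable_compose[OF fst_meas FS_meas])
    show "AE p in \<pi>. norm (F (fst p) (S (fst p))) \<le> norm (\<bar>?E p\<bar> + \<bar>h 0 (fst p, S (fst p))\<bar>)"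
      using le_E AE_space
    proof eventually_elim
      case (elim p)
      then have p: "fst p \<in> X" by (auto simp: space_\<pi>)
      show ?case using elim(1) h_le_F[OF p S_Z[OF p], of 0] by simp
    qed
  qed
  have "kernel_transport_cost c \<mu> \<nu> \<le> ext_integral \<mu> (\<lambda>x. c x (q x))"
    unfolding kernel_transport_cost_def by (rule INF_lower[OF q_tk])
  also have "\<dots> = ext_integral \<mu> (\<lambda>x. F x (S x))"
    unfolding ext_integral_def
    by (intro arg_cong2[where f="(-)"] arg_cong[where f=enn2ereal] nn_integral_cong)
      (simp_all add: c[OF _ q_fin] \<mu>'(3) S_def)
  also have "\<dots> = ereal (\<integral>x. F x (S x) \<partial>\<mu>)"
    using int_FS int_to_\<pi>[OF FS_meas] by (intro ext_integral_eq_integral) simp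
  also have "(\<integral>x. F x (S x) \<partial>\<mu>) = (\<integral>p. F (fst p) (S (fst p)) \<partial>\<pi>)"
    by (rule to_\<pi>[OF FS_meas, symmetric])
  also have "\<dots> \<le> (\<integral>p. ?E p \<partial>\<pi>)"
    by (rule integral_mono_AE[OF int_FS int_E(1) le_E])
  also have "\<dots> = (\<integral>p. F (fst p) (snd p) \<partial>\<pi>)" by (rule int_E(2))
  also have "ereal \<dots> = ext_integral \<pi> (\<lambda>(x, z). F x z)"
    using ext_integral_eq_integral[OF int_F] by (simp add: split_beta')
  finally show ?thesis by simp
qed

theorem theorem5p4:
  fixes X :: "'x::metric_space set"
    and Y Z :: "'e::euclidean_space set"
    and F :: "'x \<Rightarrow> 'e \<Rightarrow> real"
    and a :: "nat \<Rightarrow> 'x \<Rightarrow> real"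
    and u :: "nat \<Rightarrow> 'x \<Rightarrow> 'e"
    and c :: "'x \<Rightarrow> 'e measure \<Rightarrow> real"
    and \<mu> :: "'x measure"
    and \<nu> :: "'e measure"
  assumes "compact X"
    and "compact Y"
    and "Z = conical_hull Y"
    and "\<And>k. continuous_on X (a k)"
    and "\<And>k. continuous_on X (u k)"
    and "\<And>x z. x \<in> X \<Longrightarrow> z \<in> Z \<Longrightarrow>
           ereal (F x z) = (SUP k. ereal (u k x \<bullet> z + a k x))"
    and "\<And>x m. x \<in> X \<Longrightarrow> m \<in> borel_finite_measures Y \<Longrightarrow> c x m = F x (\<integral>y. y \<partial>m)"
    and "\<mu> \<in> borel_prob_measures X"
    and "\<nu> \<in> borel_prob_measures Y"
    and "kernel_transport_cost c \<mu> \<nu> < \<infinity>"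
    and "0 \<notin> convex hull (measure_support \<nu>)"
  shows "kernel_transport_cost c \<mu> \<nu> =
           (INF \<gamma>\<in>{\<gamma> \<in> borel_prob_measures Z. phc_le \<gamma> \<nu>}. classical_transport_cost F \<mu> \<gamma>) \<and>
         (\<forall>q. kernel_solution c \<mu> \<nu> q \<longrightarrow>
           (let S = (\<lambda>x. \<integral>y. y \<partial>(q x));
                \<nu>' = distr \<mu> (restrict_space borel Z) S
            in phc_le \<nu>' \<nu> \<and>
               kernel_transport_cost c \<mu> \<nu> = ext_integral \<mu> (\<lambda>x. F x (S x)) \<and>
               ext_integral \<mu> (\<lambda>x. F x (S x)) =
                 (INF \<gamma>\<in>{\<gamma> \<in> borel_prob_measures Z. phc_le \<gamma> \<nu>}.
                    classical_transport_cost F \<mu> \<gamma>)))"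
proof -
  note Y = assms(2) and Z = assms(3) and a = assms(4) and u = assms(5) and F = assms(6) and c = assms(7)
    and \<mu> = assms(8) and \<nu> = assms(9)
  note \<mu>' = borel_prob_measuresD[OF \<mu>] and \<nu>' = borel_prob_measuresD[OF \<nu>]
  let ?I = "INF \<gamma>\<in>{\<gamma> \<in> borel_prob_measures Z. phc_le \<gamma> \<nu>}. classical_transport_cost F \<mu> \<gamma>"
  \<comment> \<open>\<open>c\<close> is specified only on \<open>X\<close> and on finite Borel
    measures on \<open>Y\<close>; membership in \<open>transport_kernels\<close> ensures both on
    \<open>space \<mu>\<close>.\<close>
  have cost_eq: "ext_integral \<mu> (\<lambda>x. c x (q x)) = ext_integral \<mu> (\<lambda>x. F x (\<integral>y. y \<partial>q x))"
    if q: "q \<in> transport_kernels \<mu> \<nu>" for q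
  proof -
    have "q x \<in> borel_finite_measures Y" if "x \<in> X" for x
      using q[unfolded transport_kernels_iff[OF \<mu> \<nu>]] that \<mu>' \<nu>' by (auto simp: borel_finite_measures_def)
    then show ?thesis
      unfolding ext_integral_def
      by (intro arg_cong2[where f="(-)"] arg_cong[where f=enn2ereal] nn_integral_cong)
        (simp_all add: c \<mu>'(3))
  qed
  have "?I \<le> ext_integral \<mu> (\<lambda>x. c x (q x))" if q: "q \<in> transport_kernels \<mu> \<nu>" for q
  proof -
    let ?S = "\<lambda>x. \<integral>y. y \<partial>q x"
    let ?\<gamma> = "distr \<mu> (restrict_space borel Z) ?S"
    have S: "?S \<in> \<mu> \<rightarrow>\<^sub>M restrict_space borel Z"
    proof (rule measurable_restrict_space2)
      show "?S \<in> space \<mu> \<rightarrow> Z"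
        using transport_kernels_barycenter_in[OF Y \<mu> \<nu> q] by (auto simp: \<mu>'(3) Z)
      show "?S \<in> borel_measurable \<mu>"
        by (rule borel_measurable_integrable[OF transport_kernels_integrable_barycenter[OF Y \<mu> \<nu> q]])
    qed
    have "phc_le ?\<gamma> \<nu>" unfolding Z by (rule transport_kernels_barycenter_phc_le[OF Y \<mu> \<nu> q])
    moreover have "?\<gamma> \<in> borel_prob_measures Z"
      using prob_space.prob_space_distr[OF \<mu>'(1) S] by (simp add: borel_prob_measures_def)
    ultimately have "?I \<le> classical_transport_cost F \<mu> ?\<gamma>" by (intro INF_lower) auto
    also have "\<dots> \<le> ext_integral \<mu> (\<lambda>x. F x (?S x))"
      by (rule classical_transport_cost_distr_le[OF \<mu>'(1) S borel_measurable_SUP_affine[OF a u F \<mu>'(2) refl]])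
    finally show ?thesis by (simp add: cost_eq[OF q])
  qed
  then have "?I \<le> kernel_transport_cost c \<mu> \<nu>"
    unfolding kernel_transport_cost_def by (rule INF_greatest)
  moreover have "kernel_transport_cost c \<mu> \<nu> \<le> ?I"
    unfolding classical_transport_cost_def
    using kernel_transport_cost_le_coupling[OF assms(1-9,11)] by (intro INF_greatest) auto
  ultimately have eq: "kernel_transport_cost c \<mu> \<nu> = ?I" by (rule antisym[rotated])
  \<comment> \<open>A solution is in particular a transport kernel, so its barycenters obey the
    order, and its cost, rewritten through \<open>F\<close>, equals the common value of the two
    infima.\<close>
  have "phc_le (distr \<mu> (restrict_space borel Z) (\<lambda>x. \<integral>y. y \<partial>q x)) \<nu>"
    and "kernel_transport_cost c \<mu> \<nu> = ext_integral \<mu> (\<lambda>x. F x (\<integral>y. y \<partial>q x))"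
    if "kernel_solution c \<mu> \<nu> q" for q
    using that transport_kernels_barycenter_phc_le[OF Y \<mu> \<nu>, of q] cost_eq[of q]
    by (auto simp: kernel_solution_def Z)
  with eq show ?thesis by (simp add: Let_def)
qed

end
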